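(* Let $\Gamma$ be a Coxeter diagram with associated Coxeter group $W$ and let $J\subseteq\Gamma_0$. Let $\mathcal{BH}$ be the Brink--Howlett groupoid associated to $J$ and let $\widetilde{\mathcal{BH}}$ be the wall-crossing groupoid of the Tits cone intersection of $J$ (whose objects are the chambers of $(\mathrm{Cone}(J)^\circ,\mathcal H^J)$). Define $\mathcal F:\widetilde{\mathcal{BH}}\to\mathcal{BH}$ by $\mathcal F(x,I)=I$ on objects and by sending the unique morphism $x^{-1}y\in\mathrm{Hom}_{\widetilde{\mathcal{BH}}}((x,I),(y,K))$ to $x^{-1}y\in\mathrm{Hom}_{\mathcal{BH}}(I,K)$. Then $\mathcal F$ is a well-defined functor and is a universal groupoid covering. The groupoid $\widetilde{\mathcal{BH}}$ is generated by the morphisms corresponding to simple wall crossings, i.e. the morphisms $v_{a,I}:(x,I)\to(xv_{a,I},I+a-\iota_{[I,a]}(a))$ between adjacent chambers. Moreover, the deck transformation group of $\mathcal F$ is $\mathrm{Deck}(\mathcal F)\cong N(W,J)$, so that $\mathcal{BH}$ is obtained as the quotient of $\widetilde{\mathcal{BH}}$ by $N(W,J)$.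
   Context: Coxeter notation. $\Gamma$ is a Coxeter diagram with finite vertex set $\Gamma_0$; $W$ is its Coxeter group with simple generators $s_i$ ($i\in\Gamma_0$) and length function $\ell$. $V=\bigoplus_{i\in\Gamma_0}\mathbb R\alpha_i$ is the standard geometric representation, $\Phi=\{w\cdot\alpha_i\}=\Phi^+\sqcup\Phi^-$ the roots, $\Theta=V^*$ the contragredient representation. For $I\subseteq\Gamma_0$: $I^c=\Gamma_0\setminus I$, $I+a=I\cup\{a\}$, $I-a=I\setminus\{a\}$, $W_I=\langle s_i: i\in I\rangle$. $N(W,J)=\mathrm{Norm}_W(W_J)/W_J$. Tits cone intersection. $H_\alpha=\{\varphi\in\Theta:\varphi(\alpha)=0\}$ for $\alpha\in\Phi$; $C=\{\varphi\in\Theta:\varphi(\alpha_i)>0\ \forall i\in\Gamma_0\}$; $\mathrm{Cone}=\bigcup_{w\in W}w\cdot\overline C$. For $I\subseteq\Gamma_0$: $\Theta_I=\{\varphi\in\Theta:\varphi(\alpha_i)=0\ \forall i\in I\}$, $C_I=\{\varphi\in\Theta_I:\varphi(\alpha_j)>0\ \forall j\in I^c\}$. $\mathrm{Cone}(J)=\mathrm{Cone}\cap\Theta_J$, with interior $\mathrm{Cone}(J)^\circ$ taken in $\Theta_J$; $\mathcal H^J=\{H_\alpha\cap\Theta_J:\alpha\in\Phi,\ \Theta_J\not\subseteq H_\alpha\}$. Chambers are the connected components of $\mathrm{Cone}(J)^\circ\setminus\bigcup_{H\in\mathcal H^J}H$. By a theorem of Iyama--Wemyss, $(x,I)\mapsto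 x\cdot C_I$ is a bijection from $\mathrm{Cham}(J)=\{(x,I): x\in W,\ I\subseteq\Gamma_0,\ W_Jx=xW_I,\ x\text{ of minimal length in }xW_I\}$ onto the set of chambers; the two sets are identified. Simple wall crossings. Two distinct chambers are adjacent if they share a common wall (a codimension-one intersection of the closure with a hyperplane of $\mathcal H^J$). For $a\in I^c$, $[I,a]$ is the vertex set of the connected component containing $a$ of the full subgraph of $\Gamma$ on $I+a$. If $W_K$ is finite, $w_K$ is its longest element and $\iota_K:K\to K$ is given by $w_K\cdot\alpha_k=-\alpha_{\iota_K(k)}$. If $W_{[I,a]}$ is finite, $v_{a,I}=w_{[I,a]-a}w_{[I,a]}\in W$. Known fact: if $(x,I)$ and $(y,K)$ are adjacent there is a unique $a\in I^c$ with $W_{[I,a]}$ finite and $(y,K)=\omega_{a,I}(x,I):=(xv_{a,I},I+a-\iota_{[I,a]}(a))$ (the simple wall crossing at $a$). Groupoids. Composition is written left to right. $\mathcal{BH}$: objects are the $I\subseteq\Gamma_0$ with $W_I$ conjugate to $W_J$ in $W$ ("associates of $J$"); $\mathrm{Hom}_{\mathcal{BH}}(I,K)=\{x\in W:\{\alpha_i: i\in I\}=\{x\cdot\alpha_k: k\in K\}\}$, with composition $(x,y)\mapsto xy$. $\widetilde{\mathcal{BH}}$: objects $\mathrm{Cham}(J)$; $\mathrm{Hom}((x,I),(y,K))$ is the singleton $\{x^{-1}y\}$, composition by multiplication in $W$. $N(W,J)$ acts on $\mathrm{Cham}(J)$ by $gW_J\cdot(x,I)=(y,I)$ with $y$ the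 minimal length element of $gxW_I$ (equivalently $x\cdot C_I\mapsto gx\cdot C_I$), and hence on $\widetilde{\mathcal{BH}}$. Coverings. A functor of groupoids $\mathcal F:\widetilde{\mathcal G}\to\mathcal G$ is a groupoid covering if for every morphism $\alpha:x\to y$ in $\mathcal G$ and $\tilde x\in\mathcal F^{-1}(x)$ there are unique $\tilde y$ and $\tilde\alpha:\tilde x\to\tilde y$ with $\mathcal F(\tilde\alpha)=\alpha$. It is universal if the vertex groups of $\widetilde{\mathcal G}$ are trivial. $\mathrm{Deck}(\mathcal F)$ is the group of automorphisms $\varphi$ of $\widetilde{\mathcal G}$ with $\mathcal F\circ\varphi=\mathcal F$ (strict equality). If a group $N$ acts on a groupoid $\mathcal G$ freely on objects, the quotient groupoid $\mathcal G/N$ has as objects and morphisms the $N$-orbits of objects and morphisms, with composition of $[\alpha]$ and $[\beta]$ defined through the unique representative of $[\beta]$ whose source is the target of $\alpha$. *)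

theory Defs
  imports
    "HOL-Analysis.Analysis"
    "HOL-Algebra.Group_Action"
    "HOL-Algebra.Generated_Groups"
begin

section \<open>Groupoids, coverings and quotients\<close>

text \<open>Composition is written left to right: \<open>cmp G a b\<close> is ``first \<open>a\<close>, then \<open>b\<close>''.\<close>

record ('o, 'a) groupoid_data =
  Ob :: "'o set"
  Ar :: "'a set"
  src :: "'a \<Rightarrow> 'o"
  tgt :: "'a \<Rightarrow> 'o"
  idn :: "'o \<Rightarrow> 'a"
  cmp :: "'a \<Rightarrow> 'a \<Rightarrow> 'a"

locale groupoid =
  fixes G :: "('o, 'a) groupoid_data"
  assumes src_closed: "a \<in> Ar G \<Longrightarrow> src G a \<in> Ob G"
    and tgt_closed: "a \<in> Ar G \<Longrightarrow> tgt G a \<in> Ob G"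
    and idn_closed: "x \<in> Ob G \<Longrightarrow> idn G x \<in> Ar G"
    and src_idn: "x \<in> Ob G \<Longrightarrow> src G (idn G x) = x"
    and tgt_idn: "x \<in> Ob G \<Longrightarrow> tgt G (idn G x) = x"
    and cmp_closed: "\<lbrakk>a \<in> Ar G; b \<in> Ar G; tgt G a = src G b\<rbrakk> \<Longrightarrow> cmp G a b \<in> Ar G"
    and src_cmp: "\<lbrakk>a \<in> Ar G; b \<in> Ar G; tgt G a = src G b\<rbrakk> \<Longrightarrow> src G (cmp G a b) = src G a"
    and tgt_cmp: "\<lbrakk>a \<in> Ar G; b \<in> Ar G; tgt G a = src G b\<rbrakk> \<Longrightarrow> tgt G (cmp G a b) = tgt G b"
    and cmp_assoc: "\<lbrakk>a \<in> Ar G; b \<in> Ar G; c \<in> Ar G; tgt G a = src G b; tgt G b = src G c\<rbrakk>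
      \<Longrightarrow> cmp G (cmp G a b) c = cmp G a (cmp G b c)"
    and idn_cmp: "a \<in> Ar G \<Longrightarrow> cmp G (idn G (src G a)) a = a"
    and cmp_idn: "a \<in> Ar G \<Longrightarrow> cmp G a (idn G (tgt G a)) = a"
    and inverse_ex: "a \<in> Ar G \<Longrightarrow> \<exists>b\<in>Ar G. src G b = tgt G a \<and> tgt G b = src G a \<and>
      cmp G a b = idn G (src G a) \<and> cmp G b a = idn G (tgt G a)"

text \<open>A functor is a pair (map on objects, map on morphisms).\<close>

locale groupoid_functor = G: groupoid G + H: groupoid H
  for G :: "('o, 'a) groupoid_data" and H :: "('p, 'b) groupoid_data" +
  fixes F :: "('o \<Rightarrow> 'p) \<times> ('a \<Rightarrow> 'b)"
  assumes ob_closed: "x \<in> Ob G \<Longrightarrow> fst F x \<in> Ob H"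
    and ar_closed: "a \<in> Ar G \<Longrightarrow> snd F a \<in> Ar H"
    and map_src: "a \<in> Ar G \<Longrightarrow> src H (snd F a) = fst F (src G a)"
    and map_tgt: "a \<in> Ar G \<Longrightarrow> tgt H (snd F a) = fst F (tgt G a)"
    and map_idn: "x \<in> Ob G \<Longrightarrow> snd F (idn G x) = idn H (fst F x)"
    and map_cmp: "\<lbrakk>a \<in> Ar G; b \<in> Ar G; tgt G a = src G b\<rbrakk>
      \<Longrightarrow> snd F (cmp G a b) = cmp H (snd F a) (snd F b)"

locale groupoid_iso = groupoid_functor G H F
  for G :: "('o, 'a) groupoid_data" and H :: "('p, 'b) groupoid_data"
    and F :: "('o \<Rightarrow> 'p) \<times> ('a \<Rightarrow> 'b)" +
  assumes bij_ob: "bij_betw (fst F) (Ob G) (Ob H)"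
    and bij_ar: "bij_betw (snd F) (Ar G) (Ar H)"

locale groupoid_covering = groupoid_functor G H F
  for G :: "('o, 'a) groupoid_data" and H :: "('p, 'b) groupoid_data"
    and F :: "('o \<Rightarrow> 'p) \<times> ('a \<Rightarrow> 'b)" +
  assumes unique_lift: "\<lbrakk>b \<in> Ar H; x \<in> Ob G; fst F x = src H b\<rbrakk>
    \<Longrightarrow> \<exists>!(p :: 'o \<times> 'a). snd p \<in> Ar G \<and> src G (snd p) = x \<and> tgt G (snd p) = fst p \<and> snd F (snd p) = b"

locale universal_groupoid_covering = groupoid_covering G H F
  for G :: "('o, 'a) groupoid_data" and H :: "('p, 'b) groupoid_data"
    and F :: "('o \<Rightarrow> 'p) \<times> ('a \<Rightarrow> 'b)" +
  assumes trivial_vertex_groups: "\<lbrakk>a \<in> Ar G; src G a = tgt G a\<rbrakk> \<Longrightarrow> a = idn G (src G a)"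

text \<open>Generation allows inverses, and identities as empty composites.\<close>

inductive_set subgroupoid_generated ::
  "('o, 'a) groupoid_data \<Rightarrow> 'a set \<Rightarrow> 'a set" for G S where
  gen: "a \<in> S \<Longrightarrow> a \<in> subgroupoid_generated G S"
| idn: "x \<in> Ob G \<Longrightarrow> idn G x \<in> subgroupoid_generated G S"
| cmp: "\<lbrakk>a \<in> subgroupoid_generated G S; b \<in> subgroupoid_generated G S; tgt G a = src G b\<rbrakk>
    \<Longrightarrow> cmp G a b \<in> subgroupoid_generated G S"
| inv: "\<lbrakk>a \<in> subgroupoid_generated G S; b \<in> Ar G; src G b = tgt G a; tgt G b = src G a;
      cmp G a b = idn G (src G a)\<rbrakk> \<Longrightarrow> b \<in> subgroupoid_generated G S"

definition generates_groupoid :: "('o, 'a) groupoid_data \<Rightarrow> 'a set \<Rightarrow> bool" where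
  "generates_groupoid G S \<longleftrightarrow> S \<subseteq> Ar G \<and> subgroupoid_generated G S = Ar G"

text \<open>Deck transformations are represented by extensional maps, so that equality in the group is
  equality of automorphisms.\<close>

definition deck_group ::
  "('o, 'a) groupoid_data \<Rightarrow> ('o \<Rightarrow> 'p) \<times> ('a \<Rightarrow> 'b) \<Rightarrow> (('o \<Rightarrow> 'o) \<times> ('a \<Rightarrow> 'a)) monoid" where
  "deck_group G F = \<lparr>
     carrier = {\<phi>. fst \<phi> \<in> extensional (Ob G) \<and> snd \<phi> \<in> extensional (Ar G) \<and> groupoid_iso G G \<phi> \<and>
       (\<forall>x\<in>Ob G. fst F (fst \<phi> x) = fst F x) \<and> (\<forall>a\<in>Ar G. snd F (snd \<phi> a) = snd F a)},
     mult = (\<lambda>\<phi> \<psi>. (compose (Ob G) (fst \<phi>) (fst \<psi>), compose (Ar G) (snd \<phi>) (snd \<psi>))),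
     one = (\<lambda>x\<in>Ob G. x, \<lambda>a\<in>Ar G. a)\<rparr>"

locale free_groupoid_action =
  G: groupoid G + ob: group_action N "Ob G" p + ar: group_action N "Ar G" q
  for N :: "('n, 'z) monoid_scheme" and G :: "('o, 'a) groupoid_data"
    and p :: "'n \<Rightarrow> 'o \<Rightarrow> 'o" and q :: "'n \<Rightarrow> 'a \<Rightarrow> 'a" +
  assumes acts_by_functors: "n \<in> carrier N \<Longrightarrow> groupoid_functor G G (p n, q n)"
    and free_on_objects: "\<lbrakk>n \<in> carrier N; x \<in> Ob G; p n x = x\<rbrakk> \<Longrightarrow> n = \<one>\<^bsub>N\<^esub>"

text \<open>If the action is free on objects, then orbits of composable morphisms do have representatives
  \<open>a\<close>, \<open>b\<close> with \<open>tgt a = src b\<close>, with \<open>b\<close> determined by \<open>a\<close>, and nothing below depends on the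
  choice of representatives.\<close>

definition quotient_groupoid ::
  "('n, 'z) monoid_scheme \<Rightarrow> ('n \<Rightarrow> 'o \<Rightarrow> 'o) \<Rightarrow> ('n \<Rightarrow> 'a \<Rightarrow> 'a) \<Rightarrow> ('o, 'a) groupoid_data
    \<Rightarrow> ('o set, 'a set) groupoid_data" where
  "quotient_groupoid N p q G = \<lparr>
     Ob = orbits N (Ob G) p,
     Ar = orbits N (Ar G) q,
     src = (\<lambda>A. orbit N p (src G (SOME a. a \<in> A))),
     tgt = (\<lambda>A. orbit N p (tgt G (SOME a. a \<in> A))),
     idn = (\<lambda>X. orbit N q (idn G (SOME x. x \<in> X))),
     cmp = (\<lambda>A B. let a = (SOME a. a \<in> A); b = (THE b. b \<in> B \<and> src G b = tgt G a)
                  in orbit N q (cmp G a b))\<rparr>"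


section \<open>Coxeter groups\<close>

text \<open>The vertex set is the finite type \<open>'v\<close>; \<open>m i j\<close> is the order of \<open>s\<^sub>i s\<^sub>j\<close>, with \<open>m i j = 2\<close>
  encoding the absence of an edge.\<close>

locale coxeter_diagram =
  fixes m :: "'v::finite \<Rightarrow> 'v \<Rightarrow> enat"
  assumes m_diag: "m i i = 1"
    and m_offdiag: "i \<noteq> j \<Longrightarrow> m i j \<ge> 2"
    and m_sym: "m i j = m j i"

text \<open>\<open>W = \<langle>s\<^sub>i | (s\<^sub>i s\<^sub>j)\<^bsup>m i j\<^esup> = 1 whenever m i j \<noteq> \<infinity>\<rangle>\<close>. The relators with \<open>i = j\<close> make the
  generators involutions, so words without formal inverses suffice.\<close>

inductive cox_step :: "('v \<Rightarrow> 'v \<Rightarrow> enat) \<Rightarrow> 'v list \<Rightarrow> 'v list \<Rightarrow> bool" for m where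
  relator: "m i j = enat k \<Longrightarrow> cox_step m (us @ concat (replicate k [i, j]) @ vs) (us @ vs)"

definition cox_rel :: "('v \<Rightarrow> 'v \<Rightarrow> enat) \<Rightarrow> ('v list \<times> 'v list) set" where
  "cox_rel m = {(us, vs). equivclp (cox_step m) us vs}"

definition cox_group :: "('v \<Rightarrow> 'v \<Rightarrow> enat) \<Rightarrow> 'v list set monoid" where
  "cox_group m = \<lparr>
     carrier = UNIV // cox_rel m,
     mult = (\<lambda>A B. \<Union>us\<in>A. \<Union>vs\<in>B. cox_rel m `` {us @ vs}),
     one = cox_rel m `` {[]}\<rparr>"

definition simple_gen :: "('v \<Rightarrow> 'v \<Rightarrow> enat) \<Rightarrow> 'v \<Rightarrow> 'v list set" where
  "simple_gen m i = cox_rel m `` {[i]}"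

definition cox_length :: "'v list set \<Rightarrow> nat" where
  "cox_length w = (LEAST n. \<exists>us\<in>w. length us = n)"

definition parabolic :: "('v \<Rightarrow> 'v \<Rightarrow> enat) \<Rightarrow> 'v set \<Rightarrow> 'v list set set" where
  "parabolic m I = generate (cox_group m) (simple_gen m ` I)"

definition longest :: "('v \<Rightarrow> 'v \<Rightarrow> enat) \<Rightarrow> 'v set \<Rightarrow> 'v list set" where
  "longest m K = (ARG_MAX cox_length w. w \<in> parabolic m K)"

definition NWJ :: "('v \<Rightarrow> 'v \<Rightarrow> enat) \<Rightarrow> 'v set \<Rightarrow> 'v list set set monoid" where
  "NWJ m J = (cox_group m)\<lparr>carrier := normalizer (cox_group m) (parabolic m J)\<rparr> Mod parabolic m J"


section \<open>The geometric representation and its dual\<close>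

abbreviation simple_root :: "'v::finite \<Rightarrow> real ^ 'v" (\<open>\<alpha>\<close>) where
  "\<alpha> i \<equiv> axis i 1"

definition cox_form :: "('v::finite \<Rightarrow> 'v \<Rightarrow> enat) \<Rightarrow> real ^ 'v \<Rightarrow> real ^ 'v \<Rightarrow> real" where
  "cox_form m u v = (\<Sum>i\<in>UNIV. \<Sum>j\<in>UNIV. u $ i * v $ j *
     (case m i j of enat k \<Rightarrow> - cos (pi / real k) | \<infinity> \<Rightarrow> - 1))"

definition simple_refl :: "('v::finite \<Rightarrow> 'v \<Rightarrow> enat) \<Rightarrow> 'v \<Rightarrow> real ^ 'v \<Rightarrow> real ^ 'v" where
  "simple_refl m i v = v - (2 * cox_form m (\<alpha> i) v) *\<^sub>R \<alpha> i"

text \<open>The action does not depend on the word chosen to represent \<open>w\<close>.\<close>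

definition geo_act :: "('v::finite \<Rightarrow> 'v \<Rightarrow> enat) \<Rightarrow> 'v list set \<Rightarrow> real ^ 'v \<Rightarrow> real ^ 'v" where
  "geo_act m w v = foldr (simple_refl m) (SOME us. us \<in> w) v"

definition roots :: "('v::finite \<Rightarrow> 'v \<Rightarrow> enat) \<Rightarrow> (real ^ 'v) set" where
  "roots m = {geo_act m w (\<alpha> i) | w i. w \<in> carrier (cox_group m)}"

type_synonym 'v dual = "(real ^ 'v) \<Rightarrow>\<^sub>L real"

definition dual_act :: "('v::finite \<Rightarrow> 'v \<Rightarrow> enat) \<Rightarrow> 'v list set \<Rightarrow> 'v dual \<Rightarrow> 'v dual" where
  "dual_act m w \<phi> = Blinfun (\<lambda>v. blinfun_apply \<phi> (geo_act m (inv\<^bsub>cox_group m\<^esub> w) v))"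


section \<open>The Tits cone intersection\<close>

definition hyp :: "real ^ 'v::finite \<Rightarrow> 'v dual set" where
  "hyp \<beta> = {\<phi>. blinfun_apply \<phi> \<beta> = 0}"

definition Theta :: "'v::finite set \<Rightarrow> 'v dual set" where
  "Theta I = {\<phi>. \<forall>i\<in>I. blinfun_apply \<phi> (\<alpha> i) = 0}"

definition Cface :: "'v::finite set \<Rightarrow> 'v dual set" where
  "Cface I = {\<phi>\<in>Theta I. \<forall>j\<in>- I. blinfun_apply \<phi> (\<alpha> j) > 0}"

definition Tits_cone :: "('v::finite \<Rightarrow> 'v \<Rightarrow> enat) \<Rightarrow> 'v dual set" where
  "Tits_cone m = (\<Union>w\<in>carrier (cox_group m).
     dual_act m w ` closure {\<phi>. \<forall>i. blinfun_apply \<phi> (\<alpha> i) > 0})"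

definition cone_interior :: "('v::finite \<Rightarrow> 'v \<Rightarrow> enat) \<Rightarrow> 'v set \<Rightarrow> 'v dual set" where
  "cone_interior m J = (top_of_set (Theta J)) interior_of (Tits_cone m \<inter> Theta J)"

definition arrangement :: "('v::finite \<Rightarrow> 'v \<Rightarrow> enat) \<Rightarrow> 'v set \<Rightarrow> 'v dual set set" where
  "arrangement m J = {hyp \<beta> \<inter> Theta J | \<beta>. \<beta> \<in> roots m \<and> \<not> Theta J \<subseteq> hyp \<beta>}"

definition chambers :: "('v::finite \<Rightarrow> 'v \<Rightarrow> enat) \<Rightarrow> 'v set \<Rightarrow> 'v dual set set" where
  "chambers m J = components (cone_interior m J - \<Union>(arrangement m J))"

text \<open>The closure of a chamber is a cone with apex \<open>0\<close>, so its intersection with a linear hyperplane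
  has codimension one exactly if the linear span of the intersection does.\<close>

definition walls :: "('v::finite \<Rightarrow> 'v \<Rightarrow> enat) \<Rightarrow> 'v set \<Rightarrow> 'v dual set \<Rightarrow> 'v dual set set" where
  "walls m J D = {closure D \<inter> H | H. H \<in> arrangement m J \<and> dim (closure D \<inter> H) + 1 = dim (Theta J)}"

definition adjacent :: "('v::finite \<Rightarrow> 'v \<Rightarrow> enat) \<Rightarrow> 'v set \<Rightarrow> 'v dual set \<Rightarrow> 'v dual set \<Rightarrow> bool" where
  "adjacent m J D E \<longleftrightarrow> D \<in> chambers m J \<and> E \<in> chambers m J \<and> D \<noteq> E \<and>
     walls m J D \<inter> walls m J E \<noteq> {}"

definition Cham :: "('v \<Rightarrow> 'v \<Rightarrow> enat) \<Rightarrow> 'v set \<Rightarrow> ('v list set \<times> 'v set) set" where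
  "Cham m J = {(x, I). x \<in> carrier (cox_group m) \<and>
     parabolic m J #>\<^bsub>cox_group m\<^esub> x = x <#\<^bsub>cox_group m\<^esub> parabolic m I \<and>
     (\<forall>y \<in> x <#\<^bsub>cox_group m\<^esub> parabolic m I. cox_length x \<le> cox_length y)}"

definition chamber_of :: "('v::finite \<Rightarrow> 'v \<Rightarrow> enat) \<Rightarrow> 'v list set \<times> 'v set \<Rightarrow> 'v dual set" where
  "chamber_of m = (\<lambda>(x, I). dual_act m x ` Cface I)"


section \<open>Simple wall crossings\<close>

definition component_of_vertex :: "('v \<Rightarrow> 'v \<Rightarrow> enat) \<Rightarrow> 'v set \<Rightarrow> 'v \<Rightarrow> 'v set" where
  "component_of_vertex m I a =
     {b. (a, b) \<in> {(i, j). i \<in> insert a I \<and> j \<in> insert a I \<and> m i j \<ge> 3}\<^sup>*}"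

definition opposition :: "('v::finite \<Rightarrow> 'v \<Rightarrow> enat) \<Rightarrow> 'v set \<Rightarrow> 'v \<Rightarrow> 'v" where
  "opposition m K k = (THE j. j \<in> K \<and> geo_act m (longest m K) (\<alpha> k) = - \<alpha> j)"

definition crossing_elt :: "('v \<Rightarrow> 'v \<Rightarrow> enat) \<Rightarrow> 'v \<Rightarrow> 'v set \<Rightarrow> 'v list set" where
  "crossing_elt m a I = longest m (component_of_vertex m I a - {a})
     \<otimes>\<^bsub>cox_group m\<^esub> longest m (component_of_vertex m I a)"

definition wall_crossing :: "('v::finite \<Rightarrow> 'v \<Rightarrow> enat) \<Rightarrow> 'v \<Rightarrow>
    'v list set \<times> 'v set \<Rightarrow> 'v list set \<times> 'v set" where
  "wall_crossing m a = (\<lambda>(x, I). (x \<otimes>\<^bsub>cox_group m\<^esub> crossing_elt m a I,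
     insert a I - {opposition m (component_of_vertex m I a) a}))"


section \<open>The two groupoids\<close>

text \<open>Hom sets of different pairs of objects may share elements of \<open>W\<close>, so a morphism is recorded
  as a triple (source, element of \<open>W\<close>, target).\<close>

definition BH :: "('v::finite \<Rightarrow> 'v \<Rightarrow> enat) \<Rightarrow> 'v set \<Rightarrow>
    ('v set, 'v set \<times> 'v list set \<times> 'v set) groupoid_data" where
  "BH m J = (let Assoc = {I. \<exists>g\<in>carrier (cox_group m).
         parabolic m I = g <#\<^bsub>cox_group m\<^esub> parabolic m J #>\<^bsub>cox_group m\<^esub> inv\<^bsub>cox_group m\<^esub> g} in \<lparr>
     Ob = Assoc,
     Ar = {(I, x, K). I \<in> Assoc \<and> K \<in> Assoc \<and> x \<in> carrier (cox_group m) \<and>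
       {\<alpha> i | i. i \<in> I} = {geo_act m x (\<alpha> k) | k. k \<in> K}},
     src = (\<lambda>(I, x, K). I),
     tgt = (\<lambda>(I, x, K). K),
     idn = (\<lambda>I. (I, \<one>\<^bsub>cox_group m\<^esub>, I)),
     cmp = (\<lambda>(I, x, K) (K', y, L). (I, x \<otimes>\<^bsub>cox_group m\<^esub> y, L))\<rparr>)"

type_synonym 'v cham_arrow =
  "('v list set \<times> 'v set) \<times> 'v list set \<times> ('v list set \<times> 'v set)"

definition BHt :: "('v \<Rightarrow> 'v \<Rightarrow> enat) \<Rightarrow> 'v set \<Rightarrow>
    ('v list set \<times> 'v set, 'v cham_arrow) groupoid_data" where
  "BHt m J = \<lparr>
     Ob = Cham m J,
     Ar = {(P, g, Q). P \<in> Cham m J \<and> Q \<in> Cham m J \<and>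
       g = inv\<^bsub>cox_group m\<^esub> (fst P) \<otimes>\<^bsub>cox_group m\<^esub> fst Q},
     src = (\<lambda>(P, g, Q). P),
     tgt = (\<lambda>(P, g, Q). Q),
     idn = (\<lambda>P. (P, \<one>\<^bsub>cox_group m\<^esub>, P)),
     cmp = (\<lambda>(P, g, Q) (Q', h, R). (P, g \<otimes>\<^bsub>cox_group m\<^esub> h, R))\<rparr>"

definition BH_functor :: "('v list set \<times> 'v set \<Rightarrow> 'v set) \<times>
    ('v cham_arrow \<Rightarrow> 'v set \<times> 'v list set \<times> 'v set)" where
  "BH_functor = ((\<lambda>(x, I). I), (\<lambda>((x, I), g, (y, K)). (I, g, K)))"

definition simple_wall_crossings ::
  "('v::finite \<Rightarrow> 'v \<Rightarrow> enat) \<Rightarrow> 'v set \<Rightarrow> 'v cham_arrow set" where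
  "simple_wall_crossings m J =
     {((x, I), crossing_elt m a I, wall_crossing m a (x, I)) | x I a.
        (x, I) \<in> Cham m J \<and> a \<in> - I \<and> finite (parabolic m (component_of_vertex m I a)) \<and>
        adjacent m J (chamber_of m (x, I)) (chamber_of m (wall_crossing m a (x, I)))}"

text \<open>For \<open>n = gW\<^sub>J\<close> in \<open>N(W,J)\<close> and \<open>(x, I)\<close> in \<open>Cham(J)\<close> the set \<open>n x W\<^sub>I\<close> equals \<open>g x W\<^sub>I\<close>, because
  \<open>W\<^sub>J x = x W\<^sub>I\<close>; its minimal length element is unique.\<close>

definition N_act_ob :: "('v \<Rightarrow> 'v \<Rightarrow> enat) \<Rightarrow> 'v set \<Rightarrow> 'v list set set \<Rightarrow>
    'v list set \<times> 'v set \<Rightarrow> 'v list set \<times> 'v set" where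
  "N_act_ob m J n = (\<lambda>P\<in>Cham m J.
     (ARG_MIN cox_length y. y \<in> n <#>\<^bsub>cox_group m\<^esub> (fst P <#\<^bsub>cox_group m\<^esub> parabolic m (snd P)), snd P))"

definition N_act_ar :: "('v \<Rightarrow> 'v \<Rightarrow> enat) \<Rightarrow> 'v set \<Rightarrow> 'v list set set \<Rightarrow>
    'v cham_arrow \<Rightarrow> 'v cham_arrow" where
  "N_act_ar m J n = (\<lambda>f\<in>Ar (BHt m J).
     let P = N_act_ob m J n (src (BHt m J) f); Q = N_act_ob m J n (tgt (BHt m J) f)
     in (P, inv\<^bsub>cox_group m\<^esub> (fst P) \<otimes>\<^bsub>cox_group m\<^esub> fst Q, Q))"

end

theory Submission
  imports Defs "HOL-Algebra.Zassenhaus"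
begin

text \<open>By minimality of coset representatives, \<open>Cham(J)\<close> is the set of pairs \<open>(x, I)\<close> for which \<open>x\<close> maps
  the simple roots of \<open>I\<close> onto those of \<open>J\<close>, that is, the set of arrows of the Brink--Howlett groupoid
  at \<open>J\<close>. So the wall-crossing groupoid is the universal cover of that groupoid based at \<open>J\<close>, and its
  deck group is the vertex group at \<open>J\<close>, which is \<open>N(W,J)\<close> because every coset in the normalizer has a
  unique representative permuting the simple roots of \<open>J\<close>. That the \<open>x C\<^sub>I\<close> are the chambers follows from
  Tits' fundamental domain argument: a point of the cone in \<open>\<Theta>\<^sub>J\<close> off all hyperplanes lies in some \<open>w C\<^sub>I\<close>,
  and the roots vanishing there force \<open>w\<close> to conjugate \<open>W\<^sub>I\<close> to \<open>W\<^sub>J\<close>. For generation, if \<open>g\<close> maps the simple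
  roots of \<open>K\<close> to simple roots and \<open>a\<close> is a right descent of \<open>g\<close>, the component \<open>[K,a]\<close> is spherical and
  \<open>g v\<close> is shorter than \<open>g\<close> for the crossing element \<open>v\<close> of \<open>K\<close> at \<open>a\<close>.\<close>

section \<open>Groupoids and quotients by free actions\<close>

text \<open>The definitions speak of words, lengths and cosets, whereas the arguments run through
  signs of roots. The bridge is that \<open>\<rho> w (\<alpha> i)\<close> is nonnegative or
  nonpositive according to whether \<open>sg i\<close> lengthens or shortens \<open>w\<close>, which
  is derived from the presentation by explicit computation in rank two. The coset equation in
  \<open>Cham\<close> becomes a condition on coordinate subspaces: an element of
  \<open>par J\<close> changes a vector only in the coordinates from \<open>J\<close>, so whatever
  it negates lies in \<open>coord_space J\<close>. A group element that carries one coordinate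
  subspace onto another and is positive on the simple roots of the first must then match simple
  roots, since a simple root does not decompose into other positive vectors. Sphericality of a
  component is extracted from the descent: a group element inverts only finitely many positive
  roots, and enough roots of the component are shown to be inverted. The quotient groupoid picks
  representatives with \<open>SOME\<close> and \<open>THE\<close>, so its laws are pulled back along
  the bijection with \<open>BH\<close> instead of being checked on orbits.\<close>

lemma generated_sub: "S \<subseteq> Ar H \<Longrightarrow> groupoid H \<Longrightarrow> subgroupoid_generated H S \<subseteq> Ar H"
proof
  fix f assume S: "S \<subseteq> Ar H" and H: "groupoid H" and f: "f \<in> subgroupoid_generated H S"
  from f show "f \<in> Ar H"
    by (induction rule: subgroupoid_generated.induct)
      (use S groupoid.idn_closed[OF H] groupoid.cmp_closed[OF H] in auto)
qed

text \<open>\<open>Q\<close> is not assumed to be a groupoid. Its laws are equations, and equations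
  pull back along the injective maps \<open>f\<close> and \<open>g\<close>; inverses exist because
  \<open>g\<close> is onto.\<close>

lemma groupoid_iso_transport:
  assumes H: "groupoid H"
    and f: "bij_betw f (Ob Q) (Ob H)" and g: "bij_betw g (Ar Q) (Ar H)"
    and src: "\<And>a. a \<in> Ar Q \<Longrightarrow> src Q a \<in> Ob Q \<and> src H (g a) = f (src Q a)"
    and tgt: "\<And>a. a \<in> Ar Q \<Longrightarrow> tgt Q a \<in> Ob Q \<and> tgt H (g a) = f (tgt Q a)"
    and idn: "\<And>x. x \<in> Ob Q \<Longrightarrow> idn Q x \<in> Ar Q \<and> g (idn Q x) = idn H (f x)"
    and cmp: "\<And>a b. \<lbrakk>a \<in> Ar Q; b \<in> Ar Q; tgt Q a = src Q b\<rbrakk>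
      \<Longrightarrow> cmp Q a b \<in> Ar Q \<and> g (cmp Q a b) = cmp H (g a) (g b)"
  shows "groupoid_iso Q H (f, g)"
proof -
  interpret H: groupoid H by (rule H)
  have fC: "f x \<in> Ob H" if "x \<in> Ob Q" for x using f that by (rule bij_betwE[THEN bspec])
  have gC: "g a \<in> Ar H" if "a \<in> Ar Q" for a using g that by (rule bij_betwE[THEN bspec])
  have fI: "x = y" if "f x = f y" "x \<in> Ob Q" "y \<in> Ob Q" for x y
    using bij_betw_imp_inj_on[OF f] that by (rule inj_onD)
  have gI: "a = b" if "g a = g b" "a \<in> Ar Q" "b \<in> Ar Q" for a b
    using bij_betw_imp_inj_on[OF g] that by (rule inj_onD)
  note S = src[THEN conjunct1] and S' = src[THEN conjunct2] and T = tgt[THEN conjunct1] and T' = tgt[THEN conjunct2]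
    and D = idn[THEN conjunct1] and D' = idn[THEN conjunct2] and C = cmp[THEN conjunct1] and C' = cmp[THEN conjunct2]
  have comp: "tgt H (g a) = src H (g b)" if "a \<in> Ar Q" "b \<in> Ar Q" "tgt Q a = src Q b" for a b
    using that by (simp add: S' T')
  have sc: "src Q (cmp Q a b) = src Q a" if ab: "a \<in> Ar Q" "b \<in> Ar Q" "tgt Q a = src Q b" for a b
  proof (rule fI)
    have "f (src Q (cmp Q a b)) = src H (cmp H (g a) (g b))"
      by (simp only: S'[OF C[OF ab], symmetric] C'[OF ab])
    also have "\<dots> = src H (g a)" by (intro H.src_cmp gC comp ab)
    finally show "f (src Q (cmp Q a b)) = f (src Q a)" by (simp only: S'[OF ab(1)])
  qed (intro S C ab)+
  have tc: "tgt Q (cmp Q a b) = tgt Q b" if ab: "a \<in> Ar Q" "b \<in> Ar Q" "tgt Q a = src Q b" for a b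
  proof (rule fI)
    have "f (tgt Q (cmp Q a b)) = tgt H (cmp H (g a) (g b))"
      by (simp only: T'[OF C[OF ab], symmetric] C'[OF ab])
    also have "\<dots> = tgt H (g b)" by (intro H.tgt_cmp gC comp ab)
    finally show "f (tgt Q (cmp Q a b)) = f (tgt Q b)" by (simp only: T'[OF ab(2)])
  qed (intro T C ab)+
  have si: "src Q (idn Q x) = x" if x: "x \<in> Ob Q" for x
  proof (rule fI)
    show "f (src Q (idn Q x)) = f x"
      by (simp only: S'[OF D[OF x], symmetric] D'[OF x] H.src_idn[OF fC[OF x]])
  qed (intro S D x)+
  have ti: "tgt Q (idn Q x) = x" if x: "x \<in> Ob Q" for x
  proof (rule fI)
    show "f (tgt Q (idn Q x)) = f x"
      by (simp only: T'[OF D[OF x], symmetric] D'[OF x] H.tgt_idn[OF fC[OF x]])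
  qed (intro T D x)+
  interpret Q: groupoid Q
  proof
    fix a b c assume abc: "a \<in> Ar Q" "b \<in> Ar Q" "c \<in> Ar Q" "tgt Q a = src Q b" "tgt Q b = src Q c"
    show "cmp Q (cmp Q a b) c = cmp Q a (cmp Q b c)"
    proof (rule gI)
      have "cmp H (cmp H (g a) (g b)) (g c) = cmp H (g a) (cmp H (g b) (g c))"
        by (intro H.cmp_assoc gC comp abc)
      then show "g (cmp Q (cmp Q a b) c) = g (cmp Q a (cmp Q b c))"
        using abc by (simp add: C' C sc tc)
    qed (use abc in \<open>simp_all add: C sc tc\<close>)
  next
    fix a assume a: "a \<in> Ar Q"
    show "cmp Q (idn Q (src Q a)) a = a"
    proof (rule gI)
      have "g (cmp Q (idn Q (src Q a)) a) = cmp H (idn H (f (src Q a))) (g a)"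
        using a by (simp add: C' D D' S ti)
      then show "g (cmp Q (idn Q (src Q a)) a) = g a"
        by (simp add: S'[OF a, symmetric] H.idn_cmp[OF gC[OF a]])
    qed (use a in \<open>simp_all add: C D S ti\<close>)
    show "cmp Q a (idn Q (tgt Q a)) = a"
    proof (rule gI)
      have "g (cmp Q a (idn Q (tgt Q a))) = cmp H (g a) (idn H (f (tgt Q a)))"
        using a by (simp add: C' D D' T si)
      then show "g (cmp Q a (idn Q (tgt Q a))) = g a"
        by (simp add: T'[OF a, symmetric] H.cmp_idn[OF gC[OF a]])
    qed (use a in \<open>simp_all add: C D T si\<close>)
    obtain b' where b': "b' \<in> Ar H" "src H b' = tgt H (g a)" "tgt H b' = src H (g a)"
      "cmp H (g a) b' = idn H (src H (g a))" "cmp H b' (g a) = idn H (tgt H (g a))"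
      using H.inverse_ex[OF gC[OF a]] by blast
    have "b' \<in> g ` Ar Q" using b'(1) bij_betw_imp_surj_on[OF g] by simp
    then obtain b where b: "b \<in> Ar Q" "g b = b'" by blast
    have sb: "src Q b = tgt Q a"
    proof (rule fI)
      show "f (src Q b) = f (tgt Q a)" using b'(2) by (simp only: S'[OF b(1), symmetric] T'[OF a, symmetric] b(2))
    qed (intro S T a b)+
    have tb: "tgt Q b = src Q a"
    proof (rule fI)
      show "f (tgt Q b) = f (src Q a)" using b'(3) by (simp only: T'[OF b(1), symmetric] S'[OF a, symmetric] b(2))
    qed (intro S T a b)+
    have "cmp Q a b = idn Q (src Q a)"
    proof (rule gI)
      have "g (idn Q (src Q a)) = idn H (src H (g a))" by (simp only: D'[OF S[OF a]] S'[OF a])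
      then show "g (cmp Q a b) = g (idn Q (src Q a))" using b'(4) by (simp add: C'[OF a b(1) sb[symmetric]] b(2))
    qed (intro C D S a b sb[symmetric])+
    moreover have "cmp Q b a = idn Q (tgt Q a)"
    proof (rule gI)
      have "g (idn Q (tgt Q a)) = idn H (tgt H (g a))" by (simp only: D'[OF T[OF a]] T'[OF a])
      then show "g (cmp Q b a) = g (idn Q (tgt Q a))" using b'(5) by (simp add: C'[OF b(1) a tb] b(2))
    qed (intro C D T a b tb)+
    ultimately show "\<exists>b\<in>Ar Q. src Q b = tgt Q a \<and> tgt Q b = src Q a \<and>
        cmp Q a b = idn Q (src Q a) \<and> cmp Q b a = idn Q (tgt Q a)"
      using b sb tb by blast
  qed (simp_all add: S T D C sc tc si ti)
  show ?thesis
    by unfold_locales (simp_all add: fC gC S' T' D' C' f g)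
qed

text \<open>The hypotheses \<open>fib\<close> say that orbits are exactly the fibres of
  \<open>F\<close>, so the value of \<open>F\<close> on a chosen representative does not depend on
  the choice. Composition is the only law where the representatives have to be adjusted.\<close>

lemma quotient_groupoid_iso:
  fixes N :: "('n, 'z) monoid_scheme" and G :: "('o, 'a) groupoid_data" and H :: "('p, 'b) groupoid_data"
  assumes act: "free_groupoid_action N G p q" and F: "groupoid_functor G H F"
    and surj: "fst F ` Ob G = Ob H" "snd F ` Ar G = Ar H"
    and fib: "\<And>x x'. \<lbrakk>x \<in> Ob G; x' \<in> Ob G\<rbrakk> \<Longrightarrow> fst F x = fst F x' \<longleftrightarrow> (\<exists>n\<in>carrier N. p n x = x')"
      "\<And>a a'. \<lbrakk>a \<in> Ar G; a' \<in> Ar G\<rbrakk> \<Longrightarrow> snd F a = snd F a' \<longleftrightarrow> (\<exists>n\<in>carrier N. q n a = a')"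
  defines "\<Phi> \<equiv> (\<lambda>X. fst F (SOME x. x \<in> X), \<lambda>A. snd F (SOME a. a \<in> A))"
  shows "groupoid_iso (quotient_groupoid N p q G) H \<Phi>"
    "\<And>x. x \<in> Ob G \<Longrightarrow> fst \<Phi> (orbit N p x) = fst F x"
    "\<And>a. a \<in> Ar G \<Longrightarrow> snd \<Phi> (orbit N q a) = snd F a"
proof -
  interpret A: free_groupoid_action N G p q by (rule act)
  interpret F: groupoid_functor G H F by (rule F)
  have pC: "p n x \<in> Ob G" if "n \<in> carrier N" "x \<in> Ob G" for n x using A.ob.element_image that by blast
  have qC: "q n a \<in> Ar G" if "n \<in> carrier N" "a \<in> Ar G" for n a using A.ar.element_image that by blast
  have op: "orbit N p x = {x' \<in> Ob G. fst F x' = fst F x}" if x: "x \<in> Ob G" for x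
  proof (intro equalityI subsetI)
    fix x' assume "x' \<in> orbit N p x"
    then obtain n where "n \<in> carrier N" "x' = p n x" by (auto simp: orbit_def)
    then show "x' \<in> {x' \<in> Ob G. fst F x' = fst F x}" using fib(1)[OF x, of x'] pC[OF _ x] by auto
  next
    fix x' assume "x' \<in> {x' \<in> Ob G. fst F x' = fst F x}"
    then obtain n where "n \<in> carrier N" "p n x = x'" using fib(1)[OF x, of x'] by auto
    then show "x' \<in> orbit N p x" by (auto simp: orbit_def)
  qed
  have oq: "orbit N q a = {a' \<in> Ar G. snd F a' = snd F a}" if a: "a \<in> Ar G" for a
  proof (intro equalityI subsetI)
    fix a' assume "a' \<in> orbit N q a"
    then obtain n where "n \<in> carrier N" "a' = q n a" by (auto simp: orbit_def)
    then show "a' \<in> {a' \<in> Ar G. snd F a' = snd F a}" using fib(2)[OF a, of a'] qC[OF _ a] by auto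
  next
    fix a' assume "a' \<in> {a' \<in> Ar G. snd F a' = snd F a}"
    then obtain n where "n \<in> carrier N" "q n a = a'" using fib(2)[OF a, of a'] by auto
    then show "a' \<in> orbit N q a" by (auto simp: orbit_def)
  qed
  let ?Q = "quotient_groupoid N p q G"
  define rp where "rp X = (SOME x. x \<in> X)" for X :: "'o set"
  define rq where "rq X = (SOME x. x \<in> X)" for X :: "'a set"
  have rp: "rp X \<in> Ob G" "orbit N p (rp X) = X" if "X \<in> Ob ?Q" for X
  proof -
    obtain x where x: "x \<in> Ob G" "X = orbit N p x" using \<open>X \<in> Ob ?Q\<close> by (auto simp: quotient_groupoid_def orbits_def)
    then have "x \<in> X" by (simp add: op)
    then have "rp X \<in> X" unfolding rp_def by (rule someI)
    then show "rp X \<in> Ob G" "orbit N p (rp X) = X" using x by (auto simp: op)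
  qed
  have rq: "rq X \<in> Ar G" "orbit N q (rq X) = X" if "X \<in> Ar ?Q" for X
  proof -
    obtain x where x: "x \<in> Ar G" "X = orbit N q x" using \<open>X \<in> Ar ?Q\<close> by (auto simp: quotient_groupoid_def orbits_def)
    then have "x \<in> X" by (simp add: oq)
    then have "rq X \<in> X" unfolding rq_def by (rule someI)
    then show "rq X \<in> Ar G" "orbit N q (rq X) = X" using x by (auto simp: oq)
  qed
  have QO: "orbit N p x \<in> Ob ?Q" if "x \<in> Ob G" for x using that by (auto simp: quotient_groupoid_def orbits_def)
  have QA: "orbit N q x \<in> Ar ?Q" if "x \<in> Ar G" for x using that by (auto simp: quotient_groupoid_def orbits_def)
  have \<Phi>: "fst \<Phi> X = fst F (rp X)" "snd \<Phi> Y = snd F (rq Y)" for X Y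
    by (simp_all add: \<Phi>_def rp_def rq_def)
  have Fp: "fst F x = fst F x'" if "orbit N p x = orbit N p x'" "x \<in> Ob G" "x' \<in> Ob G" for x x'
  proof -
    have "x \<in> orbit N p x'" using that op by auto
    then show ?thesis using that op by simp
  qed
  have Fq: "snd F x = snd F x'" if "orbit N q x = orbit N q x'" "x \<in> Ar G" "x' \<in> Ar G" for x x'
  proof -
    have "x \<in> orbit N q x'" using that oq by auto
    then show ?thesis using that oq by simp
  qed
  show \<Phi>p: "fst \<Phi> (orbit N p x) = fst F x" if "x \<in> Ob G" for x
    unfolding \<Phi> using rp[OF QO[OF that]] that by (intro Fp) auto
  show \<Phi>q: "snd \<Phi> (orbit N q x) = snd F x" if "x \<in> Ar G" for x
    unfolding \<Phi> using rq[OF QA[OF that]] that by (intro Fq) auto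
  have comp: "cmp ?Q X Y \<in> Ar ?Q \<and> snd \<Phi> (cmp ?Q X Y) = cmp H (snd \<Phi> X) (snd \<Phi> Y)"
    if XY: "X \<in> Ar ?Q" "Y \<in> Ar ?Q" "tgt ?Q X = src ?Q Y" for X Y
  proof -
    let ?a = "rq X" and ?b = "rq Y"
    have a: "?a \<in> Ar G" and b: "?b \<in> Ar G" using rq XY by blast+
    \<comment> \<open>The chosen representatives are composable only up to the action;
      \<open>c\<close> will be the translate of \<open>?b\<close> that starts where
      \<open>?a\<close> ends.\<close>
    have "orbit N p (tgt G ?a) = orbit N p (src G ?b)"
      using XY(3) by (simp add: quotient_groupoid_def rq_def)
    then have "fst F (src G ?b) = fst F (tgt G ?a)"
      using a b by (intro Fp) (auto simp: A.G.src_closed A.G.tgt_closed)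
    then obtain n where n: "n \<in> carrier N" "p n (src G ?b) = tgt G ?a"
      using fib(1) a b A.G.src_closed A.G.tgt_closed by metis
    interpret qn: groupoid_functor G G "(p n, q n)" using A.acts_by_functors[OF n(1)] .
    define c where "c = q n ?b"
    have c: "c \<in> Ar G" "src G c = tgt G ?a" "snd F c = snd F ?b"
      using qC[OF n(1) b] qn.map_src[OF b] n fib(2)[OF b qC[OF n(1) b]] by (auto simp: c_def)
    have Yeq: "Y = {a' \<in> Ar G. snd F a' = snd F ?b}" using rq(2)[OF XY(2)] oq[OF b] by simp
    have cY: "c \<in> Y" by (subst Yeq) (use c in simp)
    \<comment> \<open>Two candidates differ by some \<open>k\<close>, which fixes their common
      source and is therefore the identity by freeness on objects.\<close>
    have "(THE b. b \<in> Y \<and> src G b = tgt G ?a) = c"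
    proof (rule the_equality)
      fix d assume d: "d \<in> Y \<and> src G d = tgt G ?a"
      then have dA: "d \<in> Ar G" "snd F c = snd F d" using c(3) by (subst (asm) Yeq, simp)+
      then obtain k where k: "k \<in> carrier N" "q k c = d" using fib(2)[OF c(1) dA(1)] by blast
      interpret qk: groupoid_functor G G "(p k, q k)" using A.acts_by_functors[OF k(1)] .
      have "p k (src G c) = src G c" using qk.map_src[OF c(1)] k(2) d c by simp
      then have "k = \<one>\<^bsub>N\<^esub>" using A.free_on_objects k(1) A.G.src_closed c(1) by blast
      then show "d = c" using A.ar.id_eq_one c(1) k(2) by (metis restrict_apply')
    qed (use cY c in simp)
    then have "cmp ?Q X Y = orbit N q (cmp G ?a c)"
      by (simp add: quotient_groupoid_def Let_def rq_def)
    moreover have "cmp G ?a c \<in> Ar G" using a c by (simp add: A.G.cmp_closed)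
    moreover have "snd F (cmp G ?a c) = cmp H (snd \<Phi> X) (snd \<Phi> Y)"
      using a c by (simp add: F.map_cmp \<Phi>)
    ultimately show ?thesis using QA \<Phi>q by simp
  qed
  have "groupoid_iso ?Q H (fst \<Phi>, snd \<Phi>)"
  proof (rule groupoid_iso_transport[OF F.H.groupoid_axioms])
    show "bij_betw (fst \<Phi>) (Ob ?Q) (Ob H)"
      unfolding bij_betw_def
    proof
      show "inj_on (fst \<Phi>) (Ob ?Q)"
      proof (rule inj_onI)
        fix X X' assume X: "X \<in> Ob ?Q" "X' \<in> Ob ?Q" and e: "fst \<Phi> X = fst \<Phi> X'"
        then have "orbit N p (rp X) = orbit N p (rp X')" using op rp by (simp add: \<Phi>)
        then show "X = X'" using rp X by simp
      qed
      have "fst \<Phi> ` Ob ?Q = fst \<Phi> ` orbit N p ` Ob G"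
        by (intro arg_cong[of _ _ "image (fst \<Phi>)"]) (auto simp: quotient_groupoid_def orbits_def)
      also have "\<dots> = fst F ` Ob G" unfolding image_image using \<Phi>p by (intro image_cong) auto
      finally show "fst \<Phi> ` Ob ?Q = Ob H" by (simp add: surj)
    qed
    show "bij_betw (snd \<Phi>) (Ar ?Q) (Ar H)"
      unfolding bij_betw_def
    proof
      show "inj_on (snd \<Phi>) (Ar ?Q)"
      proof (rule inj_onI)
        fix X X' assume X: "X \<in> Ar ?Q" "X' \<in> Ar ?Q" and e: "snd \<Phi> X = snd \<Phi> X'"
        then have "orbit N q (rq X) = orbit N q (rq X')" using oq rq by (simp add: \<Phi>)
        then show "X = X'" using rq X by simp
      qed
      have "snd \<Phi> ` Ar ?Q = snd \<Phi> ` orbit N q ` Ar G"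
        by (intro arg_cong[of _ _ "image (snd \<Phi>)"]) (auto simp: quotient_groupoid_def orbits_def)
      also have "\<dots> = snd F ` Ar G" unfolding image_image using \<Phi>q by (intro image_cong) auto
      finally show "snd \<Phi> ` Ar ?Q = Ar H" by (simp add: surj)
    qed
    fix X assume X: "X \<in> Ar ?Q"
    have "src ?Q X = orbit N p (src G (rq X))" "tgt ?Q X = orbit N p (tgt G (rq X))"
      by (simp_all add: quotient_groupoid_def rq_def)
    then show "src ?Q X \<in> Ob ?Q \<and> src H (snd \<Phi> X) = fst \<Phi> (src ?Q X)"
      "tgt ?Q X \<in> Ob ?Q \<and> tgt H (snd \<Phi> X) = fst \<Phi> (tgt ?Q X)"
      using rq(1)[OF X] QO A.G.src_closed A.G.tgt_closed F.map_src F.map_tgt \<Phi>p by (simp_all add: \<Phi>(2))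
  next
    fix X assume X: "X \<in> Ob ?Q"
    have "idn ?Q X = orbit N q (idn G (rp X))" by (simp add: quotient_groupoid_def rp_def)
    then show "idn ?Q X \<in> Ar ?Q \<and> snd \<Phi> (idn ?Q X) = idn H (fst \<Phi> X)"
      using rp(1)[OF X] QA A.G.idn_closed F.map_idn \<Phi>q by (simp add: \<Phi>(1))
  qed (rule comp)
  then show "groupoid_iso ?Q H \<Phi>" by simp
qed

section \<open>Auxiliary facts on bijections, spans and connected components\<close>

lemma compose_id_bij:
  assumes "f \<in> S \<rightarrow> S" "g \<in> S \<rightarrow> S" "compose S f g = (\<lambda>x\<in>S. x)" "compose S g f = (\<lambda>x\<in>S. x)"
  shows "bij_betw f S S"
proof (rule bij_betw_byWitness[of S g])
  show "\<forall>x\<in>S. g (f x) = x" "\<forall>x\<in>S. f (g x) = x"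
    using assms(3,4) by (metis compose_eq restrict_apply')+
qed (use assms(1,2) in auto)

lemma span_stable:
  assumes "linear f" "\<And>v. v \<in> S \<Longrightarrow> f v \<in> S" "u \<in> span S" shows "f u \<in> span S"
proof -
  have "f u \<in> span (f ` S)" using assms by (simp add: linear_span_image)
  also have "span (f ` S) \<subseteq> span S" using assms(2) by (intro span_mono) auto
  finally show ?thesis .
qed

text \<open>Each member of \<open>F\<close> is clopen in \<open>S\<close>, its complement being the
  union of the other open members; a connected subset of \<open>S\<close> containing it can
  therefore not be larger.\<close>

lemma components_eq_partition:
  fixes S :: "'a::topological_space set"
  assumes S: "\<Union>F = S" and ne: "\<And>A. A \<in> F \<Longrightarrow> A \<noteq> {}" and conn: "\<And>A. A \<in> F \<Longrightarrow> connected A"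
    and op: "\<And>A. A \<in> F \<Longrightarrow> openin (top_of_set S) A"
    and disj: "\<And>A B. \<lbrakk>A \<in> F; B \<in> F; A \<noteq> B\<rbrakk> \<Longrightarrow> A \<inter> B = {}"
  shows "components S = F"
proof -
  have mem: "A \<in> components S" if A: "A \<in> F" for A
    unfolding in_components_maximal
  proof (intro conjI allI impI)
    fix D assume D: "D \<noteq> {} \<and> A \<subseteq> D \<and> D \<subseteq> S \<and> connected D"
    have "S - A = \<Union>(F - {A})" using S disj A by auto
    then have "openin (top_of_set S) (S - A)" using op by (auto intro: openin_Union)
    moreover have "A \<subseteq> S" using A S by blast
    ultimately have "closedin (top_of_set S) A" by (simp add: closedin_def)
    then have "closedin (top_of_set D) A" "openin (top_of_set D) A"
      using D op[OF A] by (meson closedin_subset_trans openin_subset_trans)+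
    then show "D = A" using D ne[OF A] by (auto simp: connected_clopen)
  qed (use A S ne conn in auto)
  show ?thesis
  proof (intro equalityI subsetI)
    fix C assume C: "C \<in> components S"
    then obtain p where p: "p \<in> C" "p \<in> S" using in_components_nonempty in_components_subset by fastforce
    then obtain A where A: "A \<in> F" "p \<in> A" using S by blast
    then have "C = A" using components_nonoverlap[OF C mem[OF A(1)]] p by blast
    then show "C \<in> F" using A by simp
  qed (rule mem)
qed

section \<open>The geometric representation\<close>

subsection \<open>The bilinear form\<close>

abbreviation cox_coeff :: "('v \<Rightarrow> 'v \<Rightarrow> enat) \<Rightarrow> 'v \<Rightarrow> 'v \<Rightarrow> real" where
  "cox_coeff m i j \<equiv> (case m i j of enat k \<Rightarrow> - cos (pi / real k) | \<infinity> \<Rightarrow> - 1)"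

lemma bilinear_cox_form: "bilinear (cox_form m)"
  unfolding bilinear_def cox_form_def
  by (auto intro!: linearI sum.cong simp: sum.distrib[symmetric] scaleR_sum_right sum_distrib_left algebra_simps)

lemmas cox_form_simps =
  bilinear_ladd[OF bilinear_cox_form] bilinear_radd[OF bilinear_cox_form]
  bilinear_lsub[OF bilinear_cox_form] bilinear_rsub[OF bilinear_cox_form]
  bilinear_lmul[OF bilinear_cox_form] bilinear_rmul[OF bilinear_cox_form]
  bilinear_lneg[OF bilinear_cox_form] bilinear_rneg[OF bilinear_cox_form]

lemma cox_form_axis: "cox_form m (\<alpha> i) (\<alpha> j) = cox_coeff m i j"
proof -
  have "cox_form m (\<alpha> i) (\<alpha> j) = (\<Sum>k\<in>UNIV. \<Sum>l\<in>UNIV. if k = i then if l = j then cox_coeff m k l else 0 else 0)"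
    unfolding cox_form_def by (intro sum.cong refl) (auto simp: axis_def)
  also have "\<dots> = (\<Sum>k\<in>UNIV. if k = i then cox_coeff m k j else 0)"
    by (intro sum.cong refl) (auto simp: sum.delta)
  finally show ?thesis by (simp add: sum.delta)
qed

lemma linear_simple_refl: "linear (simple_refl m i)"
  by (rule linearI) (auto simp: simple_refl_def cox_form_simps algebra_simps)

lemma simple_refl_nth_other: "k \<noteq> i \<Longrightarrow> simple_refl m i v $ k = v $ k"
  by (simp add: simple_refl_def axis_def)

abbreviation act :: "('v::finite \<Rightarrow> 'v \<Rightarrow> enat) \<Rightarrow> 'v list \<Rightarrow> real ^ 'v \<Rightarrow> real ^ 'v" where
  "act m us \<equiv> foldr (simple_refl m) us"

lemma linear_act: "linear (act m us)"
proof (induction us)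
  case (Cons i us)
  then show ?case
    using linear_compose[OF Cons linear_simple_refl[of m i]] by (simp add: comp_def)
qed (simp add: linear_id[unfolded id_def])

subsection \<open>Alternating words\<close>

text \<open>The recursion peels the final letter \<open>b\<close> off the right end, because under
  \<open>foldr\<close> the last letter is the one that acts first on a vector.\<close>

fun alt_word :: "nat \<Rightarrow> 'v \<Rightarrow> 'v \<Rightarrow> 'v list" where
  "alt_word 0 a b = []"
| "alt_word (Suc n) a b = alt_word n b a @ [b]"

text \<open>For \<open>c = cos \<theta>\<close> this is \<open>sin ((n - 1)\<theta>) / sin \<theta>\<close>.\<close>

fun cheb :: "real \<Rightarrow> nat \<Rightarrow> real" where
  "cheb c 0 = - 1"
| "cheb c (Suc 0) = 0"
| "cheb c (Suc (Suc n)) = 2 * c * cheb c (Suc n) - cheb c n"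

lemma cheb_cos: "sin t * cheb (cos t) n = sin ((real n - 1) * t)"
proof (induction "cos t" n rule: cheb.induct)
  case (3 n)
  have "sin ((real n + 1) * t) + sin ((real n - 1) * t) = 2 * cos t * sin (real n * t)"
    by (simp add: algebra_simps sin_add sin_diff)
  with 3 show ?case by (simp add: algebra_simps)
qed simp_all

text \<open>The case of an infinite bond, where \<open>c = 1\<close> and the sine formula
  degenerates to \<open>0 = 0\<close>.\<close>

lemma cheb_1: "cheb 1 n = real n - 1"
  by (induction "1::real" n rule: cheb.induct) auto

lemma length_alt_word [simp]: "length (alt_word n a b) = n"
  by (induction n arbitrary: a b) auto

lemma alt_word_even: "alt_word (2 * n) a b = concat (replicate n [a, b])"
proof (induction n)
  case (Suc n)
  have "concat (replicate n [a, b]) @ [a, b] = [a, b] @ concat (replicate n [a, b])"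
    by (induction n) auto
  with Suc show ?case by simp
qed simp

lemma alt_word_Cons: "alt_word (Suc n) a b = (if even n then b else a) # alt_word n a b"
  by (induction n arbitrary: a b) auto

lemma rev_alt_word: "rev (alt_word n a b) = (if even n then alt_word n b a else alt_word n a b)"
proof (induction n arbitrary: a b)
  case (Suc n)
  have "rev (alt_word (Suc n) a b) = b # rev (alt_word n b a)" by simp
  also have "\<dots> = (if even (Suc n) then alt_word (Suc n) b a else alt_word (Suc n) a b)"
    unfolding Suc.IH alt_word_Cons by simp
  finally show ?case .
qed simp

lemma alt_word_append: "alt_word (k + n) a b = (if even n then alt_word k a b else alt_word k b a) @ alt_word n a b"
  by (induction n arbitrary: a b) auto

context coxeter_diagram
begin

lemma cox_form_axis_same: "cox_form m (\<alpha> i) (\<alpha> i) = 1"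
  by (simp add: cox_form_axis m_diag one_enat_def)

lemma cox_form_sym: "cox_form m u v = cox_form m v u"
proof -
  have "cox_form m u v = (\<Sum>j\<in>UNIV. \<Sum>i\<in>UNIV. u $ i * v $ j * cox_coeff m i j)"
    unfolding cox_form_def by (rule sum.swap)
  also have "\<dots> = cox_form m v u"
    unfolding cox_form_def by (intro sum.cong refl) (simp add: m_sym mult.commute)
  finally show ?thesis .
qed

lemma simple_refl_axis_same: "simple_refl m i (\<alpha> i) = - \<alpha> i"
  by (simp add: simple_refl_def cox_form_axis_same scaleR_2)

lemma simple_refl_simple_refl: "simple_refl m i (simple_refl m i v) = v"
  by (simp add: simple_refl_def cox_form_simps cox_form_axis_same)

lemma simple_refl_preserves: "cox_form m (simple_refl m i u) (simple_refl m i v) = cox_form m u v"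
  by (simp add: simple_refl_def cox_form_simps cox_form_axis_same cox_form_sym[of u "\<alpha> i"] algebra_simps)

lemma act_preserves: "cox_form m (act m us u) (act m us v) = cox_form m u v"
  by (induction us) (auto simp: simple_refl_preserves)

text \<open>Applying the last letter leaves a word with \<open>a\<close> and \<open>b\<close>
  exchanged, so the images of both roots have to be carried through the induction together. The
  parity of \<open>n\<close> decides which root takes which coefficient because it decides the first
  letter of the word.\<close>

lemma act_alt_word:
  assumes "c = - cox_form m (\<alpha> a) (\<alpha> b)"
  shows "act m (alt_word n a b) (\<alpha> b) =
           (if even n then - (cheb c n *\<^sub>R \<alpha> b + cheb c (Suc n) *\<^sub>R \<alpha> a)
            else - (cheb c (Suc n) *\<^sub>R \<alpha> b + cheb c n *\<^sub>R \<alpha> a)) \<and>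
         act m (alt_word n a b) (\<alpha> a) =
           (if even n then cheb c (Suc (Suc n)) *\<^sub>R \<alpha> a + cheb c (Suc n) *\<^sub>R \<alpha> b
            else cheb c (Suc n) *\<^sub>R \<alpha> a + cheb c (Suc (Suc n)) *\<^sub>R \<alpha> b)"
  using assms
proof (induction n arbitrary: a b)
  case (Suc n)
  have c: "c = - cox_form m (\<alpha> b) (\<alpha> a)"
    using Suc.prems by (simp add: cox_form_sym)
  interpret A: linear "act m (alt_word n b a)" by (rule linear_act)
  have 1: "act m (alt_word (Suc n) a b) (\<alpha> b) = - act m (alt_word n b a) (\<alpha> b)"
    by (simp add: simple_refl_axis_same A.neg)
  have 2: "act m (alt_word (Suc n) a b) (\<alpha> a) = act m (alt_word n b a) (\<alpha> a) + (2 * c) *\<^sub>R act m (alt_word n b a) (\<alpha> b)"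
    using c by (simp add: simple_refl_def A.diff A.scale A.add A.neg)
  note IH = Suc.IH[OF c, THEN conjunct1] Suc.IH[OF c, THEN conjunct2]
  show ?case
    unfolding 1 2 IH by (cases "even n") (simp_all add: algebra_simps)
qed auto

lemma m_finite_ge_2: "i \<noteq> j \<Longrightarrow> m i j = enat k \<Longrightarrow> k \<ge> 2"
  using m_offdiag[of i j] by (simp add: numeral_eq_enat)

lemma angle_bounds:
  assumes "i \<noteq> j" "m i j = enat k"
  shows "0 < pi / real k" "pi / real k \<le> pi / 2" "sin (pi / real k) > 0"
proof -
  have "k \<ge> 2" using m_finite_ge_2 assms by blast
  then show 1: "0 < pi / real k" "pi / real k \<le> pi / 2" by (auto intro!: divide_left_mono simp del: divide_le_eq_numeral1 le_divide_eq_numeral1 times_divide_eq_left)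
  then show "sin (pi / real k) > 0" using pi_gt_zero by (intro sin_gt_zero) linarith+
qed

text \<open>For \<open>a \<noteq> b\<close> the form on the plane of the two simple roots has
  determinant \<open>1 - c\<^sup>2\<close>, which is nonzero for a finite bond, so every vector
  splits into a part in the plane and a part orthogonal to both roots. Each letter fixes the second
  part; on the plane the Chebyshev values at \<open>2 * k\<close> give the identity.\<close>

lemma relator_acts_trivially:
  assumes k: "m a b = enat k"
  shows "act m (concat (replicate k [a, b])) v = v"
proof (cases "a = b")
  case True
  then have "k = 1" using k m_diag[of b] by (simp add: one_enat_def)
  with True show ?thesis by (simp add: simple_refl_simple_refl)
next
  case False
  define t where "t = pi / real k"
  define c where "c = cos t"
  have k2: "k \<ge> 2" using m_finite_ge_2 False k by blast
  have kt: "real k * t = pi" using k2 by (simp add: t_def)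
  have s: "sin t > 0" using angle_bounds[OF False k] by (simp add: t_def)
  have cab: "cox_form m (\<alpha> a) (\<alpha> b) = - c" "cox_form m (\<alpha> b) (\<alpha> a) = - c"
    using cox_form_axis[of m a b] cox_form_sym[of "\<alpha> a" "\<alpha> b"] k by (simp_all add: c_def t_def)
  have ch: "sin t * cheb c n = sin ((real n - 1) * t)" for n
    using cheb_cos[of t n] by (simp add: c_def)
  have "sin t * cheb c (2 * k) = - sin t"
  proof -
    have "(real (2 * k) - 1) * t = 2 * pi - t" using kt by (simp add: algebra_simps)
    then show ?thesis using ch[of "2 * k"] by (simp add: sin_diff)
  qed
  then have "sin t * (cheb c (2 * k) + 1) = 0" by (simp add: distrib_left)
  then have c0: "cheb c (2 * k) = - 1" using s by simp
  have "sin t * cheb c (Suc (2 * k)) = 0"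
  proof -
    have *: "(real (Suc (2 * k)) - 1) * t = 2 * pi" using kt by (simp add: algebra_simps)
    show ?thesis unfolding ch * by simp
  qed
  then have c1: "cheb c (Suc (2 * k)) = 0" using s by simp
  have c2: "cheb c (Suc (Suc (2 * k))) = 1" using c0 c1 by simp
  let ?R = "act m (concat (replicate k [a, b]))"
  interpret R: linear ?R by (rule linear_act)
  have Ra: "?R (\<alpha> a) = \<alpha> a" and Rb: "?R (\<alpha> b) = \<alpha> b"
    using act_alt_word[of c a b "2 * k"] cab c0 c1 c2 unfolding alt_word_even by (simp_all del: cheb.simps)
  have orth: "?R w = w" if "cox_form m (\<alpha> a) w = 0" "cox_form m (\<alpha> b) w = 0" for w
  proof -
    have "act m (concat (replicate n [a, b])) w = w" for n
      using that by (induction n) (simp_all add: simple_refl_def)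
    then show ?thesis .
  qed
  have s2: "1 - c\<^sup>2 \<noteq> 0"
  proof
    assume "1 - c\<^sup>2 = 0"
    then have "(sin t)\<^sup>2 = 0" using sin_cos_squared_add[of t] by (simp add: c_def)
    with s show False by simp
  qed
  define p q where "p = cox_form m (\<alpha> a) v" and "q = cox_form m (\<alpha> b) v"
  \<comment> \<open>Cramer's rule for the vector \<open>u\<close> of the plane that has the same
    products with \<open>\<alpha> a\<close> and \<open>\<alpha> b\<close> as
    \<open>v\<close>.\<close>
  define x y where "x = (p + c * q) / (1 - c\<^sup>2)" and "y = (q + c * p) / (1 - c\<^sup>2)"
  have xy: "x - c * y = p" "y - c * x = q"
  proof -
    have "(x - c * y) * (1 - c\<^sup>2) = p * (1 - c\<^sup>2)" "(y - c * x) * (1 - c\<^sup>2) = q * (1 - c\<^sup>2)"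
      using s2 unfolding x_def y_def by (simp_all add: left_diff_distrib) (simp_all add: algebra_simps power2_eq_square)
    then show "x - c * y = p" "y - c * x = q" using s2 by simp_all
  qed
  define u where "u = x *\<^sub>R \<alpha> a + y *\<^sub>R \<alpha> b"
  have "cox_form m (\<alpha> a) (v - u) = 0" "cox_form m (\<alpha> b) (v - u) = 0"
    using xy by (simp_all add: u_def cox_form_simps cab cox_form_axis_same p_def q_def algebra_simps)
  then have "?R (v - u) = v - u" by (rule orth)
  moreover have "?R u = u" by (simp add: u_def R.add R.scale Ra Rb)
  ultimately show ?thesis using R.add[of "v - u" u] by simp
qed

lemma cox_step_act: "cox_step m us vs \<Longrightarrow> act m us = act m vs"
  by (induction rule: cox_step.induct) (auto simp: relator_acts_trivially fun_eq_iff)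

subsection \<open>The group\<close>

lemma equiv_cox_rel: "equiv UNIV (cox_rel m)"
  unfolding cox_rel_def
  by (auto simp: equiv_def refl_on_def sym_def trans_def intro: equivclp_sym equivclp_trans)

lemma cox_rel_act: "(us, vs) \<in> cox_rel m \<Longrightarrow> act m us = act m vs"
proof -
  assume "(us, vs) \<in> cox_rel m"
  then have "equivclp (cox_step m) us vs" by (simp add: cox_rel_def)
  then show ?thesis
    by (induction rule: equivclp_induct) (auto dest: cox_step_act)
qed

lemma cox_step_ctx: "cox_step m us vs \<Longrightarrow> cox_step m (ps @ us @ qs) (ps @ vs @ qs)"
proof (induction rule: cox_step.induct)
  case (relator i j k us vs)
  from cox_step.relator[of m i j k "ps @ us" "vs @ qs", OF relator] show ?case by simp
qed

lemma cox_rel_ctx: "(us, vs) \<in> cox_rel m \<Longrightarrow> (ps @ us @ qs, ps @ vs @ qs) \<in> cox_rel m"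
proof -
  assume "(us, vs) \<in> cox_rel m"
  then have "equivclp (cox_step m) us vs" by (simp add: cox_rel_def)
  then have "equivclp (cox_step m) (ps @ us @ qs) (ps @ vs @ qs)"
  proof (induction rule: equivclp_induct)
    case (step y z)
    then show ?case using cox_step_ctx by (meson equivclp_into_equivclp)
  qed simp
  then show ?thesis by (simp add: cox_rel_def)
qed

lemma cox_rel_append: "(us, us') \<in> cox_rel m \<Longrightarrow> (vs, vs') \<in> cox_rel m \<Longrightarrow> (us @ vs, us' @ vs') \<in> cox_rel m"
  using cox_rel_ctx[of us us' "[]" vs] cox_rel_ctx[of vs vs' us' "[]"] equivE[OF equiv_cox_rel]
  by (auto elim: transE)

lemma cox_rel_relator: "m i j = enat k \<Longrightarrow> (concat (replicate k [i, j]), []) \<in> cox_rel m"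
  using cox_step.relator[of m i j k "[]" "[]"] by (auto simp: cox_rel_def)

lemma cox_rel_rev: "(us @ rev us, []) \<in> cox_rel m"
proof (induction us)
  case Nil
  show ?case using equiv_cox_rel by (simp add: equiv_def refl_on_def)
next
  case (Cons i us)
  have "((i # us) @ rev (i # us), [i] @ [] @ [i]) \<in> cox_rel m"
    using cox_rel_ctx[OF Cons, of "[i]" "[i]"] by simp
  moreover have "([i] @ [] @ [i], []) \<in> cox_rel m"
    using cox_rel_relator[of i i 1] by (simp add: m_diag one_enat_def)
  ultimately show ?case using equiv_cox_rel by (metis equivE transD)
qed

definition cls :: "'v list \<Rightarrow> 'v list set" where "cls us = cox_rel m `` {us}"

lemma cls_eq_iff: "cls us = cls vs \<longleftrightarrow> (us, vs) \<in> cox_rel m"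
  unfolding cls_def using eq_equiv_class_iff[OF equiv_cox_rel] by simp

lemma mem_cls: "vs \<in> cls us \<longleftrightarrow> cls us = cls vs"
  by (simp add: cls_eq_iff) (simp add: cls_def)

lemma cls_carrier [simp]: "cls us \<in> carrier (cox_group m)"
  by (simp add: cox_group_def cls_def quotientI)

lemma carrierE: assumes "w \<in> carrier (cox_group m)" obtains us where "w = cls us"
  using assms by (auto simp: cox_group_def cls_def elim: quotientE)

lemma cls_mult: "cls us \<otimes>\<^bsub>cox_group m\<^esub> cls vs = cls (us @ vs)"
proof -
  have "cls us \<otimes>\<^bsub>cox_group m\<^esub> cls vs = (\<Union>us'\<in>cls us. \<Union>vs'\<in>cls vs. cls (us' @ vs'))"
    by (simp add: cox_group_def cls_def)
  also have "\<dots> = (\<Union>us'\<in>cls us. \<Union>vs'\<in>cls vs. cls (us @ vs))"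
    by (intro SUP_cong refl) (metis mem_cls cls_eq_iff cox_rel_append)
  also have "\<dots> = cls (us @ vs)" by (auto simp: mem_cls)
  finally show ?thesis .
qed

lemma one_eq_cls: "\<one>\<^bsub>cox_group m\<^esub> = cls []"
  by (simp add: cox_group_def cls_def)

lemma simple_gen_cls: "simple_gen m i = cls [i]"
  by (simp add: simple_gen_def cls_def)

sublocale W: group "cox_group m"
proof (rule groupI)
  fix x y z assume "x \<in> carrier (cox_group m)" "y \<in> carrier (cox_group m)" "z \<in> carrier (cox_group m)"
  then show "x \<otimes>\<^bsub>cox_group m\<^esub> y \<otimes>\<^bsub>cox_group m\<^esub> z = x \<otimes>\<^bsub>cox_group m\<^esub> (y \<otimes>\<^bsub>cox_group m\<^esub> z)"
    by (auto elim!: carrierE simp: cls_mult)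
next
  fix x assume "x \<in> carrier (cox_group m)"
  then obtain us where "x = cls us" by (rule carrierE)
  then have "cls (rev us) \<otimes>\<^bsub>cox_group m\<^esub> x = \<one>\<^bsub>cox_group m\<^esub>"
    using cox_rel_rev[of "rev us"] by (simp add: cls_mult one_eq_cls cls_eq_iff)
  then show "\<exists>y\<in>carrier (cox_group m). y \<otimes>\<^bsub>cox_group m\<^esub> x = \<one>\<^bsub>cox_group m\<^esub>" by (meson cls_carrier)
qed (auto elim!: carrierE simp: cls_mult one_eq_cls)

lemma inv_cls: "inv\<^bsub>cox_group m\<^esub> (cls us) = cls (rev us)"
proof (rule W.inv_equality)
  show "cls (rev us) \<otimes>\<^bsub>cox_group m\<^esub> cls us = \<one>\<^bsub>cox_group m\<^esub>"
    using cox_rel_rev[of "rev us"] by (simp add: cls_mult one_eq_cls cls_eq_iff)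
qed simp_all

lemma geo_act_cls: "geo_act m (cls us) = act m us"
proof -
  have "(SOME vs. vs \<in> cls us) \<in> cls us" by (rule someI[of _ us]) (simp add: mem_cls)
  then show ?thesis
    by (simp add: geo_act_def fun_eq_iff mem_cls cls_eq_iff) (metis cox_rel_act)
qed

abbreviation G where "G \<equiv> cox_group m"
abbreviation mul (infixl "\<cdot>" 70) where "x \<cdot> y \<equiv> x \<otimes>\<^bsub>cox_group m\<^esub> y"
abbreviation iv where "iv x \<equiv> inv\<^bsub>cox_group m\<^esub> x"
abbreviation sg where "sg i \<equiv> simple_gen m i"
abbreviation \<rho> where "\<rho> \<equiv> geo_act m"
abbreviation len where "len \<equiv> cox_length"

lemma sg_carrier [simp]: "sg i \<in> carrier G"
  by (simp add: simple_gen_cls)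

lemma sg_sg [simp]: "sg i \<cdot> sg i = \<one>\<^bsub>G\<^esub>"
  using inv_cls[of "[i]"] by (metis W.r_inv cls_carrier rev_singleton_conv simple_gen_cls)

lemma inv_sg [simp]: "iv (sg i) = sg i"
  by (simp add: simple_gen_cls inv_cls)

lemma mul_sg_sg [simp]: "w \<in> carrier G \<Longrightarrow> w \<cdot> sg i \<cdot> sg i = w"
  by (simp add: W.m_assoc)

lemma rho_mult: "\<lbrakk>x \<in> carrier G; y \<in> carrier G\<rbrakk> \<Longrightarrow> \<rho> (x \<cdot> y) v = \<rho> x (\<rho> y v)"
  by (auto elim!: carrierE simp: cls_mult geo_act_cls)

lemma rho_one [simp]: "\<rho> \<one>\<^bsub>G\<^esub> v = v"
  by (simp add: one_eq_cls geo_act_cls)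

lemma rho_sg: "\<rho> (sg i) = simple_refl m i"
  by (simp add: simple_gen_cls geo_act_cls fun_eq_iff)

lemma rho_sg_same: "\<rho> (sg i) (\<alpha> i) = - \<alpha> i"
  by (simp add: rho_sg simple_refl_axis_same)

lemma linear_rho: "w \<in> carrier G \<Longrightarrow> linear (\<rho> w)"
  by (auto elim!: carrierE simp: geo_act_cls linear_act)

lemma rho_minus: "w \<in> carrier G \<Longrightarrow> \<rho> w (- v) = - \<rho> w v"
  by (simp add: linear_rho linear_neg)

lemma rho_preserves: "w \<in> carrier G \<Longrightarrow> cox_form m (\<rho> w u) (\<rho> w v) = cox_form m u v"
  by (auto elim!: carrierE simp: geo_act_cls act_preserves)

lemma rho_inv_left [simp]: "w \<in> carrier G \<Longrightarrow> \<rho> (iv w) (\<rho> w v) = v"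
  by (simp add: rho_mult[symmetric])

lemma rho_inv_right [simp]: "w \<in> carrier G \<Longrightarrow> \<rho> w (\<rho> (iv w) v) = v"
  by (simp add: rho_mult[symmetric])

lemma rho_eq_iff: "w \<in> carrier G \<Longrightarrow> \<rho> w u = \<rho> w v \<longleftrightarrow> u = v"
  by (metis rho_inv_left)

lemma rho_eq_0_iff: "w \<in> carrier G \<Longrightarrow> \<rho> w u = 0 \<longleftrightarrow> u = 0"
  using rho_eq_iff[of w u 0] by (simp add: linear_rho linear_0)

section \<open>The length function and its parity\<close>

lemma cox_rel_parity: "(us, vs) \<in> cox_rel m \<Longrightarrow> even (length us) \<longleftrightarrow> even (length vs)"
proof -
  have step: "even (length us) \<longleftrightarrow> even (length vs)" if "cox_step m us vs" for us vs
    using that by (induction rule: cox_step.induct) (simp add: length_concat sum_list_replicate)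
  assume "(us, vs) \<in> cox_rel m"
  then have "equivclp (cox_step m) us vs" by (simp add: cox_rel_def)
  then show ?thesis
    by (induction rule: equivclp_induct) (auto dest: step)
qed

lemma len_cls_le: "len (cls us) \<le> length us"
  unfolding cox_length_def by (rule Least_le) (auto simp: mem_cls)

lemma reduced_word:
  assumes "w \<in> carrier G"
  obtains us where "w = cls us" "length us = len w"
proof -
  obtain us where us: "w = cls us" using assms by (rule carrierE)
  have "\<exists>vs\<in>w. length vs = len w"
    unfolding cox_length_def by (rule LeastI[of _ "length us"]) (auto simp: us mem_cls)
  then show thesis using that us by (auto simp: mem_cls)
qed

lemma len_parity: "even (len (cls us)) \<longleftrightarrow> even (length us)"
proof -
  obtain vs where "cls us = cls vs" "length vs = len (cls us)" using reduced_word[of "cls us"] by auto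
  then show ?thesis using cox_rel_parity by (auto simp: cls_eq_iff)
qed

lemma len_mult_le: "\<lbrakk>x \<in> carrier G; y \<in> carrier G\<rbrakk> \<Longrightarrow> len (x \<cdot> y) \<le> len x + len y"
  by (metis reduced_word cls_mult len_cls_le length_append)

lemma len_sg_le: "len (sg i) \<le> 1"
  using len_cls_le[of "[i]"] by (simp add: simple_gen_cls)

lemma len_one [simp]: "len \<one>\<^bsub>G\<^esub> = 0"
  using len_cls_le[of "[]"] by (simp add: one_eq_cls)

lemma len_inv [simp]: "w \<in> carrier G \<Longrightarrow> len (iv w) = len w"
proof -
  have le: "len (iv w) \<le> len w" if "w \<in> carrier G" for w
    by (metis that reduced_word inv_cls len_cls_le length_rev)
  assume "w \<in> carrier G"
  then show ?thesis using le[of w] le[of "iv w"] by simp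
qed

text \<open>Relators have even length, so multiplication by a generator flips the parity of the
  length and the two lengths cannot be equal.\<close>

lemma len_mult_sg:
  assumes "w \<in> carrier G"
  shows "len (w \<cdot> sg i) = len w + 1 \<or> len w = len (w \<cdot> sg i) + 1"
proof -
  obtain us where us: "w = cls us" "length us = len w" using assms by (rule reduced_word)
  have "even (len (w \<cdot> sg i)) \<longleftrightarrow> odd (len w)"
    using us len_parity[of us] len_parity[of "us @ [i]"] by (simp add: simple_gen_cls cls_mult)
  then have "len (w \<cdot> sg i) \<noteq> len w" by auto
  moreover have "len (w \<cdot> sg i) \<le> len w + 1"
    using len_mult_le[OF assms sg_carrier, of i] len_sg_le[of i] by simp
  moreover have "len w \<le> len (w \<cdot> sg i) + 1"
    using len_mult_le[of "w \<cdot> sg i" "sg i"] len_sg_le[of i] assms by simp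
  ultimately show ?thesis by linarith
qed

lemma right_descent:
  assumes "w \<in> carrier G" "w \<noteq> \<one>\<^bsub>G\<^esub>"
  obtains i where "len (w \<cdot> sg i) < len w"
proof -
  obtain us where us: "w = cls us" "length us = len w" using assms(1) by (rule reduced_word)
  with assms(2) have "us \<noteq> []" by (auto simp: one_eq_cls)
  then obtain vs i where vs: "us = vs @ [i]" by (metis rev_exhaust)
  then have "w \<cdot> sg i = cls vs"
    using us by (simp add: simple_gen_cls flip: cls_mult) (simp flip: simple_gen_cls)
  then have "len (w \<cdot> sg i) < len w" using len_cls_le[of vs] us vs by simp
  then show thesis by (rule that)
qed

section \<open>Signs of roots and descents\<close>

lemma braid_relation: "m i j = enat k \<Longrightarrow> cls (alt_word k i j) = cls (alt_word k j i)"
proof -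
  assume "m i j = enat k"
  then have "cls (alt_word (k + k) i j) = \<one>\<^bsub>G\<^esub>"
    by (simp add: mult_2[symmetric] alt_word_even one_eq_cls cls_eq_iff cox_rel_relator)
  \<comment> \<open>The relator of length \<open>2 * k\<close> is the reverse of one alternating
    word followed by the other.\<close>
  moreover have "alt_word (k + k) i j = rev (alt_word k j i) @ alt_word k i j"
    by (simp add: alt_word_append rev_alt_word)
  ultimately have "iv (cls (alt_word k j i)) \<cdot> cls (alt_word k i j) = \<one>\<^bsub>G\<^esub>"
    by (simp add: inv_cls cls_mult)
  then show ?thesis
    by (metis W.inv_comm W.inv_equality W.inv_inv W.inv_closed cls_carrier)
qed

text \<open>For a finite bond the sine formula is evaluated at \<open>(n - 1) * pi / k\<close>, and
  the bound \<open>n \<le> k + 1\<close> keeps this angle between 0 and \<open>pi\<close>.\<close>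

lemma cheb_nonneg:
  assumes "i \<noteq> j" "1 \<le> n" "\<And>k. m i j = enat k \<Longrightarrow> n \<le> k + 1"
  shows "0 \<le> cheb (- cox_form m (\<alpha> i) (\<alpha> j)) n"
proof (cases "m i j")
  case infinity
  then show ?thesis using assms(2) by (simp add: cox_form_axis cheb_1)
next
  case (enat k)
  define t where "t = pi / real k"
  have s: "sin t > 0" "t > 0" using angle_bounds[OF assms(1) enat] by (simp_all add: t_def)
  have k: "k \<ge> 2" using m_finite_ge_2 assms(1) enat by blast
  have kt: "real k * t = pi" using k by (simp add: t_def)
  have "(real n - 1) * t \<le> real k * t"
    using assms(3)[OF enat] s by (intro mult_right_mono) auto
  then have "sin ((real n - 1) * t) \<ge> 0"
    using kt s assms(2) by (intro sin_ge_zero) auto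
  then have "0 \<le> sin t * cheb (cos t) n" by (simp add: cheb_cos)
  then have "0 \<le> cheb (cos t) n" using s by (simp add: zero_le_mult_iff)
  then show ?thesis using enat by (simp add: cox_form_axis t_def)
qed

text \<open>Strip from \<open>w\<close> a longest suffix alternating between \<open>i\<close> and a right descent \<open>j\<close>: the rest
  is shorter and has neither descent, and the suffix maps \<open>\<alpha> i\<close> to a nonnegative combination of
  \<open>\<alpha> i\<close> and \<open>\<alpha> j\<close>.\<close>

lemma rho_nonneg_if_ascent:
  "\<lbrakk>w \<in> carrier G; len w < len (w \<cdot> sg i)\<rbrakk> \<Longrightarrow> 0 \<le> \<rho> w (\<alpha> i)"
proof (induction "len w" arbitrary: w i rule: less_induct)
  case less
  note w = less.prems(1)
  show ?case
  proof (cases "w = \<one>\<^bsub>G\<^esub>")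
    case True
    then show ?thesis by (simp add: less_eq_vec_def axis_def)
  next
    case False
    then obtain j where j: "len (w \<cdot> sg j) < len w" using right_descent w by blast
    with less.prems have ij: "i \<noteq> j" by auto
    define P where "P k \<longleftrightarrow> (\<exists>v\<in>carrier G. w = v \<cdot> cls (alt_word k i j) \<and> len v + k = len w)" for k
    have "P 1" unfolding P_def
    proof (intro bexI conjI)
      show "w = w \<cdot> sg j \<cdot> cls (alt_word 1 i j)" using w by (simp add: simple_gen_cls[symmetric])
      show "len (w \<cdot> sg j) + 1 = len w" using len_mult_sg[OF w, of j] j by auto
    qed (use w in simp)
    moreover have bound: "\<And>k. P k \<Longrightarrow> k \<le> len w" by (auto simp: P_def)
    ultimately have PG: "P (Greatest P)" and G1: "1 \<le> Greatest P"
      by (auto intro: GreatestI_nat Greatest_le_nat)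
    define k where "k = Greatest P"
    have kmax: "\<not> P (Suc k)" using Greatest_le_nat[of P "Suc k", OF _ bound] by (auto simp: k_def)
    obtain v where v: "v \<in> carrier G" "w = v \<cdot> cls (alt_word k i j)" "len v + k = len w"
      using PG by (auto simp: P_def k_def)
    obtain k' where k': "k = Suc k'" using G1 by (cases k) (auto simp: k_def)
    \<comment> \<open>The letter that continues the alternation: a descent of \<open>v\<close> there
      would give a longer suffix, against the maximality of \<open>k\<close>.\<close>
    have asc1: "len v < len (v \<cdot> sg (if even k then j else i))" (is "_ < len (v \<cdot> sg ?c)")
    proof -
      have "cls (alt_word (Suc k) i j) = sg ?c \<cdot> cls (alt_word k i j)"
        unfolding alt_word_Cons[of k] by (simp add: simple_gen_cls cls_mult)
      then have "w = v \<cdot> sg ?c \<cdot> cls (alt_word (Suc k) i j)"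
        using v by (simp add: W.m_assoc[symmetric] del: alt_word.simps)
      with kmax v have "len (v \<cdot> sg ?c) + Suc k \<noteq> len w" unfolding P_def by (metis W.m_closed sg_carrier)
      then show ?thesis using len_mult_sg[OF v(1), of ?c] v(3) by auto
    qed
    \<comment> \<open>The first letter of the suffix: if it did not lengthen \<open>v\<close>, then
      absorbing it into \<open>v\<close> would express \<open>w\<close> by too few letters.\<close>
    have asc2: "len v < len (v \<cdot> sg (if even k' then j else i))" (is "_ < len (v \<cdot> sg ?d)")
    proof -
      have "w = v \<cdot> (sg ?d \<cdot> cls (alt_word k' i j))"
        using v unfolding k' alt_word_Cons by (simp add: simple_gen_cls cls_mult)
      then have "w = v \<cdot> sg ?d \<cdot> cls (alt_word k' i j)"
        using v by (simp add: W.m_assoc)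
      then have "len w \<le> len (v \<cdot> sg ?d) + len (cls (alt_word k' i j))"
        using len_mult_le[of "v \<cdot> sg ?d" "cls (alt_word k' i j)"] v by simp
      also have "\<dots> \<le> len (v \<cdot> sg ?d) + k'" using len_cls_le[of "alt_word k' i j"] by simp
      finally show ?thesis using v k' by simp
    qed
    have "len v < len w" using v k' by simp
    moreover have "len v < len (v \<cdot> sg i)" "len v < len (v \<cdot> sg j)"
      using asc1 asc2 k' by (auto split: if_splits)
    ultimately have pos: "0 \<le> \<rho> v (\<alpha> i)" "0 \<le> \<rho> v (\<alpha> j)"
      using less.hyps v(1) by blast+
    \<comment> \<open>A suffix of length at least \<open>M\<close> could be rewritten by the braid
      relation so as to end in \<open>i\<close>, which would make \<open>i\<close> a descent of
      \<open>w\<close>.\<close>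
    have kM: "k < M" if M: "m i j = enat M" for M
    proof (rule ccontr)
      assume "\<not> k < M"
      then obtain r where r: "k = r + M" by (metis add.commute le_Suc_ex not_less)
      obtain M' where M': "M = Suc M'" using m_finite_ge_2[OF ij M] by (cases M) auto
      define pre where "pre = (if even M then alt_word r i j else alt_word r j i)"
      have "cls (alt_word k i j) = cls pre \<cdot> cls (alt_word M i j)"
        by (simp add: r alt_word_append pre_def cls_mult)
      also have "\<dots> = cls pre \<cdot> cls (alt_word M j i)" by (simp add: braid_relation[OF M])
      also have "\<dots> = cls (pre @ alt_word M' i j) \<cdot> sg i"
        by (simp add: M' simple_gen_cls cls_mult)
      finally have "w \<cdot> sg i = v \<cdot> cls (pre @ alt_word M' i j)"
        using v by (simp add: W.m_assoc)
      then have "len (w \<cdot> sg i) \<le> len v + len (cls (pre @ alt_word M' i j))"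
        using len_mult_le[of v] v by simp
      also have "\<dots> \<le> len v + (r + M')"
        using len_cls_le[of "pre @ alt_word M' i j"] by (cases "even M") (simp_all add: pre_def)
      finally show False using less.prems v r M' by simp
    qed
    define c where "c = - cox_form m (\<alpha> i) (\<alpha> j)"
    \<comment> \<open>The bound \<open>k < M\<close> is exactly what \<open>cheb_nonneg\<close> asks
      for at the larger index \<open>k + 2\<close>.\<close>
    have ch: "0 \<le> cheb c (Suc k)" "0 \<le> cheb c (Suc (Suc k))"
      unfolding c_def using kM by (auto intro!: cheb_nonneg ij simp del: cheb.simps dest: kM)
    have "\<exists>x y. 0 \<le> x \<and> 0 \<le> y \<and> act m (alt_word k i j) (\<alpha> i) = x *\<^sub>R \<alpha> i + y *\<^sub>R \<alpha> j"
      using act_alt_word[OF c_def, of k] ch by (metis)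
    then obtain x y where xy: "0 \<le> x" "0 \<le> y" "act m (alt_word k i j) (\<alpha> i) = x *\<^sub>R \<alpha> i + y *\<^sub>R \<alpha> j"
      by blast
    have "\<rho> w (\<alpha> i) = x *\<^sub>R \<rho> v (\<alpha> i) + y *\<^sub>R \<rho> v (\<alpha> j)"
      unfolding v(2) using v(1) by (simp add: rho_mult geo_act_cls[of "alt_word k i j"] xy linear_rho linear_add linear_scale)
    then show ?thesis using pos xy by (simp add: less_eq_vec_def)
  qed
qed

lemma rho_nonpos_if_descent:
  assumes "w \<in> carrier G" "len (w \<cdot> sg i) < len w"
  shows "\<rho> w (\<alpha> i) \<le> 0"
proof -
  have "0 \<le> \<rho> (w \<cdot> sg i) (\<alpha> i)"
    using assms by (intro rho_nonneg_if_ascent) auto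
  then show ?thesis using assms by (simp add: rho_mult rho_sg_same rho_minus)
qed

lemma axis_nonneg: "0 \<le> (\<alpha> i :: real ^ 'v)"
  by (simp add: less_eq_vec_def axis_def)

lemma axis_ne_0: "(\<alpha> i :: real ^ 'v) \<noteq> 0"
  by simp

lemma root_sign: "w \<in> carrier G \<Longrightarrow> 0 \<le> \<rho> w (\<alpha> i) \<or> \<rho> w (\<alpha> i) \<le> 0"
  using rho_nonneg_if_ascent rho_nonpos_if_descent len_mult_sg[of w i] by fastforce

lemma descent_iff: "w \<in> carrier G \<Longrightarrow> len (w \<cdot> sg i) < len w \<longleftrightarrow> \<rho> w (\<alpha> i) \<le> 0"
  using rho_nonneg_if_ascent[of w i] rho_nonpos_if_descent[of w i] len_mult_sg[of w i] rho_eq_0_iff[of w "\<alpha> i"]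
  by (metis antisym axis_ne_0 less_add_one)

lemma ascent_iff: "w \<in> carrier G \<Longrightarrow> len w < len (w \<cdot> sg i) \<longleftrightarrow> 0 \<le> \<rho> w (\<alpha> i)"
  using rho_nonneg_if_ascent[of w i] rho_nonpos_if_descent[of w i] len_mult_sg[of w i] rho_eq_0_iff[of w "\<alpha> i"]
  by (metis antisym axis_ne_0 less_add_one)

lemma eq_one_if_nonneg: "\<lbrakk>w \<in> carrier G; \<And>i. 0 \<le> \<rho> w (\<alpha> i)\<rbrakk> \<Longrightarrow> w = \<one>\<^bsub>G\<^esub>"
  by (metis ascent_iff right_descent less_asym)

section \<open>Parabolic subgroups\<close>

abbreviation par where "par I \<equiv> parabolic m I"

definition coord_space :: "'v set \<Rightarrow> (real ^ 'v) set" where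
  "coord_space I = {v. \<forall>j. j \<notin> I \<longrightarrow> v $ j = 0}"

lemma subspace_coord_space: "subspace (coord_space I)"
  by (auto simp: subspace_def coord_space_def)

lemma axis_coord_space [simp]: "\<alpha> i \<in> coord_space I \<longleftrightarrow> i \<in> I"
  by (auto simp: coord_space_def axis_def)

lemma coord_space_expansion:
  "v \<in> coord_space I \<Longrightarrow> v = (\<Sum>i\<in>I. v $ i *\<^sub>R \<alpha> i)"
proof -
  assume v: "v \<in> coord_space I"
  have "v = (\<Sum>i\<in>UNIV. v $ i *\<^sub>R \<alpha> i)"
    using basis_expansion[of v] by (simp add: scalar_mult_eq_scaleR)
  also have "\<dots> = (\<Sum>i\<in>I. v $ i *\<^sub>R \<alpha> i)"
    using v by (intro sum.mono_neutral_right) (auto simp: coord_space_def)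
  finally show ?thesis .
qed

lemma linear_coord_space:
  assumes "linear f" "v \<in> coord_space I"
  shows "f v = (\<Sum>i\<in>I. v $ i *\<^sub>R f (\<alpha> i))"
  by (subst coord_space_expansion[OF assms(2)]) (simp add: assms linear_sum linear_scale)

lemma linear_maps_coord_space:
  assumes "linear f" "v \<in> coord_space I" "\<And>i. i \<in> I \<Longrightarrow> f (\<alpha> i) \<in> coord_space K"
  shows "f v \<in> coord_space K"
  unfolding linear_coord_space[OF assms(1,2)]
  by (intro subspace_sum subspace_scale subspace_coord_space assms)

lemma linear_nonneg:
  fixes f :: "real ^ 'v \<Rightarrow> real ^ 'v"
  assumes "linear f" "v \<in> coord_space I" "0 \<le> v" "\<And>i. i \<in> I \<Longrightarrow> 0 \<le> f (\<alpha> i)"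
  shows "0 \<le> f v"
  unfolding linear_coord_space[OF assms(1,2)]
  using assms(3,4) by (intro sum_nonneg scaleR_nonneg_nonneg) (auto simp: less_eq_vec_def)

lemma linear_nonpos:
  fixes f :: "real ^ 'v \<Rightarrow> real ^ 'v"
  assumes "linear f" "v \<in> coord_space I" "v \<le> 0" "\<And>i. i \<in> I \<Longrightarrow> 0 \<le> f (\<alpha> i)"
  shows "f v \<le> 0"
proof -
  have "- v \<in> coord_space I" using assms(2) by (intro subspace_neg subspace_coord_space)
  then have "0 \<le> f (- v)" by (rule linear_nonneg[OF assms(1)]) (use assms in auto)
  then show ?thesis using assms(1) by (simp add: linear_neg)
qed

section \<open>Parabolic subgroups acting on coordinate subspaces\<close>

lemma subgroup_par: "subgroup (par I) G"
  unfolding parabolic_def by (intro W.generate_is_subgroup) auto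

lemma par_carrier [intro]: "w \<in> par I \<Longrightarrow> w \<in> carrier G"
  using subgroup.subset[OF subgroup_par] by blast

lemma par_one [simp]: "\<one>\<^bsub>G\<^esub> \<in> par I"
  using subgroup.one_closed[OF subgroup_par] .

lemma par_mult [intro]: "x \<in> par I \<Longrightarrow> y \<in> par I \<Longrightarrow> x \<cdot> y \<in> par I"
  using subgroup.m_closed[OF subgroup_par] .

lemma par_inv [intro]: "x \<in> par I \<Longrightarrow> iv x \<in> par I"
  using subgroup.m_inv_closed[OF subgroup_par] .

lemma par_sg [intro]: "i \<in> I \<Longrightarrow> sg i \<in> par I"
  unfolding parabolic_def by (auto intro: generate.incl)

lemma par_mono: "I \<subseteq> K \<Longrightarrow> par I \<subseteq> par K"
  unfolding parabolic_def by (intro W.mono_generate image_mono)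

lemma par_induct [consumes 1, case_names one gen]:
  assumes "w \<in> par I" "P \<one>\<^bsub>G\<^esub>"
    "\<And>w i. \<lbrakk>w \<in> par I; P w; i \<in> I\<rbrakk> \<Longrightarrow> P (sg i \<cdot> w)"
  shows "P w"
proof -
  have "P (x \<cdot> y)" if "x \<in> par I" "y \<in> par I" "P y" for x y
    using that(1) unfolding parabolic_def using that(2,3)
  proof (induction arbitrary: y rule: generate.induct)
    case one
    then show ?case by (simp add: par_carrier)
  next
    case (incl h)
    then show ?case using assms(3) by auto
  next
    case (inv h)
    then show ?case using assms(3) by auto
  next
    case (eng h1 h2)
    have "h1 \<in> par I" "h2 \<in> par I" using eng unfolding parabolic_def by auto
    then have "h1 \<cdot> h2 \<cdot> y = h1 \<cdot> (h2 \<cdot> y)" using eng.prems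
      by (intro W.m_assoc) (simp_all add: par_carrier)
    then show ?case using eng \<open>h2 \<in> par I\<close> by (simp add: par_mult)
  qed
  from this[OF assms(1) par_one assms(2)] show ?thesis using assms(1) by (simp add: par_carrier)
qed

text \<open>Each generator \<open>sg i\<close> changes only the coordinate at \<open>i\<close>. This
  makes membership in \<open>par I\<close> visible in coordinates.\<close>

lemma par_moves:
  assumes "w \<in> par I" shows "\<rho> w v - v \<in> coord_space I"
  using assms
proof (induction rule: par_induct)
  case one
  then show ?case by (simp add: subspace_0 subspace_coord_space)
next
  case (gen w i)
  then show ?case
    using simple_refl_nth_other[of _ i]
    by (auto simp: coord_space_def rho_mult rho_sg par_carrier) metis
qed

lemma par_coord: "w \<in> par I \<Longrightarrow> j \<notin> I \<Longrightarrow> \<rho> w v $ j = v $ j"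
  using par_moves[of w I v] by (auto simp: coord_space_def)

lemma par_preserves:
  assumes "w \<in> par I" "I \<subseteq> K" "v \<in> coord_space K"
  shows "\<rho> w v \<in> coord_space K"
proof -
  have "\<rho> w v $ j = 0" if "j \<notin> K" for j
  proof -
    have "j \<notin> I" using that assms(2) by blast
    then show ?thesis using par_coord[OF assms(1)] assms(3) that by (simp add: coord_space_def)
  qed
  then show ?thesis by (simp add: coord_space_def)
qed

text \<open>Coordinates outside \<open>I\<close> are unchanged, so there they equal their own
  negatives. This locates the image of a simple root once a conjugate of its reflection is known to
  lie in a parabolic subgroup.\<close>

lemma par_negates:
  assumes "w \<in> par I" "\<rho> w v = - v"
  shows "v \<in> coord_space I"
proof -
  have "v $ j = 0" if "j \<notin> I" for j
    using par_coord[OF assms(1) that, of v] unfolding assms(2) by simp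
  then show ?thesis by (simp add: coord_space_def)
qed

text \<open>For \<open>j \<notin> I\<close> the coordinate of \<open>\<rho> w (\<alpha> j)\<close>
  at \<open>j\<close> is still 1, which already decides the sign of that root; together with the
  assumption on \<open>I\<close> this leaves \<open>w\<close> without descents.\<close>

lemma par_eq_one:
  assumes w: "w \<in> par I" and pos: "\<And>i. i \<in> I \<Longrightarrow> 0 \<le> \<rho> w (\<alpha> i)"
  shows "w = \<one>\<^bsub>G\<^esub>"
proof (rule eq_one_if_nonneg)
  fix j
  show "0 \<le> \<rho> w (\<alpha> j)"
  proof (cases "j \<in> I")
    case False
    then have "\<rho> w (\<alpha> j) $ j = 1" using par_coord[OF w] by (simp add: axis_def)
    then have "\<not> \<rho> w (\<alpha> j) \<le> 0" by (auto simp: less_eq_vec_def intro!: exI[of _ j])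
    then show ?thesis using root_sign w by blast
  qed (rule pos)
qed (use w in blast)

lemma rho_faithful:
  assumes "x \<in> carrier G" "y \<in> carrier G" "\<And>v. \<rho> x v = \<rho> y v"
  shows "x = y"
proof -
  have "iv y \<cdot> x = \<one>\<^bsub>G\<^esub>"
    using assms by (intro eq_one_if_nonneg) (auto simp: rho_mult axis_nonneg)
  then show ?thesis using assms by (metis W.inv_equality W.inv_inv W.inv_closed W.inv_comm)
qed

text \<open>In a nonnegative combination equal to a simple root, every term is a multiple of that root; the
  form then fixes the multiple to be 1.\<close>

lemma simple_root_indecomposable:
  assumes f: "linear f" "inj f" "\<And>u v. cox_form m (f u) (f v) = cox_form m u v"
    and pos: "\<And>j. j \<in> K \<Longrightarrow> 0 \<le> f (\<alpha> j)"
    and v: "v \<in> coord_space K" "0 \<le> v" "f v = \<alpha> i"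
  shows "v \<in> \<alpha> ` K"
proof -
  have "v \<noteq> 0" using v(3) f(1) by (auto simp: linear_0)
  then obtain j where j: "v $ j \<noteq> 0" by (auto simp: vec_eq_iff)
  then have jK: "j \<in> K" and vj: "v $ j > 0" using v(1,2) by (auto simp: coord_space_def less_eq_vec_def less_le)
  have "f (\<alpha> j) $ l = 0" if "l \<noteq> i" for l
  proof -
    have "0 = f v $ l" using that by (simp add: v(3) axis_def)
    also have "\<dots> = (\<Sum>k\<in>K. v $ k * f (\<alpha> k) $ l)"
      unfolding linear_coord_space[OF f(1) v(1)] by simp
    finally have "(\<Sum>k\<in>K. v $ k * f (\<alpha> k) $ l) = 0" by simp
    moreover have "0 \<le> v $ k * f (\<alpha> k) $ l" if "k \<in> K" for k
      using v(2) pos[OF that] by (simp add: less_eq_vec_def)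
    ultimately have "v $ j * f (\<alpha> j) $ l = 0"
      using jK by (subst (asm) sum_nonneg_eq_0_iff) auto
    then show ?thesis using vj by simp
  qed
  then obtain d where d: "f (\<alpha> j) = d *\<^sub>R \<alpha> i"
    by (auto simp: vec_eq_iff axis_def intro!: that[of "f (\<alpha> j) $ i"])
  have "d \<ge> 0" using pos[OF jK] unfolding d by (auto simp: less_eq_vec_def axis_def split: if_splits)
  moreover have "d * d = 1"
    using f(3)[of "\<alpha> j" "\<alpha> j"] by (simp add: d cox_form_simps cox_form_axis_same)
  ultimately have "d = 1" by (simp add: square_eq_1_iff)
  then have "f v = f (\<alpha> j)" using d v(3) by simp
  then have "v = \<alpha> j" by (rule injD[OF f(2)])
  with jK show ?thesis by blast
qed

lemma inj_rho: "w \<in> carrier G \<Longrightarrow> inj (\<rho> w)"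
  by (auto simp: inj_def rho_eq_iff)

subsection \<open>Minimal coset representatives\<close>

text \<open>If \<open>t\<close> made some \<open>\<alpha> i\<close> negative, the result would be a
  nonpositive combination of simple roots from \<open>I\<close>, and \<open>u\<close> would keep it
  nonpositive, against the positivity of \<open>u \<cdot> t\<close>.\<close>

lemma coset_rep_unique:
  assumes "u \<in> carrier G" "t \<in> par I"
    and "\<And>i. i \<in> I \<Longrightarrow> 0 \<le> \<rho> u (\<alpha> i)" "\<And>i. i \<in> I \<Longrightarrow> 0 \<le> \<rho> (u \<cdot> t) (\<alpha> i)"
  shows "t = \<one>\<^bsub>G\<^esub>"
proof (rule par_eq_one[OF assms(2)])
  fix i assume i: "i \<in> I"
  show "0 \<le> \<rho> t (\<alpha> i)"
  proof (rule ccontr)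
    assume "\<not> 0 \<le> \<rho> t (\<alpha> i)"
    then have "\<rho> t (\<alpha> i) \<le> 0" using root_sign assms(2) by blast
    moreover have "\<rho> t (\<alpha> i) \<in> coord_space I" using i assms(2) by (intro par_preserves) auto
    ultimately have "\<rho> u (\<rho> t (\<alpha> i)) \<le> 0"
      by (intro linear_nonpos[OF linear_rho[OF assms(1)]] assms(3))
    then have "\<rho> (u \<cdot> t) (\<alpha> i) \<le> 0"
      using assms(1,2) by (simp add: rho_mult par_carrier)
    then have "\<rho> (u \<cdot> t) (\<alpha> i) = 0" using assms(4)[OF i] by (intro antisym) auto
    then show False using assms(1,2) by (simp add: rho_eq_0_iff par_carrier)
  qed
qed

lemma coset_rep:
  assumes "g \<in> carrier G"
  obtains u t where "u \<in> carrier G" "t \<in> par I" "g = u \<cdot> t" "\<And>i. i \<in> I \<Longrightarrow> 0 \<le> \<rho> u (\<alpha> i)"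
    "\<And>t'. t' \<in> par I \<Longrightarrow> len u \<le> len (g \<cdot> t')"
proof -
  obtain t' where t': "t' \<in> par I" "\<And>s. s \<in> par I \<Longrightarrow> len (g \<cdot> t') \<le> len (g \<cdot> s)"
    using arg_min_nat_lemma[of "\<lambda>t. t \<in> par I" _ "\<lambda>t. len (g \<cdot> t)", OF par_one] by blast
  have "0 \<le> \<rho> (g \<cdot> t') (\<alpha> i)" if "i \<in> I" for i
  proof -
    have "len (g \<cdot> t') \<le> len (g \<cdot> (t' \<cdot> sg i))" using t' that by blast
    also have "g \<cdot> (t' \<cdot> sg i) = g \<cdot> t' \<cdot> sg i" using assms t'(1) by (simp add: W.m_assoc par_carrier)
    finally show ?thesis
      using len_mult_sg[of "g \<cdot> t'" i] assms t'(1) by (subst ascent_iff[symmetric]) (auto simp: par_carrier)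
  qed
  moreover have "g = g \<cdot> t' \<cdot> iv t'" using assms t'(1) by (simp add: W.m_assoc par_carrier)
  ultimately show thesis using that[of "g \<cdot> t'" "iv t'"] assms t' by (auto simp: par_carrier)
qed

text \<open>For the converse, \<open>u\<close> is compared with a shortest element \<open>v\<close>
  of its coset: both are nonnegative on \<open>I\<close>, and such a representative is
  unique.\<close>

lemma minimal_iff:
  assumes "u \<in> carrier G"
  shows "(\<forall>t\<in>par I. len u \<le> len (u \<cdot> t)) \<longleftrightarrow> (\<forall>i\<in>I. 0 \<le> \<rho> u (\<alpha> i))"
proof
  assume *: "\<forall>t\<in>par I. len u \<le> len (u \<cdot> t)"
  show "\<forall>i\<in>I. 0 \<le> \<rho> u (\<alpha> i)"
  proof
    fix i assume "i \<in> I"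
    then have "len u \<le> len (u \<cdot> sg i)" using * by blast
    then show "0 \<le> \<rho> u (\<alpha> i)"
      using len_mult_sg[of u i] assms by (subst ascent_iff[symmetric]) auto
  qed
next
  assume *: "\<forall>i\<in>I. 0 \<le> \<rho> u (\<alpha> i)"
  obtain v t where v: "v \<in> carrier G" "t \<in> par I" "u = v \<cdot> t" "\<And>i. i \<in> I \<Longrightarrow> 0 \<le> \<rho> v (\<alpha> i)"
    "\<And>t'. t' \<in> par I \<Longrightarrow> len v \<le> len (u \<cdot> t')"
    using coset_rep[OF assms] by blast
  then have "t = \<one>\<^bsub>G\<^esub>" using coset_rep_unique[OF v(1,2)] * by blast
  with v show "\<forall>t\<in>par I. len u \<le> len (u \<cdot> t)" by simp
qed

subsection \<open>Elements matching simple roots\<close>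

text \<open>Note the direction: \<open>matches x I J\<close> says \<open>x \<in> Hom(J, I)\<close> in the Brink--Howlett groupoid.\<close>

definition matches :: "'v list set \<Rightarrow> 'v set \<Rightarrow> 'v set \<Rightarrow> bool" where
  "matches x I J \<longleftrightarrow> x \<in> carrier G \<and> \<rho> x ` \<alpha> ` I = \<alpha> ` J"

lemma matches_carrier: "matches x I J \<Longrightarrow> x \<in> carrier G"
  by (simp add: matches_def)

lemma matches_one: "matches \<one>\<^bsub>G\<^esub> I I"
  by (simp add: matches_def)

lemma matches_mult: "matches x I J \<Longrightarrow> matches y K I \<Longrightarrow> matches (x \<cdot> y) K J"
proof -
  assume x: "matches x I J" and y: "matches y K I"
  then have "\<rho> (x \<cdot> y) = \<rho> x \<circ> \<rho> y" by (auto simp: matches_def rho_mult)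
  then have "\<rho> (x \<cdot> y) ` \<alpha> ` K = \<rho> x ` (\<rho> y ` \<alpha> ` K)" by (simp add: image_comp)
  with x y show ?thesis by (simp add: matches_def)
qed

lemma matches_inv: "matches x I J \<Longrightarrow> matches (iv x) J I"
proof -
  assume x: "matches x I J"
  then have "\<rho> (iv x) ` \<alpha> ` J = (\<rho> (iv x) \<circ> \<rho> x) ` \<alpha> ` I" by (metis matches_def image_comp)
  also have "\<rho> (iv x) \<circ> \<rho> x = id" using x by (auto simp: matches_def)
  finally show ?thesis using x by (simp add: matches_def)
qed

lemma matchesE:
  assumes "matches x I J" "i \<in> I"
  obtains j where "j \<in> J" "\<rho> x (\<alpha> i) = \<alpha> j"
  using assms by (auto simp: matches_def)

lemma matches_card: "matches x I J \<Longrightarrow> card I = card J"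
proof -
  assume x: "matches x I J"
  have inj: "inj (\<alpha> :: 'v \<Rightarrow> real ^ 'v)" by (auto simp: inj_def axis_eq_axis)
  have "card I = card (\<alpha> ` I :: (real ^ 'v) set)" using inj by (simp add: card_image inj_on_subset[OF _ subset_UNIV])
  also have "\<dots> = card (\<rho> x ` \<alpha> ` I)"
    using inj_rho[of x] x by (intro card_image[symmetric]) (auto simp: matches_def intro: inj_on_subset)
  also have "\<dots> = card (\<alpha> ` J :: (real ^ 'v) set)" using x by (simp add: matches_def)
  also have "\<dots> = card J" using inj by (simp add: card_image inj_on_subset[OF _ subset_UNIV])
  finally show ?thesis .
qed

text \<open>Positivity of \<open>x\<close> forces positivity of its inverse: a negative
  \<open>\<rho> (iv x) (\<alpha> j)\<close> would be sent by \<open>x\<close> to a nonpositive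
  vector, but its image is \<open>\<alpha> j\<close>. With both maps positive, the indecomposability
  of simple roots applies in each direction.\<close>

lemma matchesI:
  assumes x: "x \<in> carrier G"
    and "\<And>i. i \<in> I \<Longrightarrow> \<rho> x (\<alpha> i) \<in> coord_space J" "\<And>j. j \<in> J \<Longrightarrow> \<rho> (iv x) (\<alpha> j) \<in> coord_space I"
    and pos: "\<And>i. i \<in> I \<Longrightarrow> 0 \<le> \<rho> x (\<alpha> i)"
  shows "matches x I J"
proof -
  have pos': "0 \<le> \<rho> (iv x) (\<alpha> j)" if j: "j \<in> J" for j
  proof (rule ccontr)
    assume "\<not> ?thesis"
    then have "\<rho> (iv x) (\<alpha> j) \<le> 0" using root_sign x by blast
    then have "\<rho> x (\<rho> (iv x) (\<alpha> j)) \<le> 0"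
      by (rule linear_nonpos[OF linear_rho[OF x] assms(3)[OF j]]) (rule pos)
    then have "(\<alpha> j :: real ^ 'v) \<le> 0" using x by simp
    then show False using axis_nonneg[of j] axis_ne_0[of j] by (meson antisym)
  qed
  have 1: "\<rho> x (\<alpha> i) \<in> \<alpha> ` J" if "i \<in> I" for i
    by (rule simple_root_indecomposable[of "\<rho> (iv x)" J "\<rho> x (\<alpha> i)" i])
      (use assms pos' that in \<open>simp_all add: linear_rho inj_rho rho_preserves\<close>)
  have 2: "\<rho> (iv x) (\<alpha> j) \<in> \<alpha> ` I" if "j \<in> J" for j
    by (rule simple_root_indecomposable[of "\<rho> x" I "\<rho> (iv x) (\<alpha> j)" j])
      (use assms pos' that in \<open>simp_all add: linear_rho inj_rho rho_preserves\<close>)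
  have "\<alpha> j \<in> \<rho> x ` \<alpha> ` I" if "j \<in> J" for j
    using 2[OF that] x by (metis imageI rho_inv_right)
  with 1 x show ?thesis by (auto simp: matches_def)
qed

text \<open>The factor split off lies in \<open>par I\<close> and so preserves
  \<open>coord_space I\<close>; hence both subspace conditions pass from \<open>x\<close> to the
  representative \<open>u\<close>, which has the positivity that \<open>matchesI\<close> asks
  for.\<close>

lemma matches_coset_rep:
  assumes x: "x \<in> carrier G"
    and V: "\<And>i. i \<in> I \<Longrightarrow> \<rho> x (\<alpha> i) \<in> coord_space J" "\<And>j. j \<in> J \<Longrightarrow> \<rho> (iv x) (\<alpha> j) \<in> coord_space I"
  obtains u t where "matches u I J" "t \<in> par I" "x = u \<cdot> t"
proof -
  obtain u t where u: "u \<in> carrier G" "t \<in> par I" "x = u \<cdot> t" "\<And>i. i \<in> I \<Longrightarrow> 0 \<le> \<rho> u (\<alpha> i)"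
    using coset_rep[OF x] by metis
  have t: "t \<in> carrier G" using u(2) by blast
  have "matches u I J"
  proof (rule matchesI)
    fix i assume "i \<in> I"
    have "u = x \<cdot> iv t" using u t by (simp add: W.m_assoc)
    then have "\<rho> u (\<alpha> i) = \<rho> x (\<rho> (iv t) (\<alpha> i))" using x t by (simp add: rho_mult)
    also have "\<dots> \<in> coord_space J"
      by (rule linear_maps_coord_space[OF linear_rho[OF x], where I = I])
        (use \<open>i \<in> I\<close> u(2) V in \<open>auto intro: par_preserves\<close>)
    finally show "\<rho> u (\<alpha> i) \<in> coord_space J" .
  next
    fix j assume "j \<in> J"
    have "iv u = t \<cdot> iv x" using u t by (simp add: W.inv_mult_group W.m_assoc[symmetric])
    then have "\<rho> (iv u) (\<alpha> j) = \<rho> t (\<rho> (iv x) (\<alpha> j))" using x t by (simp add: rho_mult)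
    also have "\<dots> \<in> coord_space I" using V(2)[OF \<open>j \<in> J\<close>] u(2) par_preserves by blast
    finally show "\<rho> (iv u) (\<alpha> j) \<in> coord_space I" .
  qed (use u in auto)
  with u show thesis using that by blast
qed

text \<open>A form-preserving map carries the reflection in a root to the reflection in its image;
  faithfulness turns this equality of operators into one in the group.\<close>

lemma conj_simple:
  assumes x: "x \<in> carrier G" and "\<rho> x (\<alpha> i) = \<alpha> j"
  shows "x \<cdot> sg i = sg j \<cdot> x"
proof (rule rho_faithful)
  fix v
  have "cox_form m (\<alpha> j) (\<rho> x v) = cox_form m (\<alpha> i) v"
    using rho_preserves[OF x, of "\<alpha> i" v] assms(2) by simp
  then show "\<rho> (x \<cdot> sg i) v = \<rho> (sg j \<cdot> x) v"
    using assms by (simp add: rho_mult rho_sg simple_refl_def linear_diff[OF linear_rho] linear_scale[OF linear_rho])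
qed (use x in auto)

lemma matches_conj:
  assumes x: "matches x I J" and t: "t \<in> par I"
  obtains t' where "t' \<in> par J" "x \<cdot> t = t' \<cdot> x"
proof -
  from t have "\<exists>t'\<in>par J. x \<cdot> t = t' \<cdot> x"
  proof (induction rule: par_induct)
    case one
    then show ?case using matches_carrier[OF x] by (auto intro!: bexI[of _ "\<one>\<^bsub>G\<^esub>"])
  next
    case (gen w i)
    then obtain t' where t': "t' \<in> par J" "x \<cdot> w = t' \<cdot> x" by blast
    obtain j where j: "j \<in> J" "\<rho> x (\<alpha> i) = \<alpha> j" using matchesE[OF x \<open>i \<in> I\<close>] .
    have "x \<cdot> (sg i \<cdot> w) = sg j \<cdot> t' \<cdot> x"
      using conj_simple[OF matches_carrier[OF x] j(2)] t' matches_carrier[OF x] gen(1)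
      by (metis W.m_assoc par_carrier sg_carrier)
    then show ?case using j t' by blast
  qed
  then show thesis using that by blast
qed

text \<open>Write \<open>x \<cdot> sg i\<close> as \<open>t \<cdot> x\<close> with \<open>t\<close>
  in \<open>par J\<close>. Applied to \<open>\<alpha> i\<close>, this shows that \<open>t\<close>
  negates \<open>\<rho> x (\<alpha> i)\<close>, and elements of \<open>par J\<close> negate only
  vectors of \<open>coord_space J\<close>.\<close>

lemma parabolic_conj_coord_space:
  assumes x: "x \<in> carrier G" and eq: "par J #>\<^bsub>G\<^esub> x = x <#\<^bsub>G\<^esub> par I"
  shows "i \<in> I \<Longrightarrow> \<rho> x (\<alpha> i) \<in> coord_space J" "j \<in> J \<Longrightarrow> \<rho> (iv x) (\<alpha> j) \<in> coord_space I"
proof -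
  assume "i \<in> I"
  then have "x \<cdot> sg i \<in> par J #>\<^bsub>G\<^esub> x" unfolding eq by (auto simp: l_coset_def)
  then obtain t where t: "t \<in> par J" "x \<cdot> sg i = t \<cdot> x" by (auto simp: r_coset_def)
  have "\<rho> t (\<rho> x (\<alpha> i)) = \<rho> (x \<cdot> sg i) (\<alpha> i)" using t x by (simp add: rho_mult par_carrier)
  also have "\<dots> = - \<rho> x (\<alpha> i)" using x by (simp add: rho_mult rho_sg_same rho_minus)
  finally show "\<rho> x (\<alpha> i) \<in> coord_space J" using par_negates[OF t(1)] by blast
next
  assume "j \<in> J"
  then have "sg j \<cdot> x \<in> x <#\<^bsub>G\<^esub> par I" unfolding eq[symmetric] by (auto simp: r_coset_def)
  then obtain t where t: "t \<in> par I" "sg j \<cdot> x = x \<cdot> t" by (auto simp: l_coset_def)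
  have "\<rho> t (\<rho> (iv x) (\<alpha> j)) = \<rho> (iv x) (\<rho> (x \<cdot> t) (\<rho> (iv x) (\<alpha> j)))" using t x by (simp add: rho_mult par_carrier)
  also have "\<dots> = - \<rho> (iv x) (\<alpha> j)" using x by (simp add: t(2)[symmetric] rho_mult rho_sg_same rho_minus)
  finally show "\<rho> (iv x) (\<alpha> j) \<in> coord_space I" using par_negates[OF t(1)] by blast
qed

lemma matches_parabolic_conj:
  assumes x: "matches x I J" shows "par J #>\<^bsub>G\<^esub> x = x <#\<^bsub>G\<^esub> par I"
proof (intro equalityI subsetI)
  fix y assume "y \<in> par J #>\<^bsub>G\<^esub> x"
  then obtain t where t: "t \<in> par J" "y = t \<cdot> x" by (auto simp: r_coset_def)
  obtain t' where t': "t' \<in> par I" "iv x \<cdot> t = t' \<cdot> iv x" using matches_conj[OF matches_inv[OF x] t(1)] .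
  note c = matches_carrier[OF x] par_carrier[OF t(1)] par_carrier[OF t'(1)]
  have "y = x \<cdot> (iv x \<cdot> t) \<cdot> x" using t c by (simp add: W.m_assoc[symmetric])
  also have "\<dots> = x \<cdot> t'" using c by (simp add: t'(2) W.m_assoc)
  finally show "y \<in> x <#\<^bsub>G\<^esub> par I" using t' by (auto simp: l_coset_def)
next
  fix y assume "y \<in> x <#\<^bsub>G\<^esub> par I"
  then obtain t where t: "t \<in> par I" "y = x \<cdot> t" by (auto simp: l_coset_def)
  then show "y \<in> par J #>\<^bsub>G\<^esub> x" using matches_conj[OF x t(1)] by (auto simp: r_coset_def)
qed

section \<open>Chamber labels and associates in terms of matching elements\<close>

lemma Cham_eq: "Cham m J = {(x, I). matches x I J}"
proof (intro equalityI subsetI; clarify)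
  fix x I assume "(x, I) \<in> Cham m J"
  then have x: "x \<in> carrier G" "par J #>\<^bsub>G\<^esub> x = x <#\<^bsub>G\<^esub> par I"
    and "\<forall>t\<in>par I. len x \<le> len (x \<cdot> t)"
    by (auto simp: Cham_def l_coset_def)
  then have "\<forall>i\<in>I. 0 \<le> \<rho> x (\<alpha> i)" using minimal_iff by blast
  then show "matches x I J" using parabolic_conj_coord_space[OF x] x by (intro matchesI) auto
next
  fix x I assume x: "matches x I J"
  have "\<forall>i\<in>I. 0 \<le> \<rho> x (\<alpha> i)" using matchesE[OF x] axis_nonneg by metis
  then have "\<forall>t\<in>par I. len x \<le> len (x \<cdot> t)" using minimal_iff matches_carrier[OF x] by blast
  then show "(x, I) \<in> Cham m J"
    using matches_parabolic_conj[OF x] matches_carrier[OF x] by (auto simp: Cham_def l_coset_def)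
qed

text \<open>Conjugation by \<open>g\<close> takes \<open>par J\<close> to \<open>par I\<close>,
  while a matching element goes from \<open>I\<close> to \<open>J\<close>; so the witness is a
  representative of the coset of \<open>iv g\<close> modulo \<open>par I\<close>.\<close>

lemma associate_iff:
  "(\<exists>g\<in>carrier G. par I = g <#\<^bsub>G\<^esub> par J #>\<^bsub>G\<^esub> iv g) \<longleftrightarrow> (\<exists>x. matches x I J)"
proof
  assume "\<exists>g\<in>carrier G. par I = g <#\<^bsub>G\<^esub> par J #>\<^bsub>G\<^esub> iv g"
  then obtain g where g: "g \<in> carrier G" "par I = g <#\<^bsub>G\<^esub> par J #>\<^bsub>G\<^esub> iv g" by blast
  have sub: "par J \<subseteq> carrier G" by blast
  have "iv g <#\<^bsub>G\<^esub> par I = iv g <#\<^bsub>G\<^esub> (g <#\<^bsub>G\<^esub> (par J #>\<^bsub>G\<^esub> iv g))"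
    using g sub by (simp add: W.coset_assoc)
  also have "\<dots> = par J #>\<^bsub>G\<^esub> iv g"
    using g sub by (simp add: W.lcos_m_assoc W.r_coset_subset_G W.lcos_mult_one)
  finally have eq: "par J #>\<^bsub>G\<^esub> iv g = iv g <#\<^bsub>G\<^esub> par I" by simp
  show "\<exists>x. matches x I J"
    using matches_coset_rep[OF W.inv_closed[OF g(1)] parabolic_conj_coord_space[OF W.inv_closed[OF g(1)] eq]] by blast
next
  assume "\<exists>x. matches x I J"
  then obtain x where x: "matches x I J" by blast
  have c: "x \<in> carrier G" and sub: "par I \<subseteq> carrier G" "par J \<subseteq> carrier G" using matches_carrier[OF x] by blast+
  have "par I = iv x <#\<^bsub>G\<^esub> (x <#\<^bsub>G\<^esub> par I)" using c sub by (simp add: W.lcos_m_assoc W.lcos_mult_one)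
  also have "\<dots> = iv x <#\<^bsub>G\<^esub> par J #>\<^bsub>G\<^esub> iv (iv x)"
    using c sub by (simp add: matches_parabolic_conj[OF x, symmetric] W.coset_assoc)
  finally show "\<exists>g\<in>carrier G. par I = g <#\<^bsub>G\<^esub> par J #>\<^bsub>G\<^esub> iv g" using c by blast
qed

section \<open>Faces of the Tits cone\<close>

lemma dual_act_apply:
  assumes "x \<in> carrier G"
  shows "blinfun_apply (dual_act m x \<phi>) v = blinfun_apply \<phi> (\<rho> (iv x) v)"
proof -
  have "bounded_linear (\<lambda>v. blinfun_apply \<phi> (\<rho> (iv x) v))"
    using assms by (intro bounded_linear_compose[OF blinfun.bounded_linear_right])
      (simp add: linear_rho linear_conv_bounded_linear[symmetric])
  then show ?thesis by (simp add: dual_act_def bounded_linear_Blinfun_apply)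
qed

lemma linear_functional: "x \<in> carrier G \<Longrightarrow> linear (\<lambda>v. blinfun_apply \<phi> (\<rho> x v))"
  using linear_compose[OF linear_rho bounded_linear.linear[OF blinfun.bounded_linear_right], of x \<phi>]
  by (simp add: comp_def)

lemma functional_expansion:
  assumes "x \<in> carrier G" "v \<in> coord_space I"
  shows "blinfun_apply \<phi> (\<rho> x v) = (\<Sum>i\<in>I. v $ i * blinfun_apply \<phi> (\<rho> x (\<alpha> i)))"
proof -
  interpret L: linear "\<lambda>v. blinfun_apply \<phi> (\<rho> x v)" by (rule linear_functional[OF assms(1)])
  show ?thesis
    by (subst coord_space_expansion[OF assms(2)]) (simp add: L.sum L.scale)
qed

lemma functional_expansion_UNIV:
  "x \<in> carrier G \<Longrightarrow> blinfun_apply \<phi> (\<rho> x v) = (\<Sum>i\<in>UNIV. v $ i * blinfun_apply \<phi> (\<rho> x (\<alpha> i)))"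
  by (rule functional_expansion) (simp_all add: coord_space_def)

text \<open>The functional with prescribed values \<open>c i\<close> on the basis
  \<open>\<rho> x (\<alpha> i)\<close>; indicator functions for \<open>c\<close> give the dual
  basis.\<close>

definition dual_functional :: "'v list set \<Rightarrow> ('v \<Rightarrow> real) \<Rightarrow> 'v dual" where
  "dual_functional x c = Blinfun (\<lambda>v. \<Sum>i\<in>UNIV. c i * \<rho> (iv x) v $ i)"

lemma dual_functional_apply:
  assumes "x \<in> carrier G"
  shows "blinfun_apply (dual_functional x c) v = (\<Sum>i\<in>UNIV. c i * \<rho> (iv x) v $ i)"
proof -
  have "linear (\<lambda>v. \<Sum>i\<in>UNIV. c i * \<rho> (iv x) v $ i)"
    using linear_rho[OF W.inv_closed[OF assms]]
    by (intro linearI) (auto simp: linear_add linear_scale sum.distrib sum_distrib_left algebra_simps)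
  then show ?thesis
    by (simp add: dual_functional_def linear_conv_bounded_linear bounded_linear_Blinfun_apply)
qed

lemma dual_functional_axis: "x \<in> carrier G \<Longrightarrow> blinfun_apply (dual_functional x c) (\<rho> x (\<alpha> i)) = c i"
  by (simp add: dual_functional_apply axis_def if_distrib cong: if_cong)

text \<open>The translate of \<open>Cface I\<close> by \<open>x\<close>, written as conditions on
  \<open>\<rho> x (\<alpha> i)\<close> so that the contragredient action no longer appears.\<close>

definition face :: "'v list set \<Rightarrow> 'v set \<Rightarrow> 'v dual set" where
  "face x I = {\<phi>. (\<forall>i\<in>I. blinfun_apply \<phi> (\<rho> x (\<alpha> i)) = 0) \<and> (\<forall>j\<in>- I. blinfun_apply \<phi> (\<rho> x (\<alpha> j)) > 0)}"

definition cl_face :: "'v list set \<Rightarrow> 'v set \<Rightarrow> 'v dual set" where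
  "cl_face x I = {\<phi>. (\<forall>i\<in>I. blinfun_apply \<phi> (\<rho> x (\<alpha> i)) = 0) \<and> (\<forall>j\<in>- I. blinfun_apply \<phi> (\<rho> x (\<alpha> j)) \<ge> 0)}"

lemma face_zero: "\<phi> \<in> face x I \<Longrightarrow> i \<in> I \<Longrightarrow> blinfun_apply \<phi> (\<rho> x (\<alpha> i)) = 0"
  by (simp add: face_def)

lemma face_pos: "\<phi> \<in> face x I \<Longrightarrow> i \<notin> I \<Longrightarrow> blinfun_apply \<phi> (\<rho> x (\<alpha> i)) > 0"
  by (simp add: face_def)

lemma face_nonneg: "\<phi> \<in> face x I \<Longrightarrow> blinfun_apply \<phi> (\<rho> x (\<alpha> i)) \<ge> 0"
  using face_zero face_pos by (cases "i \<in> I") (simp_all add: less_imp_le)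

lemma faceI:
  "\<lbrakk>\<And>i. i \<in> I \<Longrightarrow> blinfun_apply \<phi> (\<rho> x (\<alpha> i)) = 0; \<And>i. i \<notin> I \<Longrightarrow> blinfun_apply \<phi> (\<rho> x (\<alpha> i)) > 0\<rbrakk> \<Longrightarrow> \<phi> \<in> face x I"
  by (simp add: face_def)

lemma dual_act_image:
  assumes "x \<in> carrier G"
  shows "dual_act m x ` A = {\<phi>. dual_act m (iv x) \<phi> \<in> A}"
proof (intro equalityI subsetI)
  have inv: "dual_act m x (dual_act m (iv x) \<phi>) = \<phi>" "dual_act m (iv x) (dual_act m x \<phi>) = \<phi>" for \<phi>
    using assms by (auto intro!: blinfun_eqI simp: dual_act_apply)
  show "\<phi> \<in> {\<phi>. dual_act m (iv x) \<phi> \<in> A}" if "\<phi> \<in> dual_act m x ` A" for \<phi> using that inv by auto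
  show "\<phi> \<in> dual_act m x ` A" if "\<phi> \<in> {\<phi>. dual_act m (iv x) \<phi> \<in> A}" for \<phi>
    using that inv(1)[of \<phi>] by (metis imageI mem_Collect_eq)
qed

lemma chamber_of_eq: "x \<in> carrier G \<Longrightarrow> chamber_of m (x, I) = face x I"
  by (auto simp: chamber_of_def dual_act_image face_def Cface_def Theta_def dual_act_apply)

lemma closure_face:
  assumes "x \<in> carrier G" shows "closure (face x I) = cl_face x I"
proof (intro equalityI closure_minimal subsetI)
  have "cl_face x I = (\<Inter>i\<in>I. {\<phi>. blinfun_apply \<phi> (\<rho> x (\<alpha> i)) = 0}) \<inter> (\<Inter>i\<in>- I. {\<phi>. blinfun_apply \<phi> (\<rho> x (\<alpha> i)) \<ge> 0})"
    by (auto simp: cl_face_def)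
  also have "closed \<dots>"
    by (intro closed_Int closed_INT ballI closed_Collect_eq closed_Collect_le continuous_intros)
  finally show "closed (cl_face x I)" .
next
  fix \<phi> assume \<phi>: "\<phi> \<in> cl_face x I"
  \<comment> \<open>A point of the face itself: adding small positive multiples of it pushes
    \<open>\<phi>\<close> off the boundary.\<close>
  define \<psi> where "\<psi> = dual_functional x (\<lambda>i. if i \<in> I then 0 else 1)"
  have \<psi>: "blinfun_apply \<psi> (\<rho> x (\<alpha> i)) = (if i \<in> I then 0 else 1)" for i
    using assms by (simp add: \<psi>_def dual_functional_axis)
  have "(\<lambda>n. \<phi> + inverse (real (Suc n)) *\<^sub>R \<psi>) \<longlonglongrightarrow> \<phi> + 0 *\<^sub>R \<psi>"
    by (intro tendsto_intros LIMSEQ_inverse_real_of_nat)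
  moreover have "\<phi> + inverse (real (Suc n)) *\<^sub>R \<psi> \<in> face x I" for n
    using \<phi> by (auto simp: face_def cl_face_def blinfun.add_left blinfun.scaleR_left \<psi> intro!: add_nonneg_pos)
  ultimately show "\<phi> \<in> closure (face x I)"
    unfolding closure_sequential by (intro exI[of _ "\<lambda>n. \<phi> + inverse (real (Suc n)) *\<^sub>R \<psi>"]) auto
qed (auto simp: face_def cl_face_def intro: less_imp_le)

lemma Tits_cone_iff:
  "\<phi> \<in> Tits_cone m \<longleftrightarrow> (\<exists>w\<in>carrier G. \<forall>i. 0 \<le> blinfun_apply \<phi> (\<rho> w (\<alpha> i)))"
proof -
  have "{\<phi>. \<forall>i. blinfun_apply \<phi> (\<alpha> i) > 0} = face \<one>\<^bsub>G\<^esub> {}" by (auto simp: face_def)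
  then have "closure {\<phi>. \<forall>i. blinfun_apply \<phi> (\<alpha> i) > 0} = cl_face \<one>\<^bsub>G\<^esub> {}" by (simp add: closure_face)
  then show ?thesis by (auto simp: Tits_cone_def dual_act_image cl_face_def dual_act_apply)
qed

lemma face_nonempty: "x \<in> carrier G \<Longrightarrow> face x I \<noteq> {}"
proof -
  assume "x \<in> carrier G"
  then have "dual_functional x (\<lambda>i. if i \<in> I then 0 else 1) \<in> face x I"
    by (simp add: face_def dual_functional_axis)
  then show ?thesis by blast
qed

lemma convex_face: "convex (face x I)"
  unfolding convex_def
proof (intro ballI allI impI)
  fix \<phi> \<psi> and u v :: real
  assume *: "\<phi> \<in> face x I" "\<psi> \<in> face x I" "0 \<le> u" "0 \<le> v" "u + v = 1"
  then have "0 < u \<or> 0 < v" by linarith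
  then show "u *\<^sub>R \<phi> + v *\<^sub>R \<psi> \<in> face x I"
  proof
    assume u: "0 < u"
    show ?thesis
    proof (rule faceI)
      fix i assume "i \<notin> I"
      then have "0 < u * blinfun_apply \<phi> (\<rho> x (\<alpha> i))" "0 \<le> v * blinfun_apply \<psi> (\<rho> x (\<alpha> i))"
        using face_pos[OF *(1)] face_nonneg[OF *(2)] u *(4) by auto
      then show "0 < blinfun_apply (u *\<^sub>R \<phi> + v *\<^sub>R \<psi>) (\<rho> x (\<alpha> i))"
        by (simp add: blinfun.add_left blinfun.scaleR_left)
    qed (simp add: face_zero[OF *(1)] face_zero[OF *(2)] blinfun.add_left blinfun.scaleR_left)
  next
    assume v: "0 < v"
    show ?thesis
    proof (rule faceI)
      fix i assume "i \<notin> I"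
      then have "0 \<le> u * blinfun_apply \<phi> (\<rho> x (\<alpha> i))" "0 < v * blinfun_apply \<psi> (\<rho> x (\<alpha> i))"
        using face_nonneg[OF *(1)] face_pos[OF *(2)] v *(3) by auto
      then show "0 < blinfun_apply (u *\<^sub>R \<phi> + v *\<^sub>R \<psi>) (\<rho> x (\<alpha> i))"
        by (simp add: blinfun.add_left blinfun.scaleR_left)
    qed (simp add: face_zero[OF *(1)] face_zero[OF *(2)] blinfun.add_left blinfun.scaleR_left)
  qed
qed

text \<open>The Tits argument: a functional in both faces vanishes on every left descent of \<open>w\<close>.\<close>

lemma fundamental_domain:
  "\<lbrakk>w \<in> carrier G; \<psi> \<in> face \<one>\<^bsub>G\<^esub> I; \<psi> \<in> face w K\<rbrakk> \<Longrightarrow> I = K \<and> w \<in> par I"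
proof (induction "len w" arbitrary: w rule: less_induct)
  case less
  note w = less.prems(1)
  show ?case
  proof (cases "w = \<one>\<^bsub>G\<^esub>")
    case True
    have "i \<in> I \<longleftrightarrow> i \<in> K" for i
      using face_zero[OF less.prems(2), of i] face_zero[OF less.prems(3), of i]
        face_pos[OF less.prems(2), of i] face_pos[OF less.prems(3), of i]
      unfolding True by (metis less_irrefl)
    then have "I = K" by blast
    with True show ?thesis by simp
  next
    case False
    then have "iv w \<noteq> \<one>\<^bsub>G\<^esub>" using w by (metis W.inv_inv W.inv_one)
    then obtain i where i: "len (iv w \<cdot> sg i) < len (iv w)" using right_descent[OF W.inv_closed[OF w]] by blast
    have inv: "iv (iv w \<cdot> sg i) = sg i \<cdot> w" using w by (simp add: W.inv_mult_group)
    have shorter: "len (sg i \<cdot> w) < len w"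
      using i w len_inv[of "iv w \<cdot> sg i"] unfolding inv by simp
    have neg: "\<rho> (iv w) (\<alpha> i) \<le> 0" using rho_nonpos_if_descent[OF _ i] w by simp
    have nonneg: "blinfun_apply \<psi> (\<rho> w (\<alpha> k)) \<ge> 0" for k
      using less.prems(3) by (rule face_nonneg)
    have "blinfun_apply \<psi> (\<alpha> i) = blinfun_apply \<psi> (\<rho> w (\<rho> (iv w) (\<alpha> i)))" using w by simp
    also have "\<dots> = (\<Sum>k\<in>UNIV. \<rho> (iv w) (\<alpha> i) $ k * blinfun_apply \<psi> (\<rho> w (\<alpha> k)))"
      by (rule functional_expansion_UNIV[OF w])
    also have "\<dots> \<le> 0"
      using neg nonneg by (intro sum_nonpos mult_nonpos_nonneg) (auto simp: less_eq_vec_def)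
    finally have "\<not> blinfun_apply \<psi> (\<alpha> i) > 0" by simp
    then have iI: "i \<in> I" and z: "blinfun_apply \<psi> (\<alpha> i) = 0" using face_zero[OF less.prems(2), of i] face_pos[OF less.prems(2), of i] by auto
    \<comment> \<open>Since the reflection leaves \<psi> invariant, \<psi> also lies in the face of
      the shorter element \<open>sg i \<cdot> w\<close>, where induction applies.\<close>
    have "blinfun_apply \<psi> (simple_refl m i v) = blinfun_apply \<psi> v" for v
      by (simp add: simple_refl_def blinfun.diff_right blinfun.scaleR_right z)
    then have "\<psi> \<in> face (sg i \<cdot> w) K"
      using less.prems(3) w by (simp add: face_def rho_mult rho_sg)
    then have IH: "I = K \<and> sg i \<cdot> w \<in> par I"
      by (intro less.hyps[OF shorter]) (use less.prems(2) w in auto)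
    have "w = sg i \<cdot> (sg i \<cdot> w)" using w by (simp add: W.m_assoc[symmetric])
    then show ?thesis using IH iI by (metis par_mult par_sg)
  qed
qed

lemma face_overlap:
  assumes x: "x \<in> carrier G" and y: "y \<in> carrier G" and \<phi>: "\<phi> \<in> face x I" "\<phi> \<in> face y K"
  shows "I = K" "iv x \<cdot> y \<in> par I"
proof -
  have "dual_act m (iv x) \<phi> \<in> face \<one>\<^bsub>G\<^esub> I" "dual_act m (iv x) \<phi> \<in> face (iv x \<cdot> y) K"
    using assms by (simp_all add: face_def dual_act_apply rho_mult)
  then have "I = K \<and> iv x \<cdot> y \<in> par I" by (intro fundamental_domain) (use x y in auto)
  then show "I = K" "iv x \<cdot> y \<in> par I" by blast+
qed

lemma matches_nonneg: "matches x I J \<Longrightarrow> i \<in> I \<Longrightarrow> 0 \<le> \<rho> x (\<alpha> i)"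
  using axis_nonneg by (metis matchesE)

text \<open>Overlapping faces come from the same coset modulo \<open>par I\<close>, and both
  elements are the representative of that coset which is positive on \<open>I\<close>.\<close>

lemma matches_face_unique:
  assumes x: "matches x I J" and y: "matches y K J" and \<phi>: "\<phi> \<in> face x I" "\<phi> \<in> face y K"
  shows "x = y" "I = K"
proof -
  have xc: "x \<in> carrier G" and yc: "y \<in> carrier G" using x y matches_carrier by blast+
  note o = face_overlap[OF xc yc \<phi>]
  have e: "x \<cdot> (iv x \<cdot> y) = y" using xc yc by (simp add: W.m_assoc[symmetric])
  have "iv x \<cdot> y = \<one>\<^bsub>G\<^esub>"
    using matches_nonneg[OF x] matches_nonneg[OF y] o
    by (intro coset_rep_unique[OF xc o(2)]) (auto simp: e)
  then show "x = y" "I = K" using e xc o by auto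
qed

lemma face_par:
  assumes x: "x \<in> carrier G" and t: "t \<in> par I" and \<phi>: "\<phi> \<in> face x I"
  shows "blinfun_apply \<phi> (\<rho> (x \<cdot> t) v) = blinfun_apply \<phi> (\<rho> x v)"
proof -
  have "blinfun_apply \<phi> (\<rho> x (\<rho> t v - v)) = 0"
    unfolding functional_expansion[OF x par_moves[OF t]]
    using \<phi> by (intro sum.neutral) (simp add: face_def)
  then show ?thesis
    using x t by (simp add: rho_mult par_carrier linear_diff[OF linear_rho] blinfun.diff_right)
qed

text \<open>The coordinates of a root have one sign and \<phi> is nonnegative on the basis, so a
  vanishing sum has only zero terms; outside \<open>I\<close> the values of \<phi> are strictly
  positive, which leaves no coordinate there.\<close>

lemma root_vanishing_on_face:
  assumes x: "x \<in> carrier G" and w: "w \<in> carrier G" and \<phi>: "\<phi> \<in> face x I"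
    and z: "blinfun_apply \<phi> (\<rho> x (\<rho> w (\<alpha> k))) = 0"
  shows "\<rho> w (\<alpha> k) \<in> coord_space I"
proof -
  let ?g = "\<rho> w (\<alpha> k)"
  define f where "f i = ?g $ i * blinfun_apply \<phi> (\<rho> x (\<alpha> i))" for i
  have nn: "blinfun_apply \<phi> (\<rho> x (\<alpha> i)) \<ge> 0" for i
    using \<phi> by (rule face_nonneg)
  have s: "(\<Sum>i\<in>UNIV. f i) = 0" 
    unfolding f_def by (subst functional_expansion_UNIV[OF x, symmetric]) (rule z)
  have "f i = 0" for i
    using root_sign[OF w, of k]
  proof
    assume "0 \<le> ?g"
    then have "\<forall>i. 0 \<le> f i" using nn by (auto simp: f_def less_eq_vec_def)
    then show ?thesis using s by (subst (asm) sum_nonneg_eq_0_iff) auto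
  next
    assume "?g \<le> 0"
    then have "\<forall>i. 0 \<le> - f i" using nn by (auto simp: f_def less_eq_vec_def mult_nonpos_nonneg)
    moreover have "(\<Sum>i\<in>UNIV. - f i) = 0" using s by (simp add: sum_negf)
    ultimately have "- f i = 0" by (subst (asm) sum_nonneg_eq_0_iff) auto
    then show ?thesis by simp
  qed
  then have "?g $ i = 0" if "i \<notin> I" for i
    using face_pos[OF \<phi> that] \<open>\<And>i. f i = 0\<close>[of i] by (simp add: f_def)
  then show ?thesis by (simp add: coord_space_def)
qed

lemma Theta_matches:
  assumes "matches x I J"
  shows "Theta J = {\<phi>. \<forall>i\<in>I. blinfun_apply \<phi> (\<rho> x (\<alpha> i)) = 0}"
proof -
  have "Theta J = {\<phi>. \<forall>v\<in>\<alpha> ` J. blinfun_apply \<phi> v = 0}" by (auto simp: Theta_def)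
  also have "\<alpha> ` J = \<rho> x ` \<alpha> ` I" using assms by (simp add: matches_def)
  finally show ?thesis by auto
qed

lemma openin_face:
  assumes "matches x I J"
  shows "openin (top_of_set (Theta J)) (face x I)"
proof -
  have "face x I = Theta J \<inter> (\<Inter>j\<in>- I. {\<phi>. 0 < blinfun_apply \<phi> (\<rho> x (\<alpha> j))})"
    unfolding Theta_matches[OF assms] face_def by auto
  moreover have "open {\<phi> :: 'v dual. 0 < blinfun_apply \<phi> v}" for v :: "real ^ 'v"
    by (intro open_Collect_less continuous_intros)
  then have "open (\<Inter>j\<in>- I. {\<phi> :: 'v dual. 0 < blinfun_apply \<phi> (\<rho> x (\<alpha> j))})"
    by (intro open_INT) auto
  ultimately show ?thesis by (simp add: openin_open_Int)
qed

section \<open>The chambers of the arrangement\<close>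

lemma roots_eq: "roots m = {\<rho> w (\<alpha> i) | w i. w \<in> carrier G}"
  by (simp add: roots_def)

lemma chamber_complement:
  "cone_interior m J - \<Union>(arrangement m J) = (\<Union>(x, I)\<in>Cham m J. face x I)" (is "?L = ?R")
proof (intro equalityI subsetI)
  fix \<phi> assume \<phi>: "\<phi> \<in> ?R"
  then obtain x I where x: "matches x I J" "\<phi> \<in> face x I" by (auto simp: Cham_eq)
  have xc: "x \<in> carrier G" using matches_carrier[OF x(1)] .
  have "face x I \<subseteq> Tits_cone m"
    unfolding Tits_cone_iff subset_iff using xc face_nonneg by blast
  moreover have "face x I \<subseteq> Theta J" using Theta_matches[OF x(1)] by (auto simp: face_def)
  \<comment> \<open>The face is an open subset of \<open>Theta J\<close> contained in the cone,
    hence lies in the interior.\<close>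
  ultimately have "\<phi> \<in> cone_interior m J"
    unfolding cone_interior_def using interior_of_maximal[OF _ openin_face[OF x(1)]] x(2) by blast
  moreover have "\<phi> \<notin> H" if H: "H \<in> arrangement m J" for H
  proof
    assume "\<phi> \<in> H"
    then obtain \<beta> where \<beta>: "\<beta> \<in> roots m" "\<not> Theta J \<subseteq> hyp \<beta>" "blinfun_apply \<phi> \<beta> = 0"
      using H by (auto simp: arrangement_def hyp_def)
    then obtain w k where w: "w \<in> carrier G" "\<beta> = \<rho> w (\<alpha> k)" by (auto simp: roots_eq)
    have e: "\<rho> x (\<rho> (iv x \<cdot> w) (\<alpha> k)) = \<beta>" using xc w by (simp add: rho_mult)
    \<comment> \<open>After translation by \<open>iv x\<close>, a root that vanishes at one point of
      the face is supported on \<open>I\<close>, and therefore vanishes on all of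
      \<open>Theta J\<close>.\<close>
    have c: "\<rho> (iv x \<cdot> w) (\<alpha> k) \<in> coord_space I"
      using root_vanishing_on_face[OF xc _ x(2), of "iv x \<cdot> w" k] xc w \<beta>(3) e by simp
    have "Theta J \<subseteq> hyp \<beta>"
      unfolding Theta_matches[OF x(1)] hyp_def
      using functional_expansion[OF xc c] unfolding e by auto
    with \<beta> show False by simp
  qed
  ultimately show "\<phi> \<in> ?L" by blast
next
  fix \<phi> assume \<phi>: "\<phi> \<in> ?L"
  then have \<phi>T: "\<phi> \<in> Tits_cone m" "\<phi> \<in> Theta J"
    unfolding cone_interior_def using interior_of_subset[of "top_of_set (Theta J)" "Tits_cone m \<inter> Theta J"] by blast+
  then obtain w where w: "w \<in> carrier G" "\<And>i. 0 \<le> blinfun_apply \<phi> (\<rho> w (\<alpha> i))" by (auto simp: Tits_cone_iff)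
  define I where "I = {i. blinfun_apply \<phi> (\<rho> w (\<alpha> i)) = 0}"
  have \<phi>f: "\<phi> \<in> face w I" using w(2) by (auto simp: face_def I_def less_le)
  \<comment> \<open>As \<phi> lies on no hyperplane of the arrangement, a root vanishing at \<phi>
    vanishes on \<open>Theta J\<close>; testing it on the coordinate functionals outside
    \<open>J\<close> puts it into \<open>coord_space J\<close>.\<close>
  have V1: "\<rho> w (\<alpha> i) \<in> coord_space J" if "i \<in> I" for i
  proof -
    have "\<phi> \<in> hyp (\<rho> w (\<alpha> i)) \<inter> Theta J" using that \<phi>T by (simp add: I_def hyp_def)
    moreover have "\<phi> \<notin> \<Union>(arrangement m J)" using \<phi> by blast
    ultimately have "hyp (\<rho> w (\<alpha> i)) \<inter> Theta J \<notin> arrangement m J" by blast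
    then have sub: "Theta J \<subseteq> hyp (\<rho> w (\<alpha> i))" using w(1) by (auto simp: arrangement_def roots_eq)
    have "\<rho> w (\<alpha> i) $ k = 0" if "k \<notin> J" for k
    proof -
      let ?e = "dual_functional \<one>\<^bsub>G\<^esub> (\<lambda>l. if l = k then 1 else 0)"
      have "?e \<in> Theta J" using that dual_functional_axis[of "\<one>\<^bsub>G\<^esub>" "\<lambda>l. if l = k then 1 else 0"] by (auto simp: Theta_def)
      then have "blinfun_apply ?e (\<rho> w (\<alpha> i)) = 0" using sub by (auto simp: hyp_def)
      then show ?thesis by (simp add: dual_functional_apply if_distrib[of "\<lambda>c. c * _"] cong: if_cong)
    qed
    then show ?thesis by (simp add: coord_space_def)
  qed
  have V2: "\<rho> (iv w) (\<alpha> j) \<in> coord_space I" if "j \<in> J" for j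
    using \<phi>T that w(1) by (intro root_vanishing_on_face[OF w(1) _ \<phi>f]) (auto simp: Theta_def)
  obtain u t where u: "matches u I J" "t \<in> par I" "w = u \<cdot> t"
    using matches_coset_rep[OF w(1) V1 V2] by blast
  have "w \<cdot> iv t = u" using u matches_carrier[OF u(1)] by (simp add: W.m_assoc par_carrier)
  then have "blinfun_apply \<phi> (\<rho> u v) = blinfun_apply \<phi> (\<rho> w v)" for v
    using face_par[OF w(1) par_inv[OF u(2)] \<phi>f] by simp
  then have "\<phi> \<in> face u I" using \<phi>f by (simp add: face_def)
  with u show "\<phi> \<in> ?R" by (auto simp: Cham_eq)
qed

lemma chambers_eq: "chambers m J = (\<lambda>(x, I). face x I) ` Cham m J"
  unfolding chambers_def
proof (rule components_eq_partition)
  let ?S = "cone_interior m J - \<Union>(arrangement m J)"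
  show "\<Union> ((\<lambda>(x, I). face x I) ` Cham m J) = ?S" by (simp add: chamber_complement)
  fix A assume "A \<in> (\<lambda>(x, I). face x I) ` Cham m J"
  then obtain x I where A: "A = face x I" "matches x I J" "(x, I) \<in> Cham m J" by (auto simp: Cham_eq)
  show "A \<noteq> {}" unfolding A using face_nonempty matches_carrier[OF A(2)] by blast
  show "connected A" unfolding A by (intro convex_connected convex_face)
  have sub: "A \<subseteq> ?S" unfolding chamber_complement using A by auto
  have "?S \<subseteq> Theta J" unfolding cone_interior_def using interior_of_subset[of "top_of_set (Theta J)" "Tits_cone m \<inter> Theta J"] by blast
  then show "openin (top_of_set ?S) A" using openin_face[OF A(2)] sub unfolding A(1) by (meson openin_subset_trans)
  fix B assume "B \<in> (\<lambda>(x, I). face x I) ` Cham m J" "A \<noteq> B"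
  then obtain y K where B: "B = face y K" "matches y K J" by (auto simp: Cham_eq)
  show "A \<inter> B = {}" using matches_face_unique[OF A(2) B(2)] \<open>A \<noteq> B\<close> unfolding A B by auto
qed

lemma bij_betw_chambers: "bij_betw (chamber_of m) (Cham m J) (chambers m J)"
proof -
  have eq: "chamber_of m P = (\<lambda>(x, I). face x I) P" if "P \<in> Cham m J" for P
    using that by (auto simp: Cham_eq matches_def chamber_of_eq)
  have "inj_on (\<lambda>(x, I). face x I) (Cham m J)"
  proof (rule inj_onI)
    fix P Q assume P: "P \<in> Cham m J" and Q: "Q \<in> Cham m J" and e: "(\<lambda>(x, I). face x I) P = (\<lambda>(x, I). face x I) Q"
    obtain x I y K where PQ: "P = (x, I)" "Q = (y, K)" by (metis surj_pair)
    have x: "matches x I J" and y: "matches y K J" using P Q by (auto simp: PQ Cham_eq)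
    obtain \<phi> where "\<phi> \<in> face x I" using face_nonempty[OF matches_carrier[OF x]] by blast
    then show "P = Q" using matches_face_unique[OF x y, of \<phi>] e by (simp add: PQ)
  qed
  then have "bij_betw (\<lambda>(x, I). face x I) (Cham m J) (chambers m J)"
    by (simp add: bij_betw_def chambers_eq)
  then show ?thesis using bij_betw_cong[of "Cham m J" "chamber_of m"] eq by blast
qed

subsection \<open>Walls\<close>

text \<open>Since \<open>dim\<close> is the dimension of the span, \<open>S\<close> may be a cone as
  well as a subspace: it contains the dual basis vectors indexed by \<open>L\<close> and lies in
  their span.\<close>

lemma dim_dual:
  assumes x: "x \<in> carrier G"
    and sub: "S \<subseteq> {\<phi>. \<forall>i\<in>- L. blinfun_apply \<phi> (\<rho> x (\<alpha> i)) = 0}"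
    and D: "\<And>j. j \<in> L \<Longrightarrow> dual_functional x (\<lambda>l. if l = j then 1 else 0) \<in> S"
  shows "dim S = card L"
proof -
  define d where "d j = dual_functional x (\<lambda>l. if l = j then 1 else 0)" for j
  have d: "blinfun_apply (d j) (\<rho> x (\<alpha> i)) = (if i = j then 1 else 0)" for i j
    using x by (simp add: d_def dual_functional_axis)
  have inj: "inj_on d L"
  proof (rule inj_onI)
    fix i j assume "d i = d j"
    then have "blinfun_apply (d i) (\<rho> x (\<alpha> i)) = blinfun_apply (d j) (\<rho> x (\<alpha> i))" by simp
    then show "i = j" unfolding d by (simp split: if_splits)
  qed
  have span: "S \<subseteq> span (d ` L)"
  proof
    fix \<phi> assume "\<phi> \<in> S"
    then have z: "blinfun_apply \<phi> (\<rho> x (\<alpha> i)) = 0" if "i \<notin> L" for i using sub that by auto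
    have "\<phi> = (\<Sum>j\<in>L. blinfun_apply \<phi> (\<rho> x (\<alpha> j)) *\<^sub>R d j)" (is "_ = ?\<psi>")
    proof (rule blinfun_eqI)
      fix v
      have "blinfun_apply ?\<psi> (\<rho> x (\<alpha> i)) = blinfun_apply \<phi> (\<rho> x (\<alpha> i))" for i
        using z by (simp add: blinfun.sum_left blinfun.scaleR_left d if_distrib cong: if_cong)
      then have "blinfun_apply ?\<psi> (\<rho> x u) = blinfun_apply \<phi> (\<rho> x u)" for u
        by (subst (1 2) functional_expansion_UNIV[OF x]) simp
      from this[of "\<rho> (iv x) v"] show "blinfun_apply \<phi> v = blinfun_apply ?\<psi> v" using x by simp
    qed
    also have "\<dots> \<in> span (d ` L)" by (intro span_sum span_scale span_base) auto
    finally show "\<phi> \<in> span (d ` L)" .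
  qed
  have "independent (d ` L)"
  proof (rule independent_if_scalars_zero)
    fix f and y
    assume s: "(\<Sum>y\<in>d ` L. f y *\<^sub>R y) = 0" and "y \<in> d ` L"
    then obtain j where j: "j \<in> L" "y = d j" by blast
    have "0 = blinfun_apply (\<Sum>y\<in>d ` L. f y *\<^sub>R y) (\<rho> x (\<alpha> j))" using s by simp
    also have "\<dots> = (\<Sum>i\<in>L. f (d i) * blinfun_apply (d i) (\<rho> x (\<alpha> j)))"
      by (simp add: sum.reindex[OF inj] blinfun.sum_left blinfun.scaleR_left)
    also have "\<dots> = f (d j)" using j by (simp add: d if_distrib cong: if_cong)
    finally show "f y = 0" using j by simp
  qed simp
  then show ?thesis
    using D span inj by (intro dim_unique[of "d ` L"]) (auto simp: card_image d_def[symmetric])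
qed

lemma dim_Theta: "dim (Theta (J :: 'v set)) = card (- J)"
  by (rule dim_dual[of "\<one>\<^bsub>G\<^esub>"]) (use dual_functional_axis[of "\<one>\<^bsub>G\<^esub>"] in \<open>auto simp: Theta_def\<close>)

lemma dim_cl_face: "x \<in> carrier G \<Longrightarrow> dim (cl_face x I) = card (- I)"
  by (rule dim_dual) (auto simp: cl_face_def dual_functional_axis)

lemma cl_face_is_wall:
  assumes x: "matches x I J" and a: "a \<notin> I"
  shows "cl_face x (insert a I) \<in> walls m J (face x I)"
proof -
  have xc: "x \<in> carrier G" using matches_carrier[OF x] .
  let ?H = "hyp (\<rho> x (\<alpha> a)) \<inter> Theta J"
  have eq: "cl_face x (insert a I) = closure (face x I) \<inter> ?H"
    unfolding closure_face[OF xc] Theta_matches[OF x] by (auto simp: cl_face_def hyp_def)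
  have "dual_functional x (\<lambda>l. if l = a then 1 else 0) \<in> Theta J - hyp (\<rho> x (\<alpha> a))"
    using a xc unfolding Theta_matches[OF x] by (auto simp: dual_functional_axis hyp_def)
  then have "\<not> Theta J \<subseteq> hyp (\<rho> x (\<alpha> a))" by blast
  then have H: "?H \<in> arrangement m J" using xc by (auto simp: arrangement_def roots_eq)
  have "card (- I) = card (- J)" using matches_card[OF x] by (simp add: Compl_eq_Diff_UNIV card_Diff_subset)
  moreover have "- I = insert a (- insert a I)" using a by auto
  then have "card (- I) = card (- insert a I) + 1" by (metis Compl_iff Suc_eq_plus1 card_insert_disjoint finite insertI1)
  ultimately have "dim (closure (face x I) \<inter> ?H) + 1 = dim (Theta J)"
    using dim_cl_face[OF xc, of "insert a I"] by (simp add: eq[symmetric] dim_Theta)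
  with H show ?thesis unfolding eq walls_def by blast
qed

lemma cl_face_par:
  assumes x: "x \<in> carrier G" and t: "t \<in> par I"
  shows "cl_face (x \<cdot> t) I = cl_face x I"
proof -
  have sub: "cl_face x I \<subseteq> cl_face (x \<cdot> t) I" if x: "x \<in> carrier G" and t: "t \<in> par I" for x t
  proof
    fix \<phi> assume \<phi>: "\<phi> \<in> cl_face x I"
    have "blinfun_apply \<phi> (\<rho> (x \<cdot> t) v) = blinfun_apply \<phi> (\<rho> x v)" for v
    proof -
      have "blinfun_apply \<phi> (\<rho> x (\<rho> t v - v)) = 0"
        unfolding functional_expansion[OF x par_moves[OF t]]
        using \<phi> by (intro sum.neutral) (simp add: cl_face_def)
      then show ?thesis
        using x t by (simp add: rho_mult par_carrier linear_diff[OF linear_rho] blinfun.diff_right)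
    qed
    with \<phi> show "\<phi> \<in> cl_face (x \<cdot> t) I" by (simp add: cl_face_def)
  qed
  have "x \<cdot> t \<cdot> iv t = x" using x t by (simp add: W.m_assoc par_carrier)
  then show ?thesis using sub[OF x t] sub[of "x \<cdot> t" "iv t"] x t by (auto simp: par_carrier)
qed

text \<open>The closed face belonging to \<open>insert a I\<close> is a wall of the first chamber,
  and the one belonging to \<open>insert b K\<close> a wall of the second. They coincide because a
  closed face depends only on the coset modulo the parabolic subgroup of its index set.\<close>

lemma adjacentI:
  assumes x: "matches x I J" and y: "matches y K J" and ne: "(x, I) \<noteq> (y, K)"
    and a: "a \<notin> I" and b: "b \<notin> K" and eq: "insert a I = insert b K" and t: "iv x \<cdot> y \<in> par (insert a I)"
  shows "adjacent m J (chamber_of m (x, I)) (chamber_of m (y, K))"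
proof -
  have c: "x \<in> carrier G" "y \<in> carrier G" using x y matches_carrier by blast+
  have P: "(x, I) \<in> Cham m J" "(y, K) \<in> Cham m J" using x y by (auto simp: Cham_eq)
  have "x \<cdot> (iv x \<cdot> y) = y" using c by (simp add: W.m_assoc[symmetric])
  then have "cl_face y (insert b K) = cl_face x (insert a I)"
    using cl_face_par[OF c(1) t] eq by simp
  then have "walls m J (face x I) \<inter> walls m J (face y K) \<noteq> {}"
    using cl_face_is_wall[OF x a] cl_face_is_wall[OF y b] by auto
  moreover have "chamber_of m (x, I) \<noteq> chamber_of m (y, K)"
    using bij_betw_chambers[of J] P ne by (auto simp: bij_betw_def inj_on_def)
  moreover have "chamber_of m (x, I) \<in> chambers m J" "chamber_of m (y, K) \<in> chambers m J"
    using bij_betwE[OF bij_betw_chambers] P by blast+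
  ultimately show ?thesis using c by (simp add: adjacent_def chamber_of_eq)
qed

section \<open>Longest elements and wall crossings\<close>

lemma longest_max:
  assumes "finite (par L)"
  shows "longest m L \<in> par L" "w \<in> par L \<Longrightarrow> len w \<le> len (longest m L)"
proof -
  have "\<forall>w. w \<in> par L \<longrightarrow> len w < Suc (Max (len ` par L))"
    using assms by (auto simp: less_Suc_eq_le)
  from arg_max_nat_lemma[of "\<lambda>w. w \<in> par L", OF par_one this]
  show "longest m L \<in> par L" "w \<in> par L \<Longrightarrow> len w \<le> len (longest m L)"
    by (simp_all add: longest_def)
qed

lemma longest_negates:
  assumes "finite (par L)" "i \<in> L"
  shows "\<rho> (longest m L) (\<alpha> i) \<le> 0" "\<rho> (iv (longest m L)) (\<alpha> i) \<le> 0"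
proof -
  let ?w = "longest m L"
  note w = longest_max[OF assms(1)]
  have c: "?w \<in> carrier G" using w(1) by blast
  have "len (?w \<cdot> sg i) \<le> len ?w" using w assms(2) by (intro w(2)) blast
  then have "len (?w \<cdot> sg i) < len ?w" using len_mult_sg[OF c, of i] by linarith
  then show "\<rho> ?w (\<alpha> i) \<le> 0" using c by (simp add: descent_iff)
  have "iv (iv ?w \<cdot> sg i) = sg i \<cdot> ?w" using c by (simp add: W.inv_mult_group)
  then have "len (iv ?w \<cdot> sg i) = len (sg i \<cdot> ?w)" using c by (metis W.inv_closed W.m_closed len_inv sg_carrier)
  also have "\<dots> \<le> len (iv ?w)" using w assms(2) c by (simp add: par_mult par_sg)
  finally have "len (iv ?w \<cdot> sg i) < len (iv ?w)" using len_mult_sg[of "iv ?w" i] c by simp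
  then show "\<rho> (iv ?w) (\<alpha> i) \<le> 0" using rho_nonpos_if_descent[of "iv ?w" i] c by simp
qed

lemma opposition:
  assumes fin: "finite (par L)" and i: "i \<in> L"
  shows "opposition m L i \<in> L" "\<rho> (longest m L) (\<alpha> i) = - \<alpha> (opposition m L i)"
proof -
  let ?w = "longest m L"
  have w: "?w \<in> par L" "?w \<in> carrier G" using longest_max[OF fin] by blast+
  \<comment> \<open>The sign makes the inverse of the longest element positive on \<open>L\<close>.
    For its sake \<open>simple_root_indecomposable\<close> is stated for linear maps and not only
    for group elements.\<close>
  define f where "f v = - \<rho> (iv ?w) v" for v
  have "- \<rho> ?w (\<alpha> i) \<in> \<alpha> ` L"
  proof (rule simple_root_indecomposable[of f])
    show "linear f" unfolding f_def using w by (intro linear_compose_neg linear_rho) simp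
    show "inj f" using inj_rho[of "iv ?w"] w by (auto simp: f_def inj_def)
    show "cox_form m (f u) (f v) = cox_form m u v" for u v
      using w by (simp add: f_def cox_form_simps rho_preserves)
    show "0 \<le> f (\<alpha> j)" if "j \<in> L" for j using longest_negates[OF fin that] by (simp add: f_def)
    show "- \<rho> ?w (\<alpha> i) \<in> coord_space L"
      using par_preserves[OF w(1) order_refl, of "\<alpha> i"] i by (intro subspace_neg subspace_coord_space) auto
    show "0 \<le> - \<rho> ?w (\<alpha> i)" using longest_negates[OF fin i] by simp
    show "f (- \<rho> ?w (\<alpha> i)) = \<alpha> i" using w by (simp add: f_def rho_minus)
  qed
  then obtain j where j: "j \<in> L" "- \<rho> ?w (\<alpha> i) = \<alpha> j" by blast
  have e: "\<rho> ?w (\<alpha> i) = - \<alpha> j" unfolding j(2)[symmetric] by simp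
  then have "opposition m L i = j"
    unfolding opposition_def e using j(1) by (intro the_equality) (simp_all add: axis_eq_axis)
  with j e show "opposition m L i \<in> L" "\<rho> ?w (\<alpha> i) = - \<alpha> (opposition m L i)" by simp_all
qed

text \<open>The square of the longest element lies in \<open>par L\<close> and sends simple roots of
  \<open>L\<close> to simple roots, hence is trivial.\<close>

lemma opposition_opposition:
  assumes fin: "finite (par L)" and i: "i \<in> L"
  shows "opposition m L (opposition m L i) = i"
proof -
  let ?w = "longest m L"
  have w: "?w \<in> par L" "?w \<in> carrier G" using longest_max[OF fin] by blast+
  have *: "\<rho> (?w \<cdot> ?w) (\<alpha> j) = \<alpha> (opposition m L (opposition m L j))" if "j \<in> L" for j
    using opposition[OF fin that] opposition[OF fin opposition(1)[OF fin that]] w by (simp add: rho_mult rho_minus)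
  have "?w \<cdot> ?w = \<one>\<^bsub>G\<^esub>"
    using w * by (intro par_eq_one[of _ L]) (auto simp: axis_nonneg)
  then show ?thesis using *[OF i] by (simp add: axis_eq_axis)
qed

section \<open>Connected components of the diagram\<close>

lemma cox_form_nonadjacent:
  assumes "i \<noteq> j" "\<not> m i j \<ge> 3" shows "cox_form m (\<alpha> i) (\<alpha> j) = 0"
proof -
  have "m i j = enat 2"
    using m_offdiag[OF assms(1)] assms(2) by (cases "m i j") (auto simp: numeral_eq_enat)
  then show ?thesis by (simp add: cox_form_axis)
qed

lemma cox_form_adjacent:
  assumes "m i j \<ge> 3" shows "cox_form m (\<alpha> i) (\<alpha> j) \<noteq> 0"
proof (cases "m i j")
  case (enat k)
  then have "k \<ge> 3" using assms by (simp add: numeral_eq_enat)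
  then have "pi / real k < pi / 2" by (intro divide_strict_left_mono) auto
  moreover have "0 < pi / real k" using \<open>k \<ge> 3\<close> by simp
  ultimately have "cos (pi / real k) > 0" by (intro cos_gt_zero)
  then show ?thesis using enat by (simp add: cox_form_axis)
qed (simp add: cox_form_axis)

context
  fixes a I L
  defines "L \<equiv> component_of_vertex m I a"
begin

lemma component_base: "a \<in> L"
  by (simp add: L_def component_of_vertex_def)

lemma component_subset: "L \<subseteq> insert a I"
proof
  fix b assume "b \<in> L"
  then have "(a, b) \<in> {(i, j). i \<in> insert a I \<and> j \<in> insert a I \<and> m i j \<ge> 3}\<^sup>*"
    by (simp add: L_def component_of_vertex_def)
  then show "b \<in> insert a I" by (induction rule: rtrancl_induct) auto
qed

lemma component_closed:
  assumes "l \<in> L" "i \<in> insert a I" "m l i \<ge> 3" shows "i \<in> L"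
proof -
  have "(a, l) \<in> {(i, j). i \<in> insert a I \<and> j \<in> insert a I \<and> m i j \<ge> 3}\<^sup>*"
    using assms(1) by (simp add: L_def component_of_vertex_def)
  moreover have "(l, i) \<in> {(i, j). i \<in> insert a I \<and> j \<in> insert a I \<and> m i j \<ge> 3}"
    using assms component_subset by auto
  ultimately have "(a, i) \<in> {(i, j). i \<in> insert a I \<and> j \<in> insert a I \<and> m i j \<ge> 3}\<^sup>*"
    by (rule rtrancl_into_rtrancl)
  then show ?thesis by (simp add: L_def component_of_vertex_def)
qed

lemma component_induct [consumes 1, case_names base step]:
  assumes "l \<in> L" "P a" "\<And>i j. \<lbrakk>i \<in> L; j \<in> L; m i j \<ge> 3; P i\<rbrakk> \<Longrightarrow> P j"
  shows "P l"
proof -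
  have "(a, l) \<in> {(i, j). i \<in> insert a I \<and> j \<in> insert a I \<and> m i j \<ge> 3}\<^sup>*"
    using assms(1) by (simp add: L_def component_of_vertex_def)
  then have "l \<in> L \<and> P l"
  proof (induction rule: rtrancl_induct)
    case base
    then show ?case using component_base assms(2) by simp
  next
    case (step i j)
    then have ij: "i \<in> L" "P i" "j \<in> insert a I" "m i j \<ge> 3" by simp_all
    then have "j \<in> L" using component_closed by blast
    with ij show ?case using assms(3) by blast
  qed
  then show ?thesis ..
qed

text \<open>The vertices of \<open>insert a I\<close> outside the component are orthogonal to all of
  its simple roots.\<close>

lemma component_fixes:
  assumes w: "w \<in> par L" and k: "k \<in> insert a I" "k \<notin> L"
  shows "\<rho> w (\<alpha> k) = \<alpha> k"
  using w
proof (induction rule: par_induct)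
  case (gen w l)
  have "l \<noteq> k" "\<not> m l k \<ge> 3" using \<open>l \<in> L\<close> k component_closed[of l k] by auto
  then have "simple_refl m l (\<alpha> k) = \<alpha> k" by (simp add: simple_refl_def cox_form_nonadjacent)
  with gen show ?case by (simp add: rho_mult par_carrier rho_sg)
qed simp

end

text \<open>The opposition of \<open>L\<close> followed by that of \<open>L - {a}\<close> sends
  simple roots to simple roots, as the two signs cancel. The exception is \<open>b\<close>, whose
  opposite in \<open>L\<close> is \<open>a\<close>, where the second opposition is not defined; so
  \<open>b\<close> leaves the index set. Vertices off \<open>L\<close> are fixed.\<close>

lemma crossing_elt:
  assumes a: "a \<notin> I" and fin: "finite (par (component_of_vertex m I a))"
  defines "L \<equiv> component_of_vertex m I a"
  defines "v \<equiv> crossing_elt m a I" and "b \<equiv> opposition m L a"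
  shows "matches v (insert a I - {b}) I" "v \<in> par (insert a I)" "b \<in> insert a I"
    "\<rho> v (\<alpha> b) = - \<rho> (longest m (L - {a})) (\<alpha> a)" "v \<noteq> \<one>\<^bsub>G\<^esub>"
proof -
  let ?u = "longest m (L - {a})" and ?w = "longest m L" and ?L' = "L - {a}"
  have finL: "finite (par L)" using fin by (simp add: L_def)
  have finL': "finite (par ?L')" using finL par_mono[of ?L' L] by (meson Diff_subset finite_subset)
  have u: "?u \<in> par ?L'" and w: "?w \<in> par L" using longest_max finL finL' by blast+
  have uL: "?u \<in> par L" using u par_mono[of ?L' L] by blast
  have c: "?u \<in> carrier G" "?w \<in> carrier G" using u w by blast+
  have veq: "v = ?u \<cdot> ?w" by (simp add: v_def crossing_elt_def L_def)
  have aL: "a \<in> L" and Lsub: "L \<subseteq> insert a I"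
    using component_base component_subset by (simp_all add: L_def)
  have L'I: "?L' \<subseteq> I" using Lsub by blast
  have b: "b \<in> L" "\<rho> ?w (\<alpha> a) = - \<alpha> b" "opposition m L b = a"
    using opposition[OF finL aL] opposition_opposition[OF finL aL] by (simp_all add: b_def)
  show bI: "b \<in> insert a I" using b Lsub by blast
  have "v \<in> par L" unfolding veq using uL w by blast
  then show "v \<in> par (insert a I)" using par_mono[OF Lsub] by blast
  show vb: "\<rho> v (\<alpha> b) = - \<rho> ?u (\<alpha> a)"
    using opposition(2)[OF finL b(1)] b(3) c by (simp add: veq rho_mult rho_minus)
  show "v \<noteq> \<one>\<^bsub>G\<^esub>"
  proof
    assume "v = \<one>\<^bsub>G\<^esub>"
    \<comment> \<open>The coordinate at \<open>a\<close> is 0 or 1 on the left, but -1 on the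
      right.\<close>
    then have "\<alpha> b $ a = - (\<rho> ?u (\<alpha> a) $ a)" using vb by simp
    then show False using par_coord[OF u, of a "\<alpha> a"] by (simp add: axis_def split: if_splits)
  qed
  have step: "\<rho> v (\<alpha> k) = \<alpha> (opposition m ?L' (opposition m L k))"
    if "k \<in> L" "opposition m L k \<noteq> a" for k
  proof -
    have "opposition m L k \<in> ?L'" using opposition(1)[OF finL that(1)] that(2) by blast
    then show ?thesis
      using opposition(2)[OF finL that(1)] opposition(2)[OF finL'] c by (simp add: veq rho_mult rho_minus)
  qed
  have fixed: "\<rho> v (\<alpha> k) = \<alpha> k" if "k \<in> insert a I" "k \<notin> L" for k
    using component_fixes[of v I a k] \<open>v \<in> par L\<close> that by (simp add: L_def)
  have opa: "opposition m L k = a \<longleftrightarrow> k = b" if "k \<in> L" for k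
    using opposition_opposition[OF finL that] b by (auto simp: b_def)
  show "matches v (insert a I - {b}) I"
    unfolding matches_def
  proof (intro conjI equalityI subsetI)
    show "v \<in> carrier G" using c by (simp add: veq)
    fix z assume "z \<in> \<rho> v ` \<alpha> ` (insert a I - {b})"
    then obtain k where k: "k \<in> insert a I" "k \<noteq> b" "z = \<rho> v (\<alpha> k)" by blast
    show "z \<in> \<alpha> ` I"
    proof (cases "k \<in> L")
      case True
      have "opposition m L k \<in> ?L'" using opposition(1)[OF finL True] opa[OF True] k by blast
      then have "opposition m ?L' (opposition m L k) \<in> I" using opposition(1)[OF finL'] L'I by blast
      then show ?thesis using step[OF True] opa[OF True] k by blast
    next
      case False
      then show ?thesis using fixed[OF k(1)] k aL by blast
    qed
  next
    fix z assume "z \<in> \<alpha> ` I"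
    then obtain i where i: "i \<in> I" "z = \<alpha> i" by blast
    show "z \<in> \<rho> v ` \<alpha> ` (insert a I - {b})"
    proof (cases "i \<in> L")
      case True
      then have iL': "i \<in> ?L'" using i a by blast
      \<comment> \<open>A preimage of \<open>i\<close> arises from the two involutions in the
        reverse order.\<close>
      define i' where "i' = opposition m ?L' i"
      define k where "k = opposition m L i'"
      have i': "i' \<in> ?L'" "opposition m ?L' i' = i"
        using opposition(1)[OF finL' iL'] opposition_opposition[OF finL' iL'] by (simp_all add: i'_def)
      have k: "k \<in> L" "opposition m L k = i'"
        using opposition(1)[OF finL, of i'] opposition_opposition[OF finL, of i'] i' by (simp_all add: k_def)
      have "opposition m L k \<noteq> a" using k i' by blast
      then have "\<rho> v (\<alpha> k) = z" "k \<noteq> b" using step[OF k(1)] k i' opa[OF k(1)] i by auto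
      then show ?thesis using k(1) Lsub by blast
    next
      case False
      then have "z = \<rho> v (\<alpha> i)" using fixed[of i] i by simp
      moreover have "i \<in> insert a I - {b}" using False i b(1) by blast
      ultimately show ?thesis by blast
    qed
  qed
qed

lemma crossing_adjacent:
  assumes x: "matches x I J" and a: "a \<notin> I" and fin: "finite (par (component_of_vertex m I a))"
  shows "wall_crossing m a (x, I) \<in> Cham m J"
    "adjacent m J (chamber_of m (x, I)) (chamber_of m (wall_crossing m a (x, I)))"
proof -
  define v where "v = crossing_elt m a I"
  define b where "b = opposition m (component_of_vertex m I a) a"
  note v = crossing_elt[OF a fin, folded v_def b_def]
  have y: "matches (x \<cdot> v) (insert a I - {b}) J" using matches_mult[OF x v(1)] .
  have eq: "wall_crossing m a (x, I) = (x \<cdot> v, insert a I - {b})"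
    by (simp add: wall_crossing_def v_def b_def)
  show "wall_crossing m a (x, I) \<in> Cham m J" using y by (simp add: eq Cham_eq)
  have c: "x \<in> carrier G" "v \<in> carrier G" using matches_carrier x v by blast+
  have xv: "iv x \<cdot> (x \<cdot> v) = v" using c by (simp add: W.m_assoc[symmetric])
  have ne: "(x, I) \<noteq> (x \<cdot> v, insert a I - {b})"
  proof
    assume "(x, I) = (x \<cdot> v, insert a I - {b})"
    then have "iv x \<cdot> x = v" using xv by simp
    then show False using v(5) c by simp
  qed
  from xv have p: "iv x \<cdot> (x \<cdot> v) \<in> par (insert a I)" using v(2) by simp
  have "b \<notin> insert a I - {b}" "insert a I = insert b (insert a I - {b})" using v(3) by blast+
  then show "adjacent m J (chamber_of m (x, I)) (chamber_of m (wall_crossing m a (x, I)))"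
    unfolding eq by (rule adjacentI[OF x y ne a _ _ p])
qed

subsection \<open>Factoring off a wall crossing\<close>

lemma root_closed: "\<beta> \<in> roots m \<Longrightarrow> w \<in> carrier G \<Longrightarrow> \<rho> w \<beta> \<in> roots m"
  unfolding roots_eq by (auto simp: rho_mult[symmetric]) blast

lemma axis_root: "\<alpha> i \<in> roots m"
  unfolding roots_eq by (rule CollectI) (metis W.one_closed rho_one)

lemma root_neg: "\<beta> \<in> roots m \<Longrightarrow> - \<beta> \<in> roots m"
proof -
  assume "\<beta> \<in> roots m"
  then obtain w i where w: "w \<in> carrier G" "\<beta> = \<rho> w (\<alpha> i)" by (auto simp: roots_eq)
  then have "- \<beta> = \<rho> (w \<cdot> sg i) (\<alpha> i)" by (simp add: rho_mult rho_sg_same rho_minus)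
  with w show ?thesis unfolding roots_eq by blast
qed

lemma root_nonneg_or_nonpos: "\<beta> \<in> roots m \<Longrightarrow> 0 \<le> \<beta> \<or> \<beta> \<le> 0"
  using root_sign by (auto simp: roots_eq)

lemma root_norm: "\<beta> \<in> roots m \<Longrightarrow> cox_form m \<beta> \<beta> = 1"
  by (auto simp: roots_eq rho_preserves cox_form_axis_same)

lemma root_nonneg_if_coord_pos: "\<beta> \<in> roots m \<Longrightarrow> \<beta> $ i > 0 \<Longrightarrow> 0 \<le> \<beta>"
  using root_nonneg_or_nonpos[of \<beta>] by (metis less_eq_vec_def not_le zero_index)

lemma root_nonpos_if_coord_neg: "\<beta> \<in> roots m \<Longrightarrow> \<beta> $ i < 0 \<Longrightarrow> \<beta> \<le> 0"
  using root_nonneg_or_nonpos[of \<beta>] by (metis less_eq_vec_def not_le zero_index)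

text \<open>Prepending \<open>i\<close> to the word adds at most one inversion: a nonnegative root
  made nonpositive by the reflection in \<open>\<alpha> i\<close> is a multiple of
  \<open>\<alpha> i\<close>, and its norm makes it equal to \<open>\<alpha> i\<close>.\<close>

lemma finite_inversions:
  assumes "w \<in> carrier G"
  shows "finite {\<beta> \<in> roots m. 0 \<le> \<beta> \<and> \<rho> w \<beta> \<le> 0}"
proof -
  obtain us where us: "w = cls us" using assms by (rule carrierE)
  have "finite {\<beta> \<in> roots m. 0 \<le> \<beta> \<and> \<rho> (cls us) \<beta> \<le> 0}"
  proof (induction us)
    case Nil
    have "{\<beta> \<in> roots m. 0 \<le> \<beta> \<and> \<rho> (cls []) \<beta> \<le> 0} \<subseteq> {0}" by (auto simp: geo_act_cls)
    then show ?case by (rule finite_subset) simp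
  next
    case (Cons i us)
    let ?w = "cls us"
    have "{\<beta> \<in> roots m. 0 \<le> \<beta> \<and> \<rho> (cls (i # us)) \<beta> \<le> 0} \<subseteq> insert (\<rho> (iv ?w) (\<alpha> i)) {\<beta> \<in> roots m. 0 \<le> \<beta> \<and> \<rho> ?w \<beta> \<le> 0}"
    proof
      fix \<beta> assume "\<beta> \<in> {\<beta> \<in> roots m. 0 \<le> \<beta> \<and> \<rho> (cls (i # us)) \<beta> \<le> 0}"
      then have \<beta>: "\<beta> \<in> roots m" "0 \<le> \<beta>" and neg: "simple_refl m i (\<rho> ?w \<beta>) \<le> 0"
        by (simp_all add: geo_act_cls)
      define \<gamma> where "\<gamma> = \<rho> ?w \<beta>"
      have \<gamma>: "\<gamma> \<in> roots m" using root_closed[OF \<beta>(1)] by (simp add: \<gamma>_def)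
      show "\<beta> \<in> insert (\<rho> (iv ?w) (\<alpha> i)) {\<beta> \<in> roots m. 0 \<le> \<beta> \<and> \<rho> ?w \<beta> \<le> 0}"
      proof (cases "\<gamma> \<le> 0")
        case True
        then show ?thesis using \<beta> by (simp add: \<gamma>_def)
      next
        case False
        then have pos: "0 \<le> \<gamma>" using root_nonneg_or_nonpos[OF \<gamma>] by blast
        have "\<gamma> $ l = 0" if "l \<noteq> i" for l
        proof (rule antisym)
          have "simple_refl m i \<gamma> $ l \<le> 0" using neg by (simp add: less_eq_vec_def \<gamma>_def)
          then show "\<gamma> $ l \<le> 0" by (simp add: simple_refl_nth_other[OF that])
          show "0 \<le> \<gamma> $ l" using pos by (simp add: less_eq_vec_def)
        qed
        moreover define c where "c = \<gamma> $ i"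
        ultimately have e: "\<gamma> = c *\<^sub>R \<alpha> i" by (simp add: vec_eq_iff axis_def)
        have "c * c = 1"
          using root_norm[OF \<gamma>] unfolding e by (simp add: cox_form_simps cox_form_axis_same)
        moreover have "c \<ge> 0" using pos by (simp add: less_eq_vec_def c_def)
        ultimately have "c = 1" by (simp add: square_eq_1_iff)
        then have "\<rho> ?w \<beta> = \<alpha> i" using e by (simp add: \<gamma>_def)
        then have "\<rho> (iv ?w) (\<alpha> i) = \<beta>" by (metis cls_carrier rho_inv_left)
        then show ?thesis by simp
      qed
    qed
    then show ?case using Cons by (meson finite_insert finite_subset)
  qed
  then show ?thesis by (simp add: us)
qed

text \<open>Operators that agree on \<open>S\<close> agree on its span, which contains the simple
  roots of \<open>I\<close>; so \<open>par I\<close> embeds into the self-maps of the finite set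
  \<open>S\<close>.\<close>

lemma finite_par_if_stable:
  assumes "finite S" and stable: "\<And>w \<beta>. w \<in> par I \<Longrightarrow> \<beta> \<in> S \<Longrightarrow> \<rho> w \<beta> \<in> S"
    and span: "\<alpha> ` I \<subseteq> span S"
  shows "finite (par I)"
proof (rule inj_on_finite)
  show "inj_on (\<lambda>w. restrict (\<rho> w) S) (par I)"
  proof (rule inj_onI)
    fix w w' assume w: "w \<in> par I" "w' \<in> par I" and eq: "restrict (\<rho> w) S = restrict (\<rho> w') S"
    have c: "w \<in> carrier G" "w' \<in> carrier G" using w by blast+
    have "\<rho> w v = \<rho> w' v" if "v \<in> S" for v using eq that by (metis restrict_apply')
    then have "\<rho> w v = \<rho> w' v" if "v \<in> span S" for v
      using linear_eq_on_span[OF linear_rho[OF c(1)] linear_rho[OF c(2)]] that by blast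
    then have "\<rho> (iv w' \<cdot> w) (\<alpha> i) = \<alpha> i" if "i \<in> I" for i
      using span that c by (simp add: rho_mult image_subset_iff)
    then have "iv w' \<cdot> w = \<one>\<^bsub>G\<^esub>" using w by (intro par_eq_one[of _ I]) (auto simp: axis_nonneg)
    then show "w = w'" using c by (metis W.inv_equality W.inv_inv W.inv_closed W.inv_comm)
  qed
  show "(\<lambda>w. restrict (\<rho> w) S) ` par I \<subseteq> S \<rightarrow>\<^sub>E S" using stable by auto
  show "finite (S \<rightarrow>\<^sub>E S)" using assms(1) by (intro finite_PiE)
qed

text \<open>All roots supported on the component \<open>L\<close> with positive \<open>a\<close>-coordinate are inverted by \<open>t\<close>, so
  there are finitely many. They are permuted by \<open>W\<close> of \<open>L - a\<close>, and faithfully so, since they span by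
  connectedness of \<open>L\<close>.\<close>

lemma finite_component:
  assumes t: "t \<in> carrier G" and aK: "a \<notin> K"
    and tK: "\<And>k. k \<in> K \<Longrightarrow> \<rho> t (\<alpha> k) \<in> range \<alpha>"
    and inv: "\<And>\<beta>. \<lbrakk>\<beta> \<in> roots m; \<beta> \<in> coord_space (insert a K); \<beta> $ a > 0\<rbrakk> \<Longrightarrow> \<rho> t \<beta> \<le> 0"
  shows "finite (par (component_of_vertex m K a))"
proof -
  define L where "L = component_of_vertex m K a"
  have aL: "a \<in> L" and Lsub: "L \<subseteq> insert a K" using component_base component_subset by (simp_all add: L_def)
  have VL: "coord_space L \<subseteq> coord_space (insert a K)" using Lsub by (auto simp: coord_space_def)
  define S where "S = {\<beta> \<in> roots m. \<beta> \<in> coord_space L \<and> \<beta> $ a > 0}"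
  have "S \<subseteq> {\<beta> \<in> roots m. 0 \<le> \<beta> \<and> \<rho> t \<beta> \<le> 0}"
    using inv VL root_nonneg_if_coord_pos by (auto simp: S_def)
  then have finS: "finite S" using finite_inversions[OF t] by (rule finite_subset)
  have stable: "\<rho> w \<beta> \<in> S" if "w \<in> par (L - {a})" "\<beta> \<in> S" for w \<beta>
    using that par_preserves[OF that(1) Diff_subset, of \<beta>] par_coord[OF that(1), of a \<beta>] root_closed
    by (auto simp: S_def par_carrier)
  have aS: "\<alpha> a \<in> S" using aL by (simp add: S_def axis_root)
  have span: "\<alpha> l \<in> span S" if "l \<in> L" for l
    using that unfolding L_def
  proof (induction rule: component_induct)
    case base
    show ?case using aS by (rule span_base)
  next
    case (step i j)
    show ?case
    proof (cases "j = a")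
      case True
      then show ?thesis using aS by (simp add: span_base)
    next
      case False
      then have j: "sg j \<in> par (L - {a})" using step by (auto simp: L_def)
      \<comment> \<open>Adjacency of \<open>i\<close> and \<open>j\<close> makes \<open>sg j\<close>
        change \<open>\<alpha> i\<close> by a nonzero multiple of \<open>\<alpha> j\<close>, so the
        difference brings \<open>\<alpha> j\<close> into the span.\<close>
      have "\<rho> (sg j) (\<alpha> i) \<in> span S"
        by (rule span_stable[OF linear_rho stable[OF j]]) (use step in auto)
      then have "\<alpha> i - \<rho> (sg j) (\<alpha> i) \<in> span S" using step by (intro span_diff)
      moreover have "\<alpha> i - \<rho> (sg j) (\<alpha> i) = (2 * cox_form m (\<alpha> j) (\<alpha> i)) *\<^sub>R \<alpha> j"
        by (simp add: rho_sg simple_refl_def)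
      moreover have "cox_form m (\<alpha> j) (\<alpha> i) \<noteq> 0"
        using cox_form_adjacent[of j i] step m_sym[of i j] by simp
      ultimately show ?thesis
        using span_scale[of "(2 * cox_form m (\<alpha> j) (\<alpha> i)) *\<^sub>R \<alpha> j" S "1 / (2 * cox_form m (\<alpha> j) (\<alpha> i))"] by simp
    qed
  qed
  have finL': "finite (par (L - {a}))"
    by (rule finite_par_if_stable[OF finS stable]) (use span in auto)
  define u where "u = longest m (L - {a})"
  have u: "u \<in> par (L - {a})" "u \<in> carrier G" using longest_max[OF finL'] by (auto simp: u_def)
  \<comment> \<open>The product is negative on all of \<open>L\<close>: \<open>u\<close> keeps the
    coordinate of \<open>\<alpha> a\<close> at \<open>a\<close> positive, so \<open>t\<close>
    inverts the result, while \<open>u\<close> negates the other simple roots up to a permutation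
    and \<open>t\<close> sends those to simple roots. Hence \<open>z\<close> inverts every positive
    root supported on \<open>L\<close>, and there are only finitely many.\<close>
  define z where "z = t \<cdot> u"
  have z: "z \<in> carrier G" using t u by (simp add: z_def)
  have neg: "\<rho> z (\<alpha> l) \<le> 0" if "l \<in> L" for l
  proof (cases "l = a")
    case True
    have "\<rho> u (\<alpha> a) \<in> S" using stable[OF u(1) aS] .
    then have "\<rho> t (\<rho> u (\<alpha> a)) \<le> 0" using inv VL by (auto simp: S_def)
    then show ?thesis using True t u by (simp add: z_def rho_mult)
  next
    case False
    then have l: "l \<in> L - {a}" using that by blast
    note o = opposition[OF finL' l, folded u_def]
    have "\<rho> t (\<alpha> (opposition m (L - {a}) l)) \<in> range \<alpha>" using tK o(1) Lsub by blast
    then have "0 \<le> \<rho> t (\<alpha> (opposition m (L - {a}) l))" using axis_nonneg by auto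
    then show ?thesis using o(2) t u by (simp add: z_def rho_mult rho_minus)
  qed
  define P where "P = {\<beta> \<in> roots m. \<beta> \<in> coord_space L \<and> 0 \<le> \<beta>}"
  have "P \<subseteq> {\<beta> \<in> roots m. 0 \<le> \<beta> \<and> \<rho> z \<beta> \<le> 0}"
  proof
    fix \<beta> assume "\<beta> \<in> P"
    then have \<beta>: "\<beta> \<in> roots m" "\<beta> \<in> coord_space L" "0 \<le> \<beta>" by (simp_all add: P_def)
    have "0 \<le> - \<rho> z \<beta>"
      by (rule linear_nonneg[of "\<lambda>v. - \<rho> z v", OF _ \<beta>(2,3)]) (use neg z in \<open>auto intro: linear_compose_neg linear_rho\<close>)
    with \<beta> show "\<beta> \<in> {\<beta> \<in> roots m. 0 \<le> \<beta> \<and> \<rho> z \<beta> \<le> 0}" by simp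
  qed
  then have finP: "finite P" using finite_inversions[OF z] by (rule finite_subset)
  define R where "R = {\<beta> \<in> roots m. \<beta> \<in> coord_space L}"
  have "R \<subseteq> P \<union> uminus ` P"
  proof
    fix \<beta> assume "\<beta> \<in> R"
    then have \<beta>: "\<beta> \<in> roots m" "\<beta> \<in> coord_space L" by (simp_all add: R_def)
    have "- \<beta> \<in> coord_space L" using \<beta>(2) by (intro subspace_neg subspace_coord_space)
    then have "\<beta> \<in> P \<or> - \<beta> \<in> P" using \<beta> root_nonneg_or_nonpos[OF \<beta>(1)] root_neg by (auto simp: P_def)
    then show "\<beta> \<in> P \<union> uminus ` P" by (metis UnCI image_eqI minus_minus)
  qed
  then have "finite R" using finP by (meson finite_UnI finite_imageI finite_subset)
  then show ?thesis unfolding L_def[symmetric]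
  proof (rule finite_par_if_stable)
    show "\<rho> w \<beta> \<in> R" if "w \<in> par L" "\<beta> \<in> R" for w \<beta>
      using that par_preserves[OF that(1) order_refl, of \<beta>] root_closed by (auto simp: R_def par_carrier)
    show "\<alpha> ` L \<subseteq> span R" by (auto simp: R_def axis_root intro!: span_base)
  qed
qed

text \<open>Split \<open>g = u \<cdot> t\<close> with \<open>u\<close> shortest in the coset modulo
  \<open>par Ka\<close>. By indecomposability \<open>t\<close> maps the simple roots of
  \<open>K\<close> onto those of \<open>Ka\<close> except one, \<open>b\<close>. In the coordinate
  at \<open>b\<close> only \<open>\<rho> t (\<alpha> a)\<close> contributes, negatively, so
  \<open>t\<close> inverts every root supported on \<open>Ka\<close> with positive coordinate at
  \<open>a\<close>. This yields sphericality and identifies the crossing element as the inverse of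
  \<open>t\<close>.\<close>

lemma factor_crossing:
  assumes g: "matches g K I" and desc: "\<rho> g (\<alpha> a) \<le> 0"
  shows "a \<notin> K" "finite (par (component_of_vertex m K a))" "len (g \<cdot> crossing_elt m a K) < len g"
proof -
  define Ka where "Ka = insert a K"
  have gc: "g \<in> carrier G" using matches_carrier[OF g] .
  have not_both: "\<not> (\<rho> w (\<alpha> i) \<le> 0 \<and> 0 \<le> \<rho> w (\<alpha> i))" if "w \<in> carrier G" for w i
    using that rho_eq_0_iff[of w "\<alpha> i"] axis_ne_0 by (metis antisym)
  show aK: "a \<notin> K"
    using matches_nonneg[OF g, of a] desc not_both[OF gc, of a] by blast
  obtain u t where u: "u \<in> carrier G" "t \<in> par Ka" "g = u \<cdot> t" "\<And>i. i \<in> Ka \<Longrightarrow> 0 \<le> \<rho> u (\<alpha> i)"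
    "\<And>t'. t' \<in> par Ka \<Longrightarrow> len u \<le> len (g \<cdot> t')"
    using coset_rep[OF gc] by metis
  have tc: "t \<in> carrier G" using u(2) by blast
  have "len u \<le> len (g \<cdot> sg a)" using u(5) by (simp add: Ka_def par_sg)
  also have "\<dots> < len g" using desc gc by (simp add: descent_iff)
  finally have shorter: "len u < len g" .
  have gt: "\<rho> g v = \<rho> u (\<rho> t v)" for v using u tc by (simp add: rho_mult)
  have tV: "\<rho> t v \<in> coord_space Ka" if "v \<in> coord_space Ka" for v
    using par_preserves[OF u(2) order_refl that] .
  have tK: "\<exists>l\<in>Ka. \<rho> t (\<alpha> k) = \<alpha> l" if k: "k \<in> K" for k
  proof -
    have V: "\<rho> t (\<alpha> k) \<in> coord_space Ka" using k by (intro tV) (simp add: Ka_def)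
    have "0 \<le> \<rho> t (\<alpha> k)"
    proof (rule ccontr)
      assume "\<not> ?thesis"
      then have "\<rho> t (\<alpha> k) \<le> 0" using root_sign[OF tc] by blast
      then have "\<rho> g (\<alpha> k) \<le> 0" unfolding gt using V u by (intro linear_nonpos[OF linear_rho[OF u(1)] V]) auto
      then show False using matches_nonneg[OF g k] not_both[OF gc] by blast
    qed
    moreover obtain i where "\<rho> u (\<rho> t (\<alpha> k)) = \<alpha> i" using matchesE[OF g k] gt by metis
    ultimately have "\<rho> t (\<alpha> k) \<in> \<alpha> ` Ka"
      by (intro simple_root_indecomposable[of "\<rho> u", OF linear_rho[OF u(1)] inj_rho[OF u(1)] rho_preserves[OF u(1)] u(4) V])
    then show ?thesis by blast
  qed
  then obtain \<tau> where \<tau>: "\<And>k. k \<in> K \<Longrightarrow> \<tau> k \<in> Ka" "\<And>k. k \<in> K \<Longrightarrow> \<rho> t (\<alpha> k) = \<alpha> (\<tau> k)" by metis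
  have ta: "\<rho> t (\<alpha> a) \<le> 0"
  proof (rule ccontr)
    assume "\<not> ?thesis"
    then have "0 \<le> \<rho> t (\<alpha> a)" using root_sign[OF tc] by blast
    then have "0 \<le> \<rho> g (\<alpha> a)" unfolding gt
      by (intro linear_nonneg[OF linear_rho[OF u(1)] tV] u(4)) (simp add: Ka_def)
    then show False using desc not_both[OF gc] by blast
  qed
  have "inj_on \<tau> K"
  proof (rule inj_onI)
    fix k k' assume "k \<in> K" "k' \<in> K" "\<tau> k = \<tau> k'"
    then have "\<rho> t (\<alpha> k) = \<rho> t (\<alpha> k')" using \<tau> by simp
    then show "k = k'" using tc by (simp add: rho_eq_iff axis_eq_axis)
  qed
  then have card: "card (\<tau> ` K) = card K" by (rule card_image)
  have "card (\<tau> ` K) < card Ka" using card aK by (simp add: Ka_def)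
  then obtain b where b: "b \<in> Ka" "b \<notin> \<tau> ` K" by (metis card_mono finite leD subsetI)
  have \<tau>K: "\<tau> ` K = Ka - {b}"
  proof (rule card_subset_eq)
    show "card (\<tau> ` K) = card (Ka - {b})" using b card aK by (simp add: Ka_def)
  qed (use \<tau> b in auto)
  \<comment> \<open>Otherwise \<open>\<rho> t (\<alpha> a)\<close> would be a combination of the
    images of \<open>K\<close>, and undoing \<open>t\<close> would put \<open>\<alpha> a\<close>
    into \<open>coord_space K\<close>.\<close>
  have "\<rho> t (\<alpha> a) $ b \<noteq> 0"
  proof
    assume z: "\<rho> t (\<alpha> a) $ b = 0"
    have V: "\<rho> t (\<alpha> a) \<in> coord_space Ka" by (intro tV) (simp add: Ka_def)
    have "\<rho> t (\<alpha> a) $ j = 0" if "j \<notin> \<tau> ` K" for j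
      using V z that unfolding \<tau>K by (cases "j = b") (auto simp: coord_space_def)
    then have "\<rho> t (\<alpha> a) \<in> coord_space (\<tau> ` K)" by (simp add: coord_space_def)
    moreover have "\<rho> (iv t) (\<alpha> l) \<in> coord_space K" if "l \<in> \<tau> ` K" for l
    proof -
      obtain k where k: "k \<in> K" "l = \<tau> k" using \<open>l \<in> \<tau> ` K\<close> by blast
      then have "\<rho> (iv t) (\<alpha> l) = \<alpha> k" using \<tau>(2)[OF k(1)] tc by (metis rho_inv_left)
      then show ?thesis using k by simp
    qed
    ultimately have "\<rho> (iv t) (\<rho> t (\<alpha> a)) \<in> coord_space K"
      by (rule linear_maps_coord_space[OF linear_rho[OF W.inv_closed[OF tc]]])
    then show False using tc aK by simp
  qed
  then have tab: "\<rho> t (\<alpha> a) $ b < 0" using ta by (auto simp: less_eq_vec_def less_le)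
  have inv: "\<rho> t \<beta> \<le> 0" if \<beta>: "\<beta> \<in> roots m" "\<beta> \<in> coord_space (insert a K)" "\<beta> $ a > 0" for \<beta>
  proof -
    have "\<rho> t \<beta> = (\<Sum>i\<in>insert a K. \<beta> $ i *\<^sub>R \<rho> t (\<alpha> i))"
      by (rule linear_coord_space[OF linear_rho[OF tc] \<beta>(2)])
    then have "\<rho> t \<beta> $ b = (\<Sum>i\<in>insert a K. \<beta> $ i * \<rho> t (\<alpha> i) $ b)" by simp
    also have "\<dots> = \<beta> $ a * \<rho> t (\<alpha> a) $ b + (\<Sum>i\<in>K. \<beta> $ i * \<rho> t (\<alpha> i) $ b)"
      using aK by simp
    also have "(\<Sum>i\<in>K. \<beta> $ i * \<rho> t (\<alpha> i) $ b) = 0"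
      using b \<tau> by (intro sum.neutral) (auto simp: axis_def)
    finally have "\<rho> t \<beta> $ b < 0" using \<beta>(3) tab by (simp add: mult_pos_neg)
    then show ?thesis using root_nonpos_if_coord_neg root_closed[OF \<beta>(1) tc] by blast
  qed
  show fin: "finite (par (component_of_vertex m K a))"
    by (rule finite_component[OF tc aK _ inv]) (use \<tau> in auto)
  define L where "L = component_of_vertex m K a"
  define v where "v = crossing_elt m a K"
  define b' where "b' = opposition m L a"
  note v = crossing_elt[OF aK fin, folded L_def, folded v_def b'_def]
  have vc: "v \<in> carrier G" using v(2) by blast
  \<comment> \<open>Positivity on \<open>Ka\<close> suffices. Away from \<open>b'\<close> the
    element \<open>v\<close> leads to simple roots of \<open>K\<close>, which \<open>t\<close> keeps
    simple; at \<open>b'\<close> it gives the negative of a root with positive coordinate at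
    \<open>a\<close>, which \<open>t\<close> inverts.\<close>
  have "t \<cdot> v = \<one>\<^bsub>G\<^esub>"
  proof (rule par_eq_one)
    show "t \<cdot> v \<in> par Ka" using u(2) v(2) by (auto simp: Ka_def)
    fix i assume i: "i \<in> Ka"
    show "0 \<le> \<rho> (t \<cdot> v) (\<alpha> i)"
    proof (cases "i = b'")
      case False
      then obtain k where "k \<in> K" "\<rho> v (\<alpha> i) = \<alpha> k" using matchesE[OF v(1)] i by (metis Ka_def DiffI singletonD)
      then show ?thesis using \<tau>(2) tc vc axis_nonneg by (simp add: rho_mult)
    next
      case True
      let ?\<beta> = "\<rho> (longest m (L - {a})) (\<alpha> a)"
      have "finite (par (L - {a}))"
        using fin par_mono[of "L - {a}" L] unfolding L_def[symmetric] by (meson Diff_subset finite_subset)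
      then have w: "longest m (L - {a}) \<in> par (L - {a})" using longest_max by blast
      have "L \<subseteq> insert a K" using component_subset by (simp add: L_def)
      then have "?\<beta> \<in> coord_space (insert a K)" by (intro par_preserves[OF w]) auto
      moreover have "?\<beta> $ a > 0" using par_coord[OF w, of a "\<alpha> a"] by simp
      moreover have "?\<beta> \<in> roots m" using w by (intro root_closed axis_root) blast
      ultimately have "\<rho> t ?\<beta> \<le> 0" using inv by blast
      then show ?thesis using True v(4) tc vc by (simp add: rho_mult rho_minus)
    qed
  qed
  then have "g \<cdot> v = u" using u tc vc by (simp add: W.m_assoc)
  then show "len (g \<cdot> crossing_elt m a K) < len g" using shorter by (simp add: v_def)
qed

section \<open>The two groupoids\<close>

lemma BH_simps:
  "Ob (BH m J) = {I. \<exists>x. matches x I J}"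
  "Ar (BH m J) = {(I, x, K). (\<exists>y. matches y I J) \<and> (\<exists>y. matches y K J) \<and> matches x K I}"
  "src (BH m J) (I, x, K) = I" "tgt (BH m J) (I, x, K) = K"
  "idn (BH m J) I = (I, \<one>\<^bsub>G\<^esub>, I)"
  "cmp (BH m J) (I, x, K) (K', y, L) = (I, x \<cdot> y, L)"
  by (auto simp: BH_def Let_def associate_iff matches_def Setcompr_eq_image image_image)

lemma BHt_simps:
  "Ob (BHt m J) = {(x, I). matches x I J}"
  "Ar (BHt m J) = {((x, I), g, (y, K)) | x I g y K. matches x I J \<and> matches y K J \<and> g = iv x \<cdot> y}"
  "src (BHt m J) (P, g, Q) = P" "tgt (BHt m J) (P, g, Q) = Q"
  "idn (BHt m J) P = (P, \<one>\<^bsub>G\<^esub>, P)"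
  "cmp (BHt m J) (P, g, Q) (Q', h, R) = (P, g \<cdot> h, R)"
  by (auto simp: BHt_def Cham_eq)

lemma BHt_arE:
  assumes "f \<in> Ar (BHt m J)"
  obtains x I y K where "f = ((x, I), iv x \<cdot> y, (y, K))" "matches x I J" "matches y K J"
  using assms by (auto simp: BHt_simps)

lemma BHt_arI: "\<lbrakk>matches x I J; matches y K J; g = iv x \<cdot> y\<rbrakk> \<Longrightarrow> ((x, I), g, (y, K)) \<in> Ar (BHt m J)"
  by (simp add: BHt_simps)

lemma BH_arE:
  assumes "f \<in> Ar (BH m J)"
  obtains I g K x y where "f = (I, g, K)" "matches g K I" "matches x I J" "matches y K J"
  using assms by (auto simp: BH_simps)

lemma BH_arI: "\<lbrakk>matches g K I; matches x I J\<rbrakk> \<Longrightarrow> (I, g, K) \<in> Ar (BH m J)"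
  using matches_mult[of x I J g K] by (auto simp: BH_simps)

lemma inv_mult_cancel: "\<lbrakk>x \<in> carrier G; y \<in> carrier G; z \<in> carrier G\<rbrakk> \<Longrightarrow> (iv x \<cdot> y) \<cdot> (iv y \<cdot> z) = iv x \<cdot> z"
  by (metis W.inv_closed W.inv_solve_left W.m_assoc W.m_closed)

lemma groupoid_BH: "groupoid (BH m J)"
proof
  fix a assume "a \<in> Ar (BH m J)"
  then obtain I g K x y where a: "a = (I, g, K)" "matches g K I" "matches x I J" "matches y K J" by (rule BH_arE)
  note c = matches_carrier[OF a(2)]
  show "src (BH m J) a \<in> Ob (BH m J)" "tgt (BH m J) a \<in> Ob (BH m J)" using a by (auto simp: BH_simps)
  show "cmp (BH m J) (idn (BH m J) (src (BH m J) a)) a = a" "cmp (BH m J) a (idn (BH m J) (tgt (BH m J) a)) = a"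
    using a c by (simp_all add: BH_simps)
  have "(K, iv g, I) \<in> Ar (BH m J)" using matches_inv[OF a(2)] a(4) by (rule BH_arI)
  then show "\<exists>b\<in>Ar (BH m J). src (BH m J) b = tgt (BH m J) a \<and> tgt (BH m J) b = src (BH m J) a \<and>
      cmp (BH m J) a b = idn (BH m J) (src (BH m J) a) \<and> cmp (BH m J) b a = idn (BH m J) (tgt (BH m J) a)"
    using a c by (intro bexI[of _ "(K, iv g, I)"]) (simp_all add: BH_simps)
next
  fix I assume I: "I \<in> Ob (BH m J)"
  then show "idn (BH m J) I \<in> Ar (BH m J)" using matches_one[of I] by (auto simp: BH_simps)
  show "src (BH m J) (idn (BH m J) I) = I" "tgt (BH m J) (idn (BH m J) I) = I" by (simp_all add: BH_simps)
next
  fix a b assume ab: "a \<in> Ar (BH m J)" "b \<in> Ar (BH m J)" "tgt (BH m J) a = src (BH m J) b"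
  obtain I g K x y where a: "a = (I, g, K)" "matches g K I" "matches x I J" "matches y K J" using ab(1) by (rule BH_arE)
  obtain K' h L x' y' where b: "b = (K', h, L)" "matches h L K'" "matches x' K' J" "matches y' L J" using ab(2) by (rule BH_arE)
  have "K' = K" using ab(3) a b by (simp add: BH_simps)
  then show "cmp (BH m J) a b \<in> Ar (BH m J)"
    using a b matches_mult[OF a(2)] by (simp add: BH_simps(6)) (blast intro: BH_arI)
  show "src (BH m J) (cmp (BH m J) a b) = src (BH m J) a" "tgt (BH m J) (cmp (BH m J) a b) = tgt (BH m J) b"
    using a b by (simp_all add: BH_simps)
  fix c assume "c \<in> Ar (BH m J)"
  then obtain L' k M x'' y'' where c: "c = (L', k, M)" "matches k M L'" "matches x'' L' J" "matches y'' M J" by (rule BH_arE)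
  show "cmp (BH m J) (cmp (BH m J) a b) c = cmp (BH m J) a (cmp (BH m J) b c)"
    using a b c by (simp add: BH_simps W.m_assoc matches_carrier)
qed

lemma groupoid_BHt: "groupoid (BHt m J)"
proof
  fix a assume "a \<in> Ar (BHt m J)"
  then obtain x I y K where a: "a = ((x, I), iv x \<cdot> y, (y, K))" "matches x I J" "matches y K J" by (rule BHt_arE)
  note c = matches_carrier[OF a(2)] matches_carrier[OF a(3)]
  show "src (BHt m J) a \<in> Ob (BHt m J)" "tgt (BHt m J) a \<in> Ob (BHt m J)" using a by (simp_all add: BHt_simps)
  show "cmp (BHt m J) (idn (BHt m J) (src (BHt m J) a)) a = a" "cmp (BHt m J) a (idn (BHt m J) (tgt (BHt m J) a)) = a"
    using a c by (simp_all add: BHt_simps)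
  have "((y, K), iv y \<cdot> x, (x, I)) \<in> Ar (BHt m J)" using a by (intro BHt_arI) simp_all
  then show "\<exists>b\<in>Ar (BHt m J). src (BHt m J) b = tgt (BHt m J) a \<and> tgt (BHt m J) b = src (BHt m J) a \<and>
      cmp (BHt m J) a b = idn (BHt m J) (src (BHt m J) a) \<and> cmp (BHt m J) b a = idn (BHt m J) (tgt (BHt m J) a)"
    using a c by (intro bexI[of _ "((y, K), iv y \<cdot> x, (x, I))"]) (simp_all add: BHt_simps(3-) inv_mult_cancel)
next
  fix P assume P: "P \<in> Ob (BHt m J)"
  obtain x I where "P = (x, I)" by (metis surj_pair)
  with P show "idn (BHt m J) P \<in> Ar (BHt m J)" by (simp add: BHt_simps matches_carrier)
  show "src (BHt m J) (idn (BHt m J) P) = P" "tgt (BHt m J) (idn (BHt m J) P) = P" by (simp_all add: BHt_simps)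
next
  fix a b assume ab: "a \<in> Ar (BHt m J)" "b \<in> Ar (BHt m J)" "tgt (BHt m J) a = src (BHt m J) b"
  obtain x I y K where a: "a = ((x, I), iv x \<cdot> y, (y, K))" "matches x I J" "matches y K J" using ab(1) by (rule BHt_arE)
  obtain y' K' z L where b: "b = ((y', K'), iv y' \<cdot> z, (z, L))" "matches y' K' J" "matches z L J" using ab(2) by (rule BHt_arE)
  have e: "y' = y" "K' = K" using ab(3) a b by (simp_all add: BHt_simps)
  have c: "x \<in> carrier G" "y \<in> carrier G" "z \<in> carrier G" "y' \<in> carrier G" using a b matches_carrier by blast+
  show "cmp (BHt m J) a b \<in> Ar (BHt m J)"
    using a b c by (simp add: BHt_simps(3-) e inv_mult_cancel BHt_arI)
  show "src (BHt m J) (cmp (BHt m J) a b) = src (BHt m J) a" "tgt (BHt m J) (cmp (BHt m J) a b) = tgt (BHt m J) b"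
    using a b by (simp_all add: BHt_simps)
  fix d assume "d \<in> Ar (BHt m J)"
  then obtain z' L' w M where d: "d = ((z', L'), iv z' \<cdot> w, (w, M))" "matches z' L' J" "matches w M J" by (rule BHt_arE)
  show "cmp (BHt m J) (cmp (BHt m J) a b) d = cmp (BHt m J) a (cmp (BHt m J) b d)"
    using a b c d by (simp add: BHt_simps(3-) W.m_assoc matches_carrier)
qed

lemma BH_functor_simps:
  "fst BH_functor (x, I) = I" "snd BH_functor ((x, I), g, (y, K)) = (I, g, K)"
  by (simp_all add: BH_functor_def)

lemma matches_label: "\<lbrakk>matches x I J; matches y K J\<rbrakk> \<Longrightarrow> matches (iv x \<cdot> y) K I"
  by (rule matches_mult[OF matches_inv])

lemma BH_functor: "groupoid_functor (BHt m J) (BH m J) BH_functor"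
proof (rule groupoid_functor.intro[OF groupoid_BHt groupoid_BH], unfold_locales)
  fix P assume "P \<in> Ob (BHt m J)"
  then show "fst BH_functor P \<in> Ob (BH m J)"
    "snd BH_functor (idn (BHt m J) P) = idn (BH m J) (fst BH_functor P)"
    by (auto simp: BHt_simps BH_simps BH_functor_simps)
next
  fix a assume "a \<in> Ar (BHt m J)"
  then obtain x I y K where a: "a = ((x, I), iv x \<cdot> y, (y, K))" "matches x I J" "matches y K J" by (rule BHt_arE)
  show "snd BH_functor a \<in> Ar (BH m J)"
    using a matches_label[OF a(2,3)] by (auto simp: BH_functor_simps intro: BH_arI)
  show "src (BH m J) (snd BH_functor a) = fst BH_functor (src (BHt m J) a)"
    "tgt (BH m J) (snd BH_functor a) = fst BH_functor (tgt (BHt m J) a)"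
    using a by (simp_all add: BHt_simps BH_simps BH_functor_simps)
next
  fix a b assume "a \<in> Ar (BHt m J)" "b \<in> Ar (BHt m J)"
  then obtain x I y K x' I' y' K' where "a = ((x, I), iv x \<cdot> y, (y, K))" "b = ((x', I'), iv x' \<cdot> y', (y', K'))"
    by (auto elim!: BHt_arE)
  then show "snd BH_functor (cmp (BHt m J) a b) = cmp (BH m J) (snd BH_functor a) (snd BH_functor b)"
    by (simp add: BHt_simps BH_simps BH_functor_simps)
qed

lemma BH_universal_covering: "universal_groupoid_covering (BHt m J) (BH m J) BH_functor"
proof -
  interpret F: groupoid_functor "BHt m J" "BH m J" BH_functor by (rule BH_functor)
  show ?thesis
  proof
    fix b P assume b: "b \<in> Ar (BH m J)" and P: "P \<in> Ob (BHt m J)" and e: "fst BH_functor P = src (BH m J) b"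
    obtain I g K z w where bb: "b = (I, g, K)" "matches g K I" "matches z I J" "matches w K J" using b by (rule BH_arE)
    obtain x where x: "P = (x, I)" "matches x I J"
      using P e bb by (auto simp: BHt_simps BH_simps BH_functor_simps)
    have c: "x \<in> carrier G" "g \<in> carrier G" using x bb matches_carrier by blast+
    have inv: "iv x \<cdot> (x \<cdot> g) = g" using c by (simp add: W.m_assoc[symmetric])
    \<comment> \<open>The label \<open>iv x \<cdot> y\<close> of the lift has to be
      \<open>g\<close>, which forces the end point \<open>(x \<cdot> g, K)\<close>.\<close>
    show "\<exists>!p. snd p \<in> Ar (BHt m J) \<and> src (BHt m J) (snd p) = P \<and> tgt (BHt m J) (snd p) = fst p \<and> snd BH_functor (snd p) = b"
    proof (rule ex1I[of _ "((x \<cdot> g, K), (x, I), g, (x \<cdot> g, K))"], intro conjI)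
      show "snd ((x \<cdot> g, K), (x, I), g, (x \<cdot> g, K)) \<in> Ar (BHt m J)"
        using matches_mult[OF x(2) bb(2)] x(2) inv by (simp add: BHt_arI)
    next
      fix p assume p: "snd p \<in> Ar (BHt m J) \<and> src (BHt m J) (snd p) = P \<and> tgt (BHt m J) (snd p) = fst p \<and> snd BH_functor (snd p) = b"
      then obtain x' I' y K' where f: "snd p = ((x', I'), iv x' \<cdot> y, (y, K'))" "matches x' I' J" "matches y K' J"
        using BHt_arE by metis
      have e: "x' = x" "fst p = (y, K')" "iv x' \<cdot> y = g" "I' = I" "K' = K"
        using p x bb unfolding f(1) by (auto simp: BHt_simps(3,4) BH_functor_simps)
      have "x \<cdot> (iv x \<cdot> y) = y" using c f(3) by (simp add: W.m_assoc[symmetric] matches_carrier)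
      then have "y = x \<cdot> g" using e by simp
      then show "p = ((x \<cdot> g, K), (x, I), g, (x \<cdot> g, K))" using f(1) e by (simp add: prod_eq_iff)
    qed (simp_all add: x bb BHt_simps BH_functor_simps)
  next
    fix a assume "a \<in> Ar (BHt m J)" "src (BHt m J) a = tgt (BHt m J) a"
    then show "a = idn (BHt m J) (src (BHt m J) a)"
      by (auto elim!: BHt_arE simp: BHt_simps matches_carrier)
  qed
qed

subsection \<open>Generation by simple wall crossings\<close>

lemma simple_wall_crossingsI:
  assumes "matches x I J" "a \<notin> I" "finite (par (component_of_vertex m I a))"
  shows "((x, I), crossing_elt m a I, wall_crossing m a (x, I)) \<in> simple_wall_crossings m J"
  unfolding simple_wall_crossings_def using assms crossing_adjacent[OF assms] by (auto simp: Cham_eq)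

lemma simple_wall_crossings_sub: "simple_wall_crossings m J \<subseteq> Ar (BHt m J)"
proof
  fix f assume "f \<in> simple_wall_crossings m J"
  then obtain x I a where f: "f = ((x, I), crossing_elt m a I, wall_crossing m a (x, I))"
    "matches x I J" "a \<notin> I" "finite (par (component_of_vertex m I a))"
    by (auto simp: simple_wall_crossings_def Cham_eq)
  have c: "x \<in> carrier G" "crossing_elt m a I \<in> carrier G"
    using f(2) crossing_elt(1)[OF f(3,4)] matches_carrier by blast+
  then show "f \<in> Ar (BHt m J)"
    using f(1,2) crossing_adjacent(1)[OF f(2-4)]
    by (auto simp: wall_crossing_def Cham_eq W.m_assoc[symmetric] intro!: BHt_arI)
qed

text \<open>The crossing is taken at the target \<open>(y, K)\<close>: the source stays fixed and
  the label \<open>iv x \<cdot> y\<close> is multiplied on the right, where a descent shortens it.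
  The inverse of that crossing then leads back to \<open>(y, K)\<close>.\<close>

lemma arrow_generated:
  "\<lbrakk>matches x I J; matches y K J\<rbrakk> \<Longrightarrow>
    ((x, I), iv x \<cdot> y, (y, K)) \<in> subgroupoid_generated (BHt m J) (simple_wall_crossings m J)"
proof (induction "len (iv x \<cdot> y)" arbitrary: y K rule: less_induct)
  case less
  let ?S = "subgroupoid_generated (BHt m J) (simple_wall_crossings m J)"
  define g where "g = iv x \<cdot> y"
  have c: "x \<in> carrier G" "y \<in> carrier G" using less.prems matches_carrier by blast+
  have gc: "g \<in> carrier G" using c by (simp add: g_def)
  have g: "matches g K I" unfolding g_def using less.prems by (rule matches_label)
  have xg: "x \<cdot> g = y" using c by (simp add: g_def W.m_assoc[symmetric])
  show ?case
  proof (cases "g = \<one>\<^bsub>G\<^esub>")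
    case True
    then have "x = y" using xg c by simp
    moreover have "I = K"
      using g unfolding True matches_def by (auto simp: inj_image_eq_iff inj_def axis_eq_axis image_image)
    moreover have "idn (BHt m J) (x, I) \<in> ?S"
      using less.prems by (intro subgroupoid_generated.idn) (simp add: BHt_simps)
    ultimately show ?thesis using True by (simp add: BHt_simps g_def)
  next
    case False
    then obtain a where a: "len (g \<cdot> sg a) < len g" using right_descent[OF gc] by blast
    then have "\<rho> g (\<alpha> a) \<le> 0" using gc by (simp add: descent_iff)
    note f = factor_crossing[OF g this]
    define v where "v = crossing_elt m a K"
    define K' where "K' = insert a K - {opposition m (component_of_vertex m K a) a}"
    have v: "matches v K' K" unfolding v_def K'_def by (rule crossing_elt(1)[OF f(1,2)])
    have vc: "v \<in> carrier G" using matches_carrier[OF v] .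
    have yv: "matches (y \<cdot> v) K' J" using matches_mult[OF less.prems(2) v] .
    have e1: "iv x \<cdot> (y \<cdot> v) = g \<cdot> v" using c vc by (simp add: g_def W.m_assoc)
    have s: "((y, K), v, (y \<cdot> v, K')) \<in> ?S"
      using subgroupoid_generated.gen[OF simple_wall_crossingsI[OF less.prems(2) f(1,2)]]
      by (simp add: v_def K'_def wall_crossing_def)
    have s': "((y \<cdot> v, K'), iv v, (y, K)) \<in> ?S"
    proof (rule subgroupoid_generated.inv[OF s])
      show "((y \<cdot> v, K'), iv v, (y, K)) \<in> Ar (BHt m J)"
        using yv less.prems(2) c vc by (intro BHt_arI) (simp_all add: W.inv_mult_group W.m_assoc)
    qed (use vc in \<open>simp_all add: BHt_simps\<close>)
    have r: "((x, I), g \<cdot> v, (y \<cdot> v, K')) \<in> ?S"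
      using less.hyps[of "y \<cdot> v" K'] f(3) less.prems(1) yv e1 by (simp add: v_def g_def)
    have "cmp (BHt m J) ((x, I), g \<cdot> v, (y \<cdot> v, K')) ((y \<cdot> v, K'), iv v, (y, K)) \<in> ?S"
      by (rule subgroupoid_generated.cmp[OF r s']) (simp add: BHt_simps)
    moreover have "g \<cdot> v \<cdot> iv v = g" using gc vc by (simp add: W.m_assoc)
    ultimately show ?thesis by (simp add: BHt_simps g_def)
  qed
qed

lemma generates_BHt: "generates_groupoid (BHt m J) (simple_wall_crossings m J)"
  unfolding generates_groupoid_def
proof (intro conjI equalityI simple_wall_crossings_sub generated_sub groupoid_BHt subsetI)
  fix f assume "f \<in> Ar (BHt m J)"
  then show "f \<in> subgroupoid_generated (BHt m J) (simple_wall_crossings m J)"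
    by (auto elim!: BHt_arE intro: arrow_generated)
qed

section \<open>The action of the normalizer quotient\<close>

abbreviation NJ :: "'v set \<Rightarrow> 'v list set monoid" where
  "NJ J \<equiv> G\<lparr>carrier := normalizer G (par J)\<rparr>"

lemma normal_par: "par J \<lhd> NJ J"
  by (rule W.subgroup_in_normalizer[OF subgroup_par])

lemma group_NWJ: "group (NWJ m J)"
  unfolding NWJ_def by (rule normal.factorgroup_is_group[OF normal_par])

lemma normalizer_iff:
  "g \<in> normalizer G (par J) \<longleftrightarrow> g \<in> carrier G \<and> par J #>\<^bsub>G\<^esub> g = g <#\<^bsub>G\<^esub> par J"
proof -
  have sub: "par J \<subseteq> carrier G" by blast
  have "g <#\<^bsub>G\<^esub> par J #>\<^bsub>G\<^esub> iv g = par J \<longleftrightarrow> par J #>\<^bsub>G\<^esub> g = g <#\<^bsub>G\<^esub> par J" if g: "g \<in> carrier G"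
  proof
    assume "g <#\<^bsub>G\<^esub> par J #>\<^bsub>G\<^esub> iv g = par J"
    then have "par J #>\<^bsub>G\<^esub> g = g <#\<^bsub>G\<^esub> par J #>\<^bsub>G\<^esub> iv g #>\<^bsub>G\<^esub> g" by simp
    also have "\<dots> = g <#\<^bsub>G\<^esub> par J"
      using g sub by (simp add: W.coset_mult_assoc W.l_coset_subset_G)
    finally show "par J #>\<^bsub>G\<^esub> g = g <#\<^bsub>G\<^esub> par J" .
  next
    assume "par J #>\<^bsub>G\<^esub> g = g <#\<^bsub>G\<^esub> par J"
    then have "g <#\<^bsub>G\<^esub> par J #>\<^bsub>G\<^esub> iv g = par J #>\<^bsub>G\<^esub> g #>\<^bsub>G\<^esub> iv g" by simp
    also have "\<dots> = par J" using g sub by (simp add: W.coset_mult_assoc)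
    finally show "g <#\<^bsub>G\<^esub> par J #>\<^bsub>G\<^esub> iv g = par J" .
  qed
  then show ?thesis using sub by (auto simp: normalizer_def stabilizer_def)
qed

definition ncoset :: "'v set \<Rightarrow> 'v list set \<Rightarrow> 'v list set set" where
  "ncoset J y = par J #>\<^bsub>G\<^esub> y"

lemma NWJ_carrierI: "matches y J J \<Longrightarrow> ncoset J y \<in> carrier (NWJ m J)"
  using matches_parabolic_conj[of y J J] matches_carrier[of y J J] normalizer_iff[of y J]
  by (auto simp: NWJ_def FactGroup_def RCOSETS_def ncoset_def r_coset_def)

lemma NWJ_carrierE:
  assumes "n \<in> carrier (NWJ m J)"
  obtains y where "matches y J J" "n = ncoset J y"
proof -
  obtain g where g: "g \<in> normalizer G (par J)" "n = par J #>\<^bsub>G\<^esub> g"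
    using assms by (auto simp: NWJ_def FactGroup_def RCOSETS_def r_coset_def)
  then have gc: "g \<in> carrier G" and eq: "par J #>\<^bsub>G\<^esub> g = g <#\<^bsub>G\<^esub> par J" by (simp_all add: normalizer_iff)
  obtain u t where u: "matches u J J" "t \<in> par J" "g = u \<cdot> t"
    using matches_coset_rep[OF gc parabolic_conj_coord_space[OF gc eq]] by blast
  have "n = u \<cdot> t <#\<^bsub>G\<^esub> par J" using g eq u by simp
  also have "\<dots> = u <#\<^bsub>G\<^esub> (t <#\<^bsub>G\<^esub> par J)"
    using u(2) matches_carrier[OF u(1)] by (intro W.lcos_m_assoc[symmetric]) blast+
  also have "t <#\<^bsub>G\<^esub> par J = par J" using u(2) by (intro W.coset_join3 subgroup_par) blast+
  finally have "n = ncoset J u" using matches_parabolic_conj[OF u(1)] by (simp add: ncoset_def)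
  with u(1) show thesis by (rule that)
qed

lemma ncoset_mult:
  assumes y: "matches y J J" and z: "matches z J J"
  shows "ncoset J y \<otimes>\<^bsub>NWJ m J\<^esub> ncoset J z = ncoset J (y \<cdot> z)"
proof -
  have c: "y \<in> normalizer G (par J)" "z \<in> normalizer G (par J)"
    using y z matches_parabolic_conj matches_carrier by (simp_all add: normalizer_iff)
  have "(par J #>\<^bsub>NJ J\<^esub> y) <#>\<^bsub>NJ J\<^esub> (par J #>\<^bsub>NJ J\<^esub> z) = par J #>\<^bsub>NJ J\<^esub> (y \<otimes>\<^bsub>NJ J\<^esub> z)"
    using c by (intro normal.rcos_sum[OF normal_par]) simp_all
  then show ?thesis by (simp add: NWJ_def FactGroup_def ncoset_def r_coset_def set_mult_def)
qed

lemma NWJ_one: "\<one>\<^bsub>NWJ m J\<^esub> = ncoset J \<one>\<^bsub>G\<^esub>"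
proof -
  have "par J #>\<^bsub>G\<^esub> \<one>\<^bsub>G\<^esub> = par J" by (intro W.coset_mult_one) blast
  then show ?thesis by (simp add: NWJ_def FactGroup_def ncoset_def)
qed

text \<open>Being no longer than \<open>z\<close>, the element \<open>z \<cdot> s\<close> is itself
  minimal in the coset, and only one representative is positive on \<open>I\<close>. This evaluates
  the \<open>ARG_MIN\<close> in the action.\<close>

lemma minimal_unique:
  assumes z: "matches z I J" and s: "s \<in> par I" and le: "len (z \<cdot> s) \<le> len z"
  shows "s = \<one>\<^bsub>G\<^esub>"
proof -
  have c: "z \<in> carrier G" "s \<in> carrier G" using matches_carrier[OF z] s by blast+
  have zmin: "\<forall>t\<in>par I. len z \<le> len (z \<cdot> t)" using minimal_iff[OF c(1)] matches_nonneg[OF z] by blast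
  have "\<forall>t\<in>par I. len (z \<cdot> s) \<le> len (z \<cdot> s \<cdot> t)"
  proof
    fix t assume t: "t \<in> par I"
    then have "len z \<le> len (z \<cdot> (s \<cdot> t))" using zmin s by blast
    then show "len (z \<cdot> s) \<le> len (z \<cdot> s \<cdot> t)" using le c t by (simp add: W.m_assoc par_carrier)
  qed
  then have "\<forall>i\<in>I. 0 \<le> \<rho> (z \<cdot> s) (\<alpha> i)" using minimal_iff[of "z \<cdot> s"] c by simp
  then show ?thesis using matches_nonneg[OF z] by (intro coset_rep_unique[OF c(1) s]) simp_all
qed

text \<open>With \<open>y\<close> chosen to permute the simple roots of \<open>J\<close>, the
  product \<open>y \<cdot> x\<close> matches \<open>I\<close> with \<open>J\<close> and so is
  already the shortest element of its coset; the action becomes left multiplication.\<close>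

lemma N_act_ob_eq:
  assumes y: "matches y J J" and x: "matches x I J"
  shows "N_act_ob m J (ncoset J y) (x, I) = (y \<cdot> x, I)"
proof -
  have c: "y \<in> carrier G" "x \<in> carrier G" using x y matches_carrier by blast+
  have yx: "matches (y \<cdot> x) I J" using matches_mult[OF y x] .
  \<comment> \<open>The factor from \<open>par J\<close> can be moved past
    \<open>y \<cdot> x\<close>, so the product set is a single left coset of
    \<open>par I\<close>.\<close>
  have set: "w \<in> ncoset J y <#>\<^bsub>G\<^esub> (x <#\<^bsub>G\<^esub> par I) \<longleftrightarrow> (\<exists>s\<in>par I. w = y \<cdot> x \<cdot> s)" for w
  proof
    assume "w \<in> ncoset J y <#>\<^bsub>G\<^esub> (x <#\<^bsub>G\<^esub> par I)"
    then obtain t s where t: "t \<in> par J" "s \<in> par I" "w = t \<cdot> y \<cdot> (x \<cdot> s)"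
      by (auto simp: set_mult_def ncoset_def r_coset_def l_coset_def)
    have "t \<cdot> (y \<cdot> x) \<in> par J #>\<^bsub>G\<^esub> (y \<cdot> x)" using t by (auto simp: r_coset_def)
    then have "t \<cdot> (y \<cdot> x) \<in> (y \<cdot> x) <#\<^bsub>G\<^esub> par I" by (simp only: matches_parabolic_conj[OF yx])
    then obtain s' where s': "s' \<in> par I" "t \<cdot> (y \<cdot> x) = y \<cdot> x \<cdot> s'" by (auto simp: l_coset_def)
    have "w = t \<cdot> (y \<cdot> x) \<cdot> s" using t c by (simp add: W.m_assoc par_carrier)
    also have "\<dots> = y \<cdot> x \<cdot> (s' \<cdot> s)" unfolding s'(2) using s' t c by (simp add: W.m_assoc par_carrier)
    finally show "\<exists>s\<in>par I. w = y \<cdot> x \<cdot> s" using s' t by blast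
  next
    assume "\<exists>s\<in>par I. w = y \<cdot> x \<cdot> s"
    then obtain s where s: "s \<in> par I" "w = y \<cdot> x \<cdot> s" by blast
    have "w = \<one>\<^bsub>G\<^esub> \<cdot> y \<cdot> (x \<cdot> s)" using s c by (simp add: W.m_assoc par_carrier)
    moreover have "\<one>\<^bsub>G\<^esub> \<cdot> y \<in> ncoset J y" unfolding ncoset_def r_coset_def using par_one by blast
    moreover have "x \<cdot> s \<in> x <#\<^bsub>G\<^esub> par I" unfolding l_coset_def using s by blast
    ultimately show "w \<in> ncoset J y <#>\<^bsub>G\<^esub> (x <#\<^bsub>G\<^esub> par I)" unfolding set_mult_def by blast
  qed
  let ?P = "\<lambda>w. w \<in> ncoset J y <#>\<^bsub>G\<^esub> (x <#\<^bsub>G\<^esub> par I)"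
  have P0: "?P (y \<cdot> x)" unfolding set using c by (intro bexI[of _ "\<one>\<^bsub>G\<^esub>"]) simp_all
  have am: "?P (arg_min len ?P)" "len (arg_min len ?P) \<le> len (y \<cdot> x)"
    using arg_min_nat_lemma[of ?P, OF P0, of len] P0 by blast+
  obtain s where s: "s \<in> par I" "arg_min len ?P = y \<cdot> x \<cdot> s" using am(1) unfolding set by blast
  then have "s = \<one>\<^bsub>G\<^esub>" using am(2) by (intro minimal_unique[OF yx s(1)]) simp
  then have "arg_min len ?P = y \<cdot> x" using s c by simp
  then show ?thesis using x by (simp add: N_act_ob_def Cham_eq)
qed

text \<open>Left multiplication of both end points by \<open>y\<close> cancels in the label, which
  is why the action lies over \<open>BH_functor\<close>.\<close>

lemma N_act_ar_eq:
  assumes y: "matches y J J" and x: "matches x I J" and z: "matches z K J"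
  shows "N_act_ar m J (ncoset J y) ((x, I), iv x \<cdot> z, (z, K)) = ((y \<cdot> x, I), iv x \<cdot> z, (y \<cdot> z, K))"
proof -
  have c: "x \<in> carrier G" "y \<in> carrier G" "z \<in> carrier G" using x y z matches_carrier by blast+
  have "iv (y \<cdot> x) \<cdot> (y \<cdot> z) = iv x \<cdot> z" using c by (simp add: W.inv_mult_group W.m_assoc) (simp add: W.m_assoc[symmetric])
  moreover have "((x, I), iv x \<cdot> z, (z, K)) \<in> Ar (BHt m J)" using x z by (rule BHt_arI) simp
  ultimately show ?thesis
    using x z by (simp add: N_act_ar_def BHt_simps(3,4) N_act_ob_eq[OF y])
qed

lemma N_act_ext: "N_act_ob m J n \<in> extensional (Ob (BHt m J))" "N_act_ar m J n \<in> extensional (Ar (BHt m J))"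
  by (simp_all add: N_act_ob_def N_act_ar_def BHt_def)

lemma N_act_ob_mult:
  assumes "matches y J J" "matches z J J"
  shows "N_act_ob m J (ncoset J (y \<cdot> z)) = compose (Ob (BHt m J)) (N_act_ob m J (ncoset J y)) (N_act_ob m J (ncoset J z))"
proof (rule extensionalityI)
  fix P assume "P \<in> Ob (BHt m J)"
  then obtain x I where P: "P = (x, I)" "matches x I J" "P \<in> Ob (BHt m J)" by (auto simp: BHt_simps)
  then show "N_act_ob m J (ncoset J (y \<cdot> z)) P = compose (Ob (BHt m J)) (N_act_ob m J (ncoset J y)) (N_act_ob m J (ncoset J z)) P"
    using assms N_act_ob_eq[OF matches_mult[OF assms] P(2)] N_act_ob_eq[OF assms(2) P(2)]
      N_act_ob_eq[OF assms(1) matches_mult[OF assms(2) P(2)]] matches_carrier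
    by (simp add: compose_eq[OF P(3)[unfolded P(1)]] P(1) W.m_assoc matches_carrier[OF P(2)] matches_carrier[OF assms(1)] matches_carrier[OF assms(2)])
qed (rule N_act_ext, rule compose_extensional)

lemma N_act_ar_mult:
  assumes "matches y J J" "matches z J J"
  shows "N_act_ar m J (ncoset J (y \<cdot> z)) = compose (Ar (BHt m J)) (N_act_ar m J (ncoset J y)) (N_act_ar m J (ncoset J z))"
proof (rule extensionalityI)
  fix f assume f: "f \<in> Ar (BHt m J)"
  then obtain x I w K where P: "f = ((x, I), iv x \<cdot> w, (w, K))" "matches x I J" "matches w K J" by (rule BHt_arE)
  note zx = matches_mult[OF assms(2) P(2)] and zw = matches_mult[OF assms(2) P(3)]
  have c: "x \<in> carrier G" "y \<in> carrier G" "z \<in> carrier G" "w \<in> carrier G" using P assms matches_carrier by blast+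
  have e: "iv (z \<cdot> x) \<cdot> (z \<cdot> w) = iv x \<cdot> w" using c by (simp add: W.inv_mult_group W.m_assoc) (simp add: W.m_assoc[symmetric])
  show "N_act_ar m J (ncoset J (y \<cdot> z)) f = compose (Ar (BHt m J)) (N_act_ar m J (ncoset J y)) (N_act_ar m J (ncoset J z)) f"
    using N_act_ar_eq[OF matches_mult[OF assms] P(2,3)] N_act_ar_eq[OF assms(2) P(2,3)]
      N_act_ar_eq[OF assms(1) zx zw] c
    by (simp add: compose_eq[OF f[unfolded P(1)]] P(1) W.m_assoc e)
qed (rule N_act_ext, rule compose_extensional)

lemma N_act_one:
  "N_act_ob m J (ncoset J \<one>\<^bsub>G\<^esub>) = (\<lambda>P\<in>Ob (BHt m J). P)" "N_act_ar m J (ncoset J \<one>\<^bsub>G\<^esub>) = (\<lambda>f\<in>Ar (BHt m J). f)"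
proof -
  show "N_act_ob m J (ncoset J \<one>\<^bsub>G\<^esub>) = (\<lambda>P\<in>Ob (BHt m J). P)"
    by (rule extensionalityI[OF N_act_ext(1)])
      (auto simp: BHt_simps N_act_ob_eq[OF matches_one] matches_carrier)
  show "N_act_ar m J (ncoset J \<one>\<^bsub>G\<^esub>) = (\<lambda>f\<in>Ar (BHt m J). f)"
    by (rule extensionalityI[OF N_act_ext(2)])
      (auto elim!: BHt_arE simp: N_act_ar_eq[OF matches_one] matches_carrier)
qed

lemma N_act_functor:
  assumes y: "matches y J J"
  shows "groupoid_functor (BHt m J) (BHt m J) (N_act_ob m J (ncoset J y), N_act_ar m J (ncoset J y))"
proof (rule groupoid_functor.intro[OF groupoid_BHt groupoid_BHt], unfold_locales)
  fix P assume "P \<in> Ob (BHt m J)"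
  then obtain x I where P: "P = (x, I)" "matches x I J" by (auto simp: BHt_simps)
  show "fst (N_act_ob m J (ncoset J y), N_act_ar m J (ncoset J y)) P \<in> Ob (BHt m J)"
    using N_act_ob_eq[OF y P(2)] matches_mult[OF y P(2)] by (simp add: P BHt_simps)
  show "snd (N_act_ob m J (ncoset J y), N_act_ar m J (ncoset J y)) (idn (BHt m J) P) = idn (BHt m J) (fst (N_act_ob m J (ncoset J y), N_act_ar m J (ncoset J y)) P)"
    using N_act_ob_eq[OF y P(2)] N_act_ar_eq[OF y P(2) P(2)] matches_carrier[OF P(2)] by (simp add: P(1) BHt_simps)
next
  fix a assume "a \<in> Ar (BHt m J)"
  then obtain x I z K where a: "a = ((x, I), iv x \<cdot> z, (z, K))" "matches x I J" "matches z K J" by (rule BHt_arE)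
  have c: "x \<in> carrier G" "y \<in> carrier G" "z \<in> carrier G" using a y matches_carrier by blast+
  note e = N_act_ar_eq[OF y a(2,3)] N_act_ob_eq[OF y a(2)] N_act_ob_eq[OF y a(3)]
  have "iv (y \<cdot> x) \<cdot> (y \<cdot> z) = iv x \<cdot> z" using c by (simp add: W.inv_mult_group W.m_assoc) (simp add: W.m_assoc[symmetric])
  then show "snd (N_act_ob m J (ncoset J y), N_act_ar m J (ncoset J y)) a \<in> Ar (BHt m J)"
    using matches_mult[OF y a(2)] matches_mult[OF y a(3)] by (simp add: a(1) e BHt_arI)
  show "src (BHt m J) (snd (N_act_ob m J (ncoset J y), N_act_ar m J (ncoset J y)) a) = fst (N_act_ob m J (ncoset J y), N_act_ar m J (ncoset J y)) (src (BHt m J) a)"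
    "tgt (BHt m J) (snd (N_act_ob m J (ncoset J y), N_act_ar m J (ncoset J y)) a) = fst (N_act_ob m J (ncoset J y), N_act_ar m J (ncoset J y)) (tgt (BHt m J) a)"
    by (simp_all add: a(1) e BHt_simps(3,4))
next
  fix a b assume ab: "a \<in> Ar (BHt m J)" "b \<in> Ar (BHt m J)" "tgt (BHt m J) a = src (BHt m J) b"
  obtain x I z K where a: "a = ((x, I), iv x \<cdot> z, (z, K))" "matches x I J" "matches z K J" using ab(1) by (rule BHt_arE)
  obtain z' K' w L where b: "b = ((z', K'), iv z' \<cdot> w, (w, L))" "matches z' K' J" "matches w L J" using ab(2) by (rule BHt_arE)
  have e: "z' = z" "K' = K" using ab(3) by (simp_all add: a(1) b(1) BHt_simps(3,4))
  have c: "x \<in> carrier G" "z \<in> carrier G" "w \<in> carrier G" using a b matches_carrier by blast+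
  show "snd (N_act_ob m J (ncoset J y), N_act_ar m J (ncoset J y)) (cmp (BHt m J) a b) =
      cmp (BHt m J) (snd (N_act_ob m J (ncoset J y), N_act_ar m J (ncoset J y)) a) (snd (N_act_ob m J (ncoset J y), N_act_ar m J (ncoset J y)) b)"
    using N_act_ar_eq[OF y a(2) b(3)] N_act_ar_eq[OF y a(2,3)] N_act_ar_eq[OF y a(3) b(3)] c
    by (simp add: a(1) b(1) e BHt_simps(6) inv_mult_cancel)
qed

lemma N_act_iso:
  assumes y: "matches y J J"
  shows "groupoid_iso (BHt m J) (BHt m J) (N_act_ob m J (ncoset J y), N_act_ar m J (ncoset J y))"
proof -
  have c: "y \<in> carrier G" using matches_carrier[OF y] .
  note y' = matches_inv[OF y]
  interpret F: groupoid_functor "BHt m J" "BHt m J" "(N_act_ob m J (ncoset J y), N_act_ar m J (ncoset J y))" by (rule N_act_functor[OF y])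
  interpret F': groupoid_functor "BHt m J" "BHt m J" "(N_act_ob m J (ncoset J (iv y)), N_act_ar m J (ncoset J (iv y)))" by (rule N_act_functor[OF y'])
  show ?thesis
  proof
    show "bij_betw (fst (N_act_ob m J (ncoset J y), N_act_ar m J (ncoset J y))) (Ob (BHt m J)) (Ob (BHt m J))"
      unfolding fst_conv
      by (rule compose_id_bij[of _ _ "N_act_ob m J (ncoset J (iv y))"])
        (use F.ob_closed F'.ob_closed c in \<open>simp_all add: N_act_ob_mult[symmetric] y y' N_act_one\<close>)
    show "bij_betw (snd (N_act_ob m J (ncoset J y), N_act_ar m J (ncoset J y))) (Ar (BHt m J)) (Ar (BHt m J))"
      unfolding snd_conv
      by (rule compose_id_bij[of _ _ "N_act_ar m J (ncoset J (iv y))"])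
        (use F.ar_closed F'.ar_closed c in \<open>simp_all add: N_act_ar_mult[symmetric] y y' N_act_one\<close>)
  qed
qed

lemma N_act_free:
  assumes y: "matches y J J" and x: "matches x I J" and eq: "N_act_ob m J (ncoset J y) (x, I) = (x, I)"
  shows "y = \<one>\<^bsub>G\<^esub>"
proof -
  have c: "x \<in> carrier G" "y \<in> carrier G" using x y matches_carrier by blast+
  have "y \<cdot> x = x" using eq N_act_ob_eq[OF y x] by simp
  then show ?thesis using c by (simp add: W.l_cancel_one')
qed

lemma N_act_group_action:
  shows "group_action (NWJ m J) (Ob (BHt m J)) (N_act_ob m J)" "group_action (NWJ m J) (Ar (BHt m J)) (N_act_ar m J)"
proof -
  have *: "group_action (NWJ m J) E \<phi>"
    if B: "\<And>y. matches y J J \<Longrightarrow> \<phi> (ncoset J y) \<in> Bij E"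
      and C: "\<And>y z. \<lbrakk>matches y J J; matches z J J\<rbrakk> \<Longrightarrow> \<phi> (ncoset J (y \<cdot> z)) = compose E (\<phi> (ncoset J y)) (\<phi> (ncoset J z))"
    for E and \<phi> :: "'v list set set \<Rightarrow> 'e \<Rightarrow> 'e"
  proof (intro group_action.intro group_hom.intro group_NWJ group_BijGroup group_hom_axioms.intro homI)
    fix n assume "n \<in> carrier (NWJ m J)"
    then obtain y where y: "matches y J J" "n = ncoset J y" by (rule NWJ_carrierE)
    then show "\<phi> n \<in> carrier (BijGroup E)" using B by (simp add: BijGroup_def)
    fix n' assume "n' \<in> carrier (NWJ m J)"
    then obtain z where z: "matches z J J" "n' = ncoset J z" by (rule NWJ_carrierE)
    show "\<phi> (n \<otimes>\<^bsub>NWJ m J\<^esub> n') = \<phi> n \<otimes>\<^bsub>BijGroup E\<^esub> \<phi> n'"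
      using y z B C by (simp add: BijGroup_def ncoset_mult)
  qed
  show "group_action (NWJ m J) (Ob (BHt m J)) (N_act_ob m J)"
    by (rule *) (use groupoid_iso.bij_ob[OF N_act_iso] in \<open>simp_all add: Bij_def N_act_ext N_act_ob_mult\<close>)
  show "group_action (NWJ m J) (Ar (BHt m J)) (N_act_ar m J)"
    by (rule *) (use groupoid_iso.bij_ar[OF N_act_iso] in \<open>simp_all add: Bij_def N_act_ext N_act_ar_mult\<close>)
qed

lemma N_act_free_groupoid_action: "free_groupoid_action (NWJ m J) (BHt m J) (N_act_ob m J) (N_act_ar m J)"
proof (intro free_groupoid_action.intro free_groupoid_action_axioms.intro groupoid_BHt N_act_group_action)
  fix n assume "n \<in> carrier (NWJ m J)"
  then obtain y where y: "matches y J J" "n = ncoset J y" by (rule NWJ_carrierE)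
  then show "groupoid_functor (BHt m J) (BHt m J) (N_act_ob m J n, N_act_ar m J n)" by (simp add: N_act_functor)
  fix P assume "P \<in> Ob (BHt m J)" "N_act_ob m J n P = P"
  then have "y = \<one>\<^bsub>G\<^esub>" using N_act_free[OF y(1)] y(2) by (auto simp: BHt_simps)
  then show "n = \<one>\<^bsub>NWJ m J\<^esub>" by (simp add: y NWJ_one)
qed

section \<open>Deck transformations of the covering\<close>

lemma N_act_over_BH:
  assumes y: "matches y J J"
  shows "P \<in> Ob (BHt m J) \<Longrightarrow> fst BH_functor (N_act_ob m J (ncoset J y) P) = fst BH_functor P"
    "f \<in> Ar (BHt m J) \<Longrightarrow> snd BH_functor (N_act_ar m J (ncoset J y) f) = snd BH_functor f"
proof -
  show "P \<in> Ob (BHt m J) \<Longrightarrow> fst BH_functor (N_act_ob m J (ncoset J y) P) = fst BH_functor P"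
    by (auto simp: BHt_simps N_act_ob_eq[OF y] BH_functor_simps)
  show "f \<in> Ar (BHt m J) \<Longrightarrow> snd BH_functor (N_act_ar m J (ncoset J y) f) = snd BH_functor f"
    by (auto elim!: BHt_arE simp: N_act_ar_eq[OF y] BH_functor_simps)
qed

text \<open>A deck transformation is determined by the image of the base chamber \<open>(1, J)\<close>, since every
  chamber \<open>(x, I)\<close> is the end of the lift of \<open>x\<close> starting there.\<close>

lemma deck_iso: "(\<lambda>n. (N_act_ob m J n, N_act_ar m J n)) \<in> iso (NWJ m J) (deck_group (BHt m J) BH_functor)"
proof -
  let ?\<theta> = "\<lambda>n. (N_act_ob m J n, N_act_ar m J n)" and ?D = "deck_group (BHt m J) BH_functor"
  have cl: "?\<theta> n \<in> carrier ?D" if n: "n \<in> carrier (NWJ m J)" for n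
  proof -
    obtain y where y: "matches y J J" "n = ncoset J y" using n by (rule NWJ_carrierE)
    then show ?thesis
      using N_act_iso[OF y(1)] N_act_over_BH[OF y(1)] by (simp add: deck_group_def N_act_ext)
  qed
  have hom: "?\<theta> \<in> hom (NWJ m J) ?D"
  proof (rule homI[OF cl])
    fix n n' assume n: "n \<in> carrier (NWJ m J)" and n': "n' \<in> carrier (NWJ m J)"
    obtain y where y: "matches y J J" "n = ncoset J y" using n by (rule NWJ_carrierE)
    obtain z where z: "matches z J J" "n' = ncoset J z" using n' by (rule NWJ_carrierE)
    show "?\<theta> (n \<otimes>\<^bsub>NWJ m J\<^esub> n') = ?\<theta> n \<otimes>\<^bsub>?D\<^esub> ?\<theta> n'"
      using y z by (simp add: deck_group_def ncoset_mult N_act_ob_mult N_act_ar_mult)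
  qed
  have inj: "inj_on ?\<theta> (carrier (NWJ m J))"
  proof (rule inj_onI)
    fix n n' assume n: "n \<in> carrier (NWJ m J)" and n': "n' \<in> carrier (NWJ m J)" and eq: "?\<theta> n = ?\<theta> n'"
    obtain y where y: "matches y J J" "n = ncoset J y" using n by (rule NWJ_carrierE)
    obtain z where z: "matches z J J" "n' = ncoset J z" using n' by (rule NWJ_carrierE)
    have "N_act_ob m J n (\<one>\<^bsub>G\<^esub>, J) = N_act_ob m J n' (\<one>\<^bsub>G\<^esub>, J)" using eq by simp
    then show "n = n'"
      using y z N_act_ob_eq[OF y(1) matches_one] N_act_ob_eq[OF z(1) matches_one] by (simp add: matches_carrier)
  qed
  have surj: "d \<in> ?\<theta> ` carrier (NWJ m J)" if d: "d \<in> carrier ?D" for d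
  proof -
  obtain f g where fg: "d = (f, g)" by (metis surj_pair)
  have ext: "f \<in> extensional (Ob (BHt m J))" "g \<in> extensional (Ar (BHt m J))"
    and iso: "groupoid_iso (BHt m J) (BHt m J) (f, g)"
    and Ff: "\<And>P. P \<in> Ob (BHt m J) \<Longrightarrow> fst BH_functor (f P) = fst BH_functor P"
    and Fg: "\<And>a. a \<in> Ar (BHt m J) \<Longrightarrow> snd BH_functor (g a) = snd BH_functor a"
    using d by (auto simp: deck_group_def fg)
  interpret d: groupoid_iso "BHt m J" "BHt m J" "(f, g)" by (rule iso)
  have base: "(\<one>\<^bsub>G\<^esub>, J) \<in> Ob (BHt m J)" by (simp add: BHt_simps matches_one)
  obtain y where y: "f (\<one>\<^bsub>G\<^esub>, J) = (y, J)" "matches y J J"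
    using d.ob_closed[OF base] Ff[OF base] by (auto simp: BHt_simps BH_functor_simps)
  have yc: "y \<in> carrier G" using matches_carrier[OF y(2)] .
  have fx: "f (x, I) = (y \<cdot> x, I)" if x: "matches x I J" for x I
  proof -
    have xc: "x \<in> carrier G" using matches_carrier[OF x] .
    define a where "a = ((\<one>\<^bsub>G\<^esub>, J), x, (x, I))"
    have a: "a \<in> Ar (BHt m J)" unfolding a_def using x xc by (intro BHt_arI matches_one) simp_all
    have "g a \<in> Ar (BHt m J)" using d.ar_closed[OF a] by simp
    then obtain u K w L where ga: "g a = ((u, K), iv u \<cdot> w, (w, L))" "matches w L J" by (rule BHt_arE)
    have "src (BHt m J) (g a) = f (\<one>\<^bsub>G\<^esub>, J)" "tgt (BHt m J) (g a) = f (x, I)"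
      using d.map_src[OF a] d.map_tgt[OF a] by (simp_all add: a_def BHt_simps(3,4))
    then have e: "u = y" "f (x, I) = (w, L)" by (simp_all add: ga(1) y BHt_simps(3,4))
    have "iv u \<cdot> w = x" "L = I" using Fg[OF a, unfolded ga(1)] by (simp_all add: a_def BH_functor_simps)
    moreover have "y \<cdot> (iv y \<cdot> w) = w" using yc matches_carrier[OF ga(2)] by (simp add: W.m_assoc[symmetric])
    ultimately show ?thesis using e by simp
  qed
  have "f = N_act_ob m J (ncoset J y)"
    by (rule extensionalityI[OF ext(1) N_act_ext(1)]) (auto simp: BHt_simps fx N_act_ob_eq[OF y(2)])
  \<comment> \<open>The end points of \<open>g a\<close> are known from \<open>f\<close>, and its
    label is that of \<open>a\<close> because the transformation lies over
    \<open>BH_functor\<close>.\<close>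
  moreover have "g = N_act_ar m J (ncoset J y)"
  proof (rule extensionalityI[OF ext(2) N_act_ext(2)])
    fix a assume a: "a \<in> Ar (BHt m J)"
    then obtain x I z K where aa: "a = ((x, I), iv x \<cdot> z, (z, K))" "matches x I J" "matches z K J" by (rule BHt_arE)
    have "g a \<in> Ar (BHt m J)" using d.ar_closed[OF a] by simp
    then obtain u M w L where ga: "g a = ((u, M), iv u \<cdot> w, (w, L))" by (rule BHt_arE)
    have "src (BHt m J) (g a) = f (x, I)" "tgt (BHt m J) (g a) = f (z, K)"
      using d.map_src[OF a] d.map_tgt[OF a] by (simp_all add: aa(1) BHt_simps(3,4))
    then have e: "(u, M) = (y \<cdot> x, I)" "(w, L) = (y \<cdot> z, K)"
      by (simp_all add: ga(1) BHt_simps(3,4) fx[OF aa(2)] fx[OF aa(3)])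
    have "iv u \<cdot> w = iv x \<cdot> z" using Fg[OF a, unfolded ga(1)] by (simp add: aa(1) BH_functor_simps)
    then show "g a = N_act_ar m J (ncoset J y) a"
      unfolding aa(1) N_act_ar_eq[OF y(2) aa(2,3)] using ga(1) e by (simp add: aa(1))
  qed
  ultimately show ?thesis
    using NWJ_carrierI[OF y(2)] fg by blast
  qed
  from cl surj have "?\<theta> ` carrier (NWJ m J) = carrier ?D" by blast
  with hom inj show ?thesis by (simp add: iso_def bij_betw_def)
qed

section \<open>Orbits of the action as fibres of the covering\<close>

lemma orbit_ob_iff:
  assumes P: "P \<in> Ob (BHt m J)" and Q: "Q \<in> Ob (BHt m J)"
  shows "fst BH_functor P = fst BH_functor Q \<longleftrightarrow> (\<exists>n\<in>carrier (NWJ m J). N_act_ob m J n P = Q)"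
proof
  assume eq: "fst BH_functor P = fst BH_functor Q"
  then obtain x z I where x: "P = (x, I)" "matches x I J" and z: "Q = (z, I)" "matches z I J"
    using P Q by (auto simp: BHt_simps BH_functor_simps)
  have c: "x \<in> carrier G" "z \<in> carrier G" using x z matches_carrier by blast+
  \<comment> \<open>The only element whose left multiplication takes \<open>x\<close> to
    \<open>z\<close>; it matches \<open>J\<close> with itself because it passes through
    \<open>I\<close>.\<close>
  have y: "matches (z \<cdot> iv x) J J" using matches_mult[OF z(2) matches_inv[OF x(2)]] .
  have "N_act_ob m J (ncoset J (z \<cdot> iv x)) P = Q"
    using N_act_ob_eq[OF y x(2)] c by (simp add: x z W.m_assoc)
  then show "\<exists>n\<in>carrier (NWJ m J). N_act_ob m J n P = Q" using NWJ_carrierI[OF y] by blast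
next
  assume "\<exists>n\<in>carrier (NWJ m J). N_act_ob m J n P = Q"
  then show "fst BH_functor P = fst BH_functor Q" using N_act_over_BH(1)[OF _ P] NWJ_carrierE by metis
qed

lemma orbit_ar_iff:
  assumes a: "a \<in> Ar (BHt m J)" and b: "b \<in> Ar (BHt m J)"
  shows "snd BH_functor a = snd BH_functor b \<longleftrightarrow> (\<exists>n\<in>carrier (NWJ m J). N_act_ar m J n a = b)"
proof
  assume eq: "snd BH_functor a = snd BH_functor b"
  obtain x I w K where aa: "a = ((x, I), iv x \<cdot> w, (w, K))" "matches x I J" "matches w K J" using a by (rule BHt_arE)
  obtain x' I' w' K' where bb: "b = ((x', I'), iv x' \<cdot> w', (w', K'))" "matches x' I' J" "matches w' K' J" using b by (rule BHt_arE)
  have e: "I' = I" "K' = K" "iv x' \<cdot> w' = iv x \<cdot> w" using eq by (simp_all add: aa(1) bb(1) BH_functor_simps)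
  have c: "x \<in> carrier G" "w \<in> carrier G" "x' \<in> carrier G" "w' \<in> carrier G" using aa bb matches_carrier by blast+
  \<comment> \<open>The sources force this element; equality of the labels makes it carry the target
    \<open>w\<close> to \<open>w'\<close> as well.\<close>
  have y: "matches (x' \<cdot> iv x) J J" using matches_mult[OF bb(2)[unfolded e] matches_inv[OF aa(2)]] .
  have "x' \<cdot> iv x \<cdot> w = x' \<cdot> (iv x' \<cdot> w')" using c e(3) by (simp add: W.m_assoc)
  also have "\<dots> = w'" using c by (simp add: W.m_assoc[symmetric])
  finally have "N_act_ar m J (ncoset J (x' \<cdot> iv x)) a = b"
    using N_act_ar_eq[OF y aa(2,3)] c by (simp add: aa(1) bb(1) e W.m_assoc)
  then show "\<exists>n\<in>carrier (NWJ m J). N_act_ar m J n a = b" using NWJ_carrierI[OF y] by blast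
next
  assume "\<exists>n\<in>carrier (NWJ m J). N_act_ar m J n a = b"
  then show "snd BH_functor a = snd BH_functor b" using N_act_over_BH(2)[OF _ a] NWJ_carrierE by metis
qed

lemma BH_functor_surj:
  "fst BH_functor ` Ob (BHt m J) = Ob (BH m J)" "snd BH_functor ` Ar (BHt m J) = Ar (BH m J)"
proof -
  interpret F: groupoid_functor "BHt m J" "BH m J" BH_functor by (rule BH_functor)
  have "I \<in> fst BH_functor ` Ob (BHt m J)" if "I \<in> Ob (BH m J)" for I
  proof -
    obtain x where "matches x I J" using \<open>I \<in> Ob (BH m J)\<close> by (auto simp: BH_simps)
    then have "(x, I) \<in> Ob (BHt m J)" by (simp add: BHt_simps)
    then show ?thesis by (metis BH_functor_simps(1) imageI)
  qed
  then show "fst BH_functor ` Ob (BHt m J) = Ob (BH m J)" using F.ob_closed by blast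
  have "a \<in> snd BH_functor ` Ar (BHt m J)" if "a \<in> Ar (BH m J)" for a
  proof -
    obtain I g K x where a: "a = (I, g, K)" "matches g K I" "matches x I J" using \<open>a \<in> Ar (BH m J)\<close> by (rule BH_arE)
    have c: "x \<in> carrier G" "g \<in> carrier G" using a matches_carrier by blast+
    have "((x, I), g, (x \<cdot> g, K)) \<in> Ar (BHt m J)"
      using a c matches_mult[OF a(3,2)] by (intro BHt_arI) (simp_all add: W.m_assoc[symmetric])
    then show ?thesis by (metis BH_functor_simps(2) a(1) imageI)
  qed
  then show "snd BH_functor ` Ar (BHt m J) = Ar (BH m J)" using F.ar_closed by blast
qed

end

theorem theorem1p3:
  fixes m :: "'v::finite \<Rightarrow> 'v \<Rightarrow> enat" and J :: "'v set"
  assumes "coxeter_diagram m"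
  shows "bij_betw (chamber_of m) (Ob (BHt m J)) (chambers m J) \<and>
    groupoid_functor (BHt m J) (BH m J) BH_functor \<and>
    universal_groupoid_covering (BHt m J) (BH m J) BH_functor \<and>
    generates_groupoid (BHt m J) (simple_wall_crossings m J) \<and>
    (\<lambda>n. (N_act_ob m J n, N_act_ar m J n)) \<in> iso (NWJ m J) (deck_group (BHt m J) BH_functor) \<and>
    free_groupoid_action (NWJ m J) (BHt m J) (N_act_ob m J) (N_act_ar m J) \<and>
    (\<exists>\<Phi>. groupoid_iso (quotient_groupoid (NWJ m J) (N_act_ob m J) (N_act_ar m J) (BHt m J)) (BH m J) \<Phi> \<and>
      (\<forall>P\<in>Ob (BHt m J). fst \<Phi> (orbit (NWJ m J) (N_act_ob m J) P) = fst BH_functor P) \<and>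
      (\<forall>f\<in>Ar (BHt m J). snd \<Phi> (orbit (NWJ m J) (N_act_ar m J) f) = snd BH_functor f))"
proof -
  interpret coxeter_diagram m by (rule assms)
  define \<Phi> where "\<Phi> = (\<lambda>X :: ('v list set \<times> 'v set) set. fst BH_functor (SOME P. P \<in> X),
    \<lambda>A :: 'v cham_arrow set. snd BH_functor (SOME f. f \<in> A))"
  have Q: "groupoid_iso (quotient_groupoid (NWJ m J) (N_act_ob m J) (N_act_ar m J) (BHt m J)) (BH m J) \<Phi>"
    "\<And>P. P \<in> Ob (BHt m J) \<Longrightarrow> fst \<Phi> (orbit (NWJ m J) (N_act_ob m J) P) = fst BH_functor P"
    "\<And>f. f \<in> Ar (BHt m J) \<Longrightarrow> snd \<Phi> (orbit (NWJ m J) (N_act_ar m J) f) = snd BH_functor f"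
    unfolding \<Phi>_def
    by (rule quotient_groupoid_iso[OF N_act_free_groupoid_action BH_functor BH_functor_surj orbit_ob_iff orbit_ar_iff];
        assumption)+
  have "\<exists>\<Phi>. groupoid_iso (quotient_groupoid (NWJ m J) (N_act_ob m J) (N_act_ar m J) (BHt m J)) (BH m J) \<Phi> \<and>
      (\<forall>P\<in>Ob (BHt m J). fst \<Phi> (orbit (NWJ m J) (N_act_ob m J) P) = fst BH_functor P) \<and>
      (\<forall>f\<in>Ar (BHt m J). snd \<Phi> (orbit (NWJ m J) (N_act_ar m J) f) = snd BH_functor f)"
    using Q by (intro exI[of _ \<Phi>]) blast
  moreover have "Ob (BHt m J) = Cham m J" by (simp add: BHt_def)
  ultimately show ?thesis
    using bij_betw_chambers BH_functor BH_universal_covering generates_BHt deck_iso N_act_free_groupoid_action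
    by simp
qed

end
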